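(* Let $B$ be a $\mathbf{k}$-hereditary left regular band with a finite group $G$ acting by semigroup automorphisms, where $\mathbf{k}$ is a field with $\mathrm{char}(\mathbf{k})\nmid|G|$. Fix a $G$-invariant standardly indexed cfpoi $\{E_X\}$ of $\mathbf{k} B$ and put $E_{[X]}=\sum_{X'\in[X]}E_{X'}$. Let $[X]<[Y]$ in $\Lambda(B)/G$, and for each support $Z$ with $[X]<[Z]\le[Y]$ fix $b_Z\in B$ with $\sigma(b_Z)=Z$. Then, as $G$-representations, \[E_{[Y]}\cdot\mathbf{k} B\cdot E_{[X]}\cong\bigoplus_{\substack{m\ge1,\\ [X_0<X_1<\cdots<X_m]:\\ X_0\in[X],\,X_m\in[Y]}}\Big(\bigotimes_{i=1}^m\widetilde{H}_0\big(\widetilde{B^{<b_{X_i}}_{\ge X_{i-1}}};\mathbf{k}\big)\Big)\Big\uparrow_{\bigcap_iG_{X_i}}^{G},\] the inner sum over $G$-orbits of strict chains in $\Lambda(B)$ (one representative chosen per orbit).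
   Context: A left regular band (LRB) is a finite semigroup $B$ with $x^2=x$, $xyx=xy$. For $b\in B$, $\sigma(b)=Bb$; $\Lambda(B)$ (principal left ideals ordered by inclusion) is the support semilattice; $G$ acts on it by $g(Bb)=Bg(b)$; $G_X$ is the stabilizer and $[X]$ the orbit of $X$; the orbit poset $\Lambda(B)/G$ has $[X]\le[Y]$ iff $X'\le Y'$ for some representatives. Semigroup order: $x\le y$ iff $yx=x$; $B$ is connected if each $B_{\ge X}=\{b:\sigma(b)\ge X\}$ has connected Hasse diagram; $\mathbf{k}$-hereditary means connected with $\mathbf{k} B$ hereditary (all left ideals projective). For $W<Z$ and $\sigma(b)=Z$, $B^{<b}_{\ge W}=\{a:a<b,\ \sigma(a)\ge W\}$ with the action $g\ast a=b\cdot g(a)$ of subgroups of $G_W\cap G_Z$ (indicated by the tilde); $\widetilde H_0$ is reduced $0$-th homology of the order complex; factors are restricted to $\bigcap_iG_{X_i}$ and tensored over $\mathbf{k}$. The simple $M_X$ is one-dimensional with $b$ acting by $1$ if $\sigma(b)\ge X$, else $0$; a cfpoi $\{E_X\}$ is standardly indexed if $\mathbf{k} BE_X/\mathrm{rad}(\mathbf{k} B)E_X\cong M_X$ and $G$-invariant if $g(E_X)=E_{g(X)}$. *)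

theory Defs
  imports Complex_Main "HOL-Algebra.Group_Action" "HOL-Library.Poly_Mapping"
begin

section \<open>Left regular bands\<close>

class left_regular_band = semigroup_mult + finite +
  assumes band: "x * x = x"
    and left_regular: "x * y * x = x * y"

definition band_le :: "'b::left_regular_band \<Rightarrow> 'b \<Rightarrow> bool" where
  "band_le x y \<longleftrightarrow> y * x = x"

definition band_less :: "'b::left_regular_band \<Rightarrow> 'b \<Rightarrow> bool" where
  "band_less x y \<longleftrightarrow> band_le x y \<and> x \<noteq> y"

definition supp :: "'b::left_regular_band \<Rightarrow> 'b set" where
  "supp b = {a * b | a. True}"

text \<open>The support semilattice; its order is inclusion of sets.\<close>

definition supports :: "'b::left_regular_band set set" where
  "supports = {supp b | b. True}"

definition band_above :: "'b::left_regular_band set \<Rightarrow> 'b set" where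
  "band_above X = {b. X \<subseteq> supp b}"

definition hasse_edge :: "'b::left_regular_band set \<Rightarrow> 'b \<Rightarrow> 'b \<Rightarrow> bool" where
  "hasse_edge P x y \<longleftrightarrow> x \<in> P \<and> y \<in> P \<and> band_less x y
     \<and> \<not> (\<exists>z\<in>P. band_less x z \<and> band_less z y)"

definition hasse_connected :: "'b::left_regular_band set \<Rightarrow> bool" where
  "hasse_connected P \<longleftrightarrow> P \<noteq> {} \<and>
     (\<forall>x\<in>P. \<forall>y\<in>P. (\<lambda>u v. hasse_edge P u v \<or> hasse_edge P v u)\<^sup>*\<^sup>* x y)"

definition connected_band :: "'b::left_regular_band itself \<Rightarrow> bool" where
  "connected_band _ \<longleftrightarrow> (\<forall>X\<in>(supports :: 'b set set). hasse_connected (band_above X))"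

section \<open>Vector spaces with a linear action\<close>

text \<open>
  The type \<^typ>\<open>'i \<Rightarrow>\<^sub>0 'k\<close> is the free vector space on \<^typ>\<open>'i\<close>, with basis vectors
  \<^term>\<open>Poly_Mapping.single i 1\<close>.
\<close>

definition pscale :: "'k::field \<Rightarrow> ('i \<Rightarrow>\<^sub>0 'k) \<Rightarrow> ('i \<Rightarrow>\<^sub>0 'k)" where
  "pscale c = Poly_Mapping.map (\<lambda>x. c * x)"

lemma lookup_pscale: "Poly_Mapping.lookup (pscale c p) i = c * Poly_Mapping.lookup p i"
  by (simp add: pscale_def Poly_Mapping.map.rep_eq when_def)

interpretation free: vector_space "pscale :: 'k::field \<Rightarrow> ('i \<Rightarrow>\<^sub>0 'k) \<Rightarrow> ('i \<Rightarrow>\<^sub>0 'k)"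
  by unfold_locales
    (auto intro!: poly_mapping_eqI simp: lookup_pscale lookup_add algebra_simps)

text \<open>The linear extension of a map of basis elements.\<close>

definition pushforward :: "('i \<Rightarrow> 'j) \<Rightarrow> ('i \<Rightarrow>\<^sub>0 'k::field) \<Rightarrow> ('j \<Rightarrow>\<^sub>0 'k)" where
  "pushforward f p =
     (\<Sum>i\<in>Poly_Mapping.keys p. Poly_Mapping.single (f i) (Poly_Mapping.lookup p i))"

text \<open>
  A vector space on an explicit carrier, together with linear operators indexed by
  \<^typ>\<open>'s\<close>.  The operators in a set \<open>S\<close> of indices are what homomorphisms must respect:
  \<open>S\<close> is the carrier of a group for group representations, and \<^term>\<open>UNIV\<close> (all of \<open>B\<close>)
  for modules over the semigroup algebra of \<open>B\<close>.
\<close>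

record ('k, 's, 'v) rep =
  rcarrier :: "'v set"
  radd :: "'v \<Rightarrow> 'v \<Rightarrow> 'v"
  rscale :: "'k \<Rightarrow> 'v \<Rightarrow> 'v"
  ract :: "'s \<Rightarrow> 'v \<Rightarrow> 'v"

definition rep_hom ::
  "'s set \<Rightarrow> ('k, 's, 'v) rep \<Rightarrow> ('k, 's, 'w) rep \<Rightarrow> ('v \<Rightarrow> 'w) set" where
  "rep_hom S V W = {f. (\<forall>v\<in>rcarrier V. f v \<in> rcarrier W)
     \<and> (\<forall>u\<in>rcarrier V. \<forall>v\<in>rcarrier V. f (radd V u v) = radd W (f u) (f v))
     \<and> (\<forall>c. \<forall>v\<in>rcarrier V. f (rscale V c v) = rscale W c (f v))
     \<and> (\<forall>s\<in>S. \<forall>v\<in>rcarrier V. f (ract V s v) = ract W s (f v))}"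

definition rep_iso :: "'s set \<Rightarrow> ('k, 's, 'v) rep \<Rightarrow> ('k, 's, 'w) rep \<Rightarrow> bool" where
  "rep_iso S V W \<longleftrightarrow> (\<exists>f\<in>rep_hom S V W. bij_betw f (rcarrier V) (rcarrier W))"

definition sub_rep ::
  "('i \<Rightarrow>\<^sub>0 'k::field) set \<Rightarrow> ('s \<Rightarrow> ('i \<Rightarrow>\<^sub>0 'k) \<Rightarrow> ('i \<Rightarrow>\<^sub>0 'k)) \<Rightarrow> ('k, 's, 'i \<Rightarrow>\<^sub>0 'k) rep"
where
  "sub_rep V act = \<lparr>rcarrier = V, radd = (+), rscale = pscale, ract = act\<rparr>"

definition rcoset :: "('k, 's, 'v) rep \<Rightarrow> 'v set \<Rightarrow> 'v \<Rightarrow> 'v set" where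
  "rcoset V U v = radd V v ` U"

text \<open>
  The quotient by an invariant subspace.  Operations on cosets are computed on all
  representatives, so that for instance the zero multiple of a coset is \<open>U\<close>.
\<close>

definition quotient_rep :: "('k, 's, 'v) rep \<Rightarrow> 'v set \<Rightarrow> ('k, 's, 'v set) rep" where
  "quotient_rep V U =
     \<lparr>rcarrier = rcoset V U ` rcarrier V,
      radd = (\<lambda>A A'. \<Union>a\<in>A. \<Union>a'\<in>A'. rcoset V U (radd V a a')),
      rscale = (\<lambda>c A. \<Union>a\<in>A. rcoset V U (rscale V c a)),
      ract = (\<lambda>s A. \<Union>a\<in>A. rcoset V U (ract V s a))\<rparr>"

text \<open>External direct sum over a finite index set.\<close>

definition direct_sum_rep :: "'r set \<Rightarrow> ('r \<Rightarrow> ('k, 's, 'v) rep) \<Rightarrow> ('k, 's, 'r \<Rightarrow> 'v) rep" where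
  "direct_sum_rep R V =
     \<lparr>rcarrier = (\<Pi>\<^sub>E r\<in>R. rcarrier (V r)),
      radd = (\<lambda>f f'. \<lambda>r\<in>R. radd (V r) (f r) (f' r)),
      rscale = (\<lambda>c f. \<lambda>r\<in>R. rscale (V r) c (f r)),
      ract = (\<lambda>s f. \<lambda>r\<in>R. ract (V r) s (f r))\<rparr>"

text \<open>
  The tensor product over the ground field of a list of spaces, with diagonal action: the free
  vector space on tuples of vectors modulo multilinearity.
\<close>

definition tensor_relations :: "('k::field, 's, 'v) rep list \<Rightarrow> ('v list \<Rightarrow>\<^sub>0 'k) set" where
  "tensor_relations Vs =
     {Poly_Mapping.single (vs[i := radd (Vs ! i) u w]) 1
        - Poly_Mapping.single (vs[i := u]) 1 - Poly_Mapping.single (vs[i := w]) 1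
      | vs i u w. vs \<in> listset (map rcarrier Vs) \<and> i < length Vs
          \<and> u \<in> rcarrier (Vs ! i) \<and> w \<in> rcarrier (Vs ! i)}
   \<union> {Poly_Mapping.single (vs[i := rscale (Vs ! i) c u]) 1
        - pscale c (Poly_Mapping.single (vs[i := u]) 1)
      | vs i u c. vs \<in> listset (map rcarrier Vs) \<and> i < length Vs \<and> u \<in> rcarrier (Vs ! i)}"

definition tensor_rep ::
  "('k::field, 's, 'v) rep list \<Rightarrow> ('k, 's, ('v list \<Rightarrow>\<^sub>0 'k) set) rep" where
  "tensor_rep Vs =
     quotient_rep
       (sub_rep {p. Poly_Mapping.keys p \<subseteq> listset (map rcarrier Vs)}
         (\<lambda>s. pushforward (map2 (\<lambda>V v. ract V s v) Vs)))
       (free.span (tensor_relations Vs))"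

text \<open>
  The induced representation \<open>kG \<otimes>\<^bsub>kH\<^esub> W\<close>: the basis element \<open>(x, w)\<close> stands for \<open>x \<otimes> w\<close>.
\<close>

definition induced_relations ::
  "('g, 'm) monoid_scheme \<Rightarrow> 'g set \<Rightarrow> ('k::field, 'g, 'w) rep \<Rightarrow> ('g \<times> 'w \<Rightarrow>\<^sub>0 'k) set" where
  "induced_relations G H W =
     {Poly_Mapping.single (x, radd W w w') 1
        - Poly_Mapping.single (x, w) 1 - Poly_Mapping.single (x, w') 1
      | x w w'. x \<in> carrier G \<and> w \<in> rcarrier W \<and> w' \<in> rcarrier W}
   \<union> {Poly_Mapping.single (x, rscale W c w) 1 - pscale c (Poly_Mapping.single (x, w) 1)
      | x w c. x \<in> carrier G \<and> w \<in> rcarrier W}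
   \<union> {Poly_Mapping.single (x \<otimes>\<^bsub>G\<^esub> h, w) 1 - Poly_Mapping.single (x, ract W h w) 1
      | x h w. x \<in> carrier G \<and> h \<in> H \<and> w \<in> rcarrier W}"

definition induced_rep ::
  "('g, 'm) monoid_scheme \<Rightarrow> 'g set \<Rightarrow> ('k::field, 'g, 'w) rep
    \<Rightarrow> ('k, 'g, ('g \<times> 'w \<Rightarrow>\<^sub>0 'k) set) rep" where
  "induced_rep G H W =
     quotient_rep
       (sub_rep {p. Poly_Mapping.keys p \<subseteq> carrier G \<times> rcarrier W}
         (\<lambda>g. pushforward (\<lambda>(x, w). (g \<otimes>\<^bsub>G\<^esub> x, w))))
       (free.span (induced_relations G H W))"

section \<open>The semigroup algebra\<close>

text \<open>
  The algebra is carried by \<^typ>\<open>'b \<Rightarrow>\<^sub>0 'k\<close>.  The product that type already has comes from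
  addition of keys, so the product induced by multiplication of keys gets its own symbol.
\<close>

definition alg_mult :: "('b::semigroup_mult \<Rightarrow>\<^sub>0 'k::field) \<Rightarrow> ('b \<Rightarrow>\<^sub>0 'k) \<Rightarrow> ('b \<Rightarrow>\<^sub>0 'k)"
  (infixl \<open>\<star>\<close> 70) where
  "p \<star> q = (\<Sum>x\<in>Poly_Mapping.keys p. \<Sum>y\<in>Poly_Mapping.keys q.
     Poly_Mapping.single (x * y) (Poly_Mapping.lookup p x * Poly_Mapping.lookup q y))"

definition left_mult :: "'b::semigroup_mult \<Rightarrow> ('b \<Rightarrow>\<^sub>0 'k::field) \<Rightarrow> ('b \<Rightarrow>\<^sub>0 'k)" where
  "left_mult b p = Poly_Mapping.single b 1 \<star> p"

definition left_ideal :: "('b::semigroup_mult \<Rightarrow>\<^sub>0 'k::field) set \<Rightarrow> bool" where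
  "left_ideal L \<longleftrightarrow> free.subspace L \<and> (\<forall>a. \<forall>x\<in>L. a \<star> x \<in> L)"

definition maximal_left_ideal :: "('b::semigroup_mult \<Rightarrow>\<^sub>0 'k::field) set \<Rightarrow> bool" where
  "maximal_left_ideal L \<longleftrightarrow> left_ideal L \<and> L \<noteq> UNIV
     \<and> (\<forall>L'. left_ideal L' \<and> L \<subseteq> L' \<longrightarrow> L' = L \<or> L' = UNIV)"

definition jacobson_radical :: "('b::semigroup_mult \<Rightarrow>\<^sub>0 'k::field) set" where
  "jacobson_radical = \<Inter>{L. maximal_left_ideal L}"

text \<open>
  The free module on \<^typ>\<open>'j\<close>, and projectivity as being a direct summand of a free module.
  The carrier type of \<open>M\<close> is enough as index set of the basis, because \<open>M\<close> is a quotient of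
  the free module on its own elements.
\<close>

definition free_module :: "('k::field, 'b::semigroup_mult, 'j \<Rightarrow>\<^sub>0 ('b \<Rightarrow>\<^sub>0 'k)) rep" where
  "free_module =
     \<lparr>rcarrier = UNIV, radd = (+),
      rscale = (\<lambda>c. Poly_Mapping.map (pscale c)),
      ract = (\<lambda>b. Poly_Mapping.map (left_mult b))\<rparr>"

definition projective :: "('k::field, 'b::semigroup_mult, 'v) rep \<Rightarrow> bool" where
  "projective M \<longleftrightarrow>
     (\<exists>i \<in> rep_hom UNIV M (free_module :: ('k, 'b, 'v \<Rightarrow>\<^sub>0 ('b \<Rightarrow>\<^sub>0 'k)) rep).
      \<exists>p \<in> rep_hom UNIV free_module M. \<forall>x\<in>rcarrier M. p (i x) = x)"

definition k_hereditary :: "'k::field itself \<Rightarrow> 'b::left_regular_band itself \<Rightarrow> bool" where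
  "k_hereditary _ B \<longleftrightarrow> connected_band B
     \<and> (\<forall>L :: ('b \<Rightarrow>\<^sub>0 'k) set. left_ideal L \<longrightarrow> projective (sub_rep L left_mult))"

definition idempotent :: "('b::semigroup_mult \<Rightarrow>\<^sub>0 'k::field) \<Rightarrow> bool" where
  "idempotent e \<longleftrightarrow> e \<star> e = e"

definition primitive_idempotent :: "('b::semigroup_mult \<Rightarrow>\<^sub>0 'k::field) \<Rightarrow> bool" where
  "primitive_idempotent e \<longleftrightarrow> idempotent e \<and> e \<noteq> 0
     \<and> (\<forall>f f'. idempotent f \<and> idempotent f' \<and> f \<star> f' = 0 \<and> f' \<star> f = 0 \<and> e = f + f'
          \<longrightarrow> f = 0 \<or> f' = 0)"

text \<open>
  Complete families of primitive orthogonal idempotents indexed by supports: the sum is the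
  (two-sided) identity of the algebra, which exists when the band is connected.
\<close>

definition cfpoi :: "('b::left_regular_band set \<Rightarrow> ('b \<Rightarrow>\<^sub>0 'k::field)) \<Rightarrow> bool" where
  "cfpoi E \<longleftrightarrow> (\<forall>X\<in>supports. primitive_idempotent (E X))
     \<and> (\<forall>X\<in>supports. \<forall>Y\<in>supports. X \<noteq> Y \<longrightarrow> E X \<star> E Y = 0)
     \<and> (\<forall>a. (\<Sum>X\<in>supports. E X) \<star> a = a \<and> a \<star> (\<Sum>X\<in>supports. E X) = a)"

definition simple_module :: "'b::left_regular_band set \<Rightarrow> ('k::field, 'b, 'k) rep" where
  "simple_module X =
     \<lparr>rcarrier = UNIV, radd = (+), rscale = (*),
      ract = (\<lambda>b v. if X \<subseteq> supp b then v else 0)\<rparr>"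

definition standardly_indexed ::
  "('b::left_regular_band set \<Rightarrow> ('b \<Rightarrow>\<^sub>0 'k::field)) \<Rightarrow> bool" where
  "standardly_indexed E \<longleftrightarrow>
     (\<forall>X\<in>supports. rep_iso UNIV
        (quotient_rep (sub_rep {a \<star> E X | a. True} left_mult)
           {r \<star> E X | r. r \<in> jacobson_radical})
        (simple_module X))"

section \<open>Group actions\<close>

definition acts_by_automorphisms ::
  "('g, 'm) monoid_scheme \<Rightarrow> ('g \<Rightarrow> 'b::semigroup_mult \<Rightarrow> 'b) \<Rightarrow> bool" where
  "acts_by_automorphisms G \<alpha> \<longleftrightarrow> group_action G UNIV \<alpha>
     \<and> (\<forall>g\<in>carrier G. \<forall>x y. \<alpha> g (x * y) = \<alpha> g x * \<alpha> g y)"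

text \<open>
  Since \<open>\<alpha> g\<close> is an automorphism, the image of the left ideal \<open>Bb\<close> under it is \<open>Bg(b)\<close>.
\<close>

definition supp_act :: "('g \<Rightarrow> 'b \<Rightarrow> 'b) \<Rightarrow> 'g \<Rightarrow> 'b set \<Rightarrow> 'b set" where
  "supp_act \<alpha> g X = \<alpha> g ` X"

definition invariant_family ::
  "('g, 'm) monoid_scheme \<Rightarrow> ('g \<Rightarrow> 'b \<Rightarrow> 'b)
    \<Rightarrow> ('b::left_regular_band set \<Rightarrow> ('b \<Rightarrow>\<^sub>0 'k::field)) \<Rightarrow> bool" where
  "invariant_family G \<alpha> E \<longleftrightarrow>
     (\<forall>g\<in>carrier G. \<forall>X\<in>supports. pushforward (\<alpha> g) (E X) = E (supp_act \<alpha> g X))"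

definition supp_orbit :: "('g, 'm) monoid_scheme \<Rightarrow> ('g \<Rightarrow> 'b \<Rightarrow> 'b) \<Rightarrow> 'b set \<Rightarrow> 'b set set" where
  "supp_orbit G \<alpha> X = orbit G (supp_act \<alpha>) X"

definition orbit_le :: "'b set set \<Rightarrow> 'b set set \<Rightarrow> bool" where
  "orbit_le P Q \<longleftrightarrow> (\<exists>X\<in>P. \<exists>Y\<in>Q. X \<subseteq> Y)"

definition orbit_less :: "'b set set \<Rightarrow> 'b set set \<Rightarrow> bool" where
  "orbit_less P Q \<longleftrightarrow> orbit_le P Q \<and> P \<noteq> Q"

text \<open>Strict chains \<open>X\<^sub>0 < \<dots> < X\<^sub>m\<close> with \<open>m \<ge> 1\<close> from one orbit to another, as lists.\<close>

definition chains_between ::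
  "'b::left_regular_band set set \<Rightarrow> 'b set set \<Rightarrow> 'b set list set" where
  "chains_between P Q =
     {C. 2 \<le> length C \<and> set C \<subseteq> supports \<and> sorted_wrt (\<subset>) C \<and> hd C \<in> P \<and> last C \<in> Q}"

definition chain_act :: "('g \<Rightarrow> 'b \<Rightarrow> 'b) \<Rightarrow> 'g \<Rightarrow> 'b set list \<Rightarrow> 'b set list" where
  "chain_act \<alpha> g C = map (supp_act \<alpha> g) C"

definition orbit_representatives ::
  "('g, 'm) monoid_scheme \<Rightarrow> ('g \<Rightarrow> 'x \<Rightarrow> 'x) \<Rightarrow> 'x set \<Rightarrow> 'x set \<Rightarrow> bool" where
  "orbit_representatives G act S R \<longleftrightarrow> R \<subseteq> S \<and> (\<forall>Q\<in>orbits G S act. \<exists>!r. r \<in> R \<and> r \<in> Q)"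

definition chain_stabilizer ::
  "('g, 'm) monoid_scheme \<Rightarrow> ('g \<Rightarrow> 'b \<Rightarrow> 'b) \<Rightarrow> 'b set list \<Rightarrow> 'g set" where
  "chain_stabilizer G \<alpha> C = (\<Inter>X\<in>set C. stabilizer G (supp_act \<alpha>) X)"

section \<open>Reduced homology in degree zero\<close>

text \<open>
  For the order complex of a subset \<open>P\<close> of the band, the kernel of the augmentation on
  0-chains, and the image of the boundary map, which sends an edge \<open>x < y\<close> to \<open>y - x\<close>.
\<close>

definition reduced_cycles0 :: "'b::left_regular_band set \<Rightarrow> ('b \<Rightarrow>\<^sub>0 'k::field) set" where
  "reduced_cycles0 P = {p. Poly_Mapping.keys p \<subseteq> P
     \<and> (\<Sum>x\<in>Poly_Mapping.keys p. Poly_Mapping.lookup p x) = 0}"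

definition boundaries0 :: "'b::left_regular_band set \<Rightarrow> ('b \<Rightarrow>\<^sub>0 'k::field) set" where
  "boundaries0 P = free.span
     {Poly_Mapping.single y 1 - Poly_Mapping.single x 1 | x y. x \<in> P \<and> y \<in> P \<and> band_less x y}"

definition below_above :: "'b::left_regular_band \<Rightarrow> 'b set \<Rightarrow> 'b set" where
  "below_above b W = {a. band_less a b \<and> W \<subseteq> supp a}"

text \<open>The tilde action of \<open>g\<close> sends a vertex \<open>a\<close> to \<open>b \<cdot> g(a)\<close>.\<close>

definition reduced_H0 ::
  "('g \<Rightarrow> 'b \<Rightarrow> 'b) \<Rightarrow> 'b::left_regular_band \<Rightarrow> 'b set \<Rightarrow> ('k::field, 'g, ('b \<Rightarrow>\<^sub>0 'k) set) rep"
where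
  "reduced_H0 \<alpha> b W =
     quotient_rep
       (sub_rep (reduced_cycles0 (below_above b W)) (\<lambda>g. pushforward (\<lambda>a. b * \<alpha> g a)))
       (boundaries0 (below_above b W))"

end

theory Submission
  imports Defs
begin

text \<open>
  The characters of the semigroup algebra, one for each support, have a nilpotent common kernel,
  the radical. The square of the radical has a complement in it that is stable under \<open>G\<close> and under
  the idempotents (average a linear projection); let \<open>V\<close> be this complement. Projectivity of the left
  ideals (radical)\<open>E\<^sub>X\<close> forces the algebra to be the tensor algebra of \<open>V\<close> over the span of the
  idempotents, so the spaces \<open>V\<^sub>C\<close> of products of arrows along strict chains \<open>C\<close> of supports decompose
  the algebra, every \<open>V\<^sub>C\<close> is the tensor product of its arrow spaces \<open>E\<^sub>Z V E\<^sub>W\<close>, and \<open>G\<close> permutes the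
  \<open>V\<^sub>C\<close>. An orbit of chains therefore contributes an induced representation. Finally
  \<open>z \<mapsto> E\<^sub>Z z E\<^sub>W\<close> identifies the reduced homology of \<open>{a. a < b, W \<subseteq> supp a}\<close>, \<open>supp b = Z\<close>, with
  \<open>E\<^sub>Z V E\<^sub>W\<close>; the inverse is the derivation that sends \<open>c\<close> to the class of \<open>b c\<close>.
\<close>

section \<open>Linear maps between free vector spaces\<close>

interpretation free_pair: vector_space_pair
  "pscale :: 'k::field \<Rightarrow> ('i \<Rightarrow>\<^sub>0 'k) \<Rightarrow> ('i \<Rightarrow>\<^sub>0 'k)"
  "pscale :: 'k::field \<Rightarrow> ('j \<Rightarrow>\<^sub>0 'k) \<Rightarrow> ('j \<Rightarrow>\<^sub>0 'k)"
  by unfold_locales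

abbreviation lin :: "(('i \<Rightarrow>\<^sub>0 'k::field) \<Rightarrow> ('j \<Rightarrow>\<^sub>0 'k)) \<Rightarrow> bool" where
  "lin \<equiv> Vector_Spaces.linear pscale pscale"

abbreviation (input) "keys \<equiv> Poly_Mapping.keys"
abbreviation (input) "lookup \<equiv> Poly_Mapping.lookup"
abbreviation (input) "basis i \<equiv> Poly_Mapping.single i 1"

lemma linI:
  assumes "\<And>x y. f (x + y) = f x + f y" "\<And>c x. f (pscale c x) = pscale c (f x)"
  shows "lin f"
  using assms by (simp add: linear_iff_module_hom module_hom_iff free.module_axioms)

lemma
  assumes "lin f"
  shows lin_add: "f (x + y) = f x + f y"
    and lin_diff: "f (x - y) = f x - f y"
    and lin_scale: "f (pscale c x) = pscale c (f x)"
    and lin_zero: "f 0 = 0"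
    and lin_sum: "f (sum g A) = (\<Sum>a\<in>A. f (g a))"
    and lin_span_image: "free.span (f ` S) = f ` free.span S"
  using assms
  by (auto simp: free_pair.linear_add free_pair.linear_diff free_pair.linear_scale
      free_pair.linear_0 free_pair.linear_sum free_pair.linear_span_image)

lemma pscale_single: "pscale c (Poly_Mapping.single i d) = Poly_Mapping.single i (c * d)"
  by (rule poly_mapping_eqI) (simp add: lookup_pscale lookup_single when_def)

lemma pscale_one [simp]: "pscale 1 p = p"
  by (rule free.scale_one)

lemma lookup_sum': "lookup (sum f A) i = (\<Sum>a\<in>A. lookup (f a) i)"
  by (induction A rule: infinite_finite_induct) (auto simp: lookup_add)

lemma free_expansion:
  assumes "finite A" "keys p \<subseteq> A"
  shows "p = (\<Sum>i\<in>A. pscale (lookup p i) (basis i))"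
proof (rule poly_mapping_eqI)
  fix j
  show "lookup p j =
      lookup (\<Sum>i\<in>A. pscale (lookup p i) (basis i)) j"
    using assms
    by (auto simp: lookup_sum' pscale_single lookup_single when_def in_keys_iff subset_iff)
qed

lemma free_in_span:
  assumes "keys p \<subseteq> A"
  shows "p \<in> free.span ((\<lambda>i. basis i) ` A)"
proof -
  have "p = (\<Sum>i\<in>keys p. pscale (lookup p i) (basis i))"
    by (rule free_expansion) auto
  moreover have "\<dots> \<in> free.span ((\<lambda>i. basis i) ` A)"
    using assms by (intro free.span_sum free.span_scale free.span_base) auto
  ultimately show ?thesis by simp
qed

lemma subspace_keys: "free.subspace {p :: 'i \<Rightarrow>\<^sub>0 'k::field. keys p \<subseteq> A}"
proof (rule free.subspaceI; clarsimp)
  fix x y :: "'i \<Rightarrow>\<^sub>0 'k" and i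
  assume "keys x \<subseteq> A" "keys y \<subseteq> A" "i \<in> keys (x + y)"
  then show "i \<in> A" using Poly_Mapping.keys_add[of x y] by blast
next
  fix c and x :: "'i \<Rightarrow>\<^sub>0 'k" and i
  assume "keys x \<subseteq> A" "i \<in> keys (pscale c x)"
  then show "i \<in> A" by (auto simp: in_keys_iff lookup_pscale subset_iff)
qed

lemma span_singles: "free.span ((\<lambda>i. basis i) ` A) = {p. keys p \<subseteq> A}"
proof
  show "free.span ((\<lambda>i. basis i) ` A) \<subseteq> {p. keys p \<subseteq> A}"
    by (rule free.span_minimal) (auto simp: subspace_keys split: if_splits)
qed (use free_in_span in auto)

lemma lin_eq_on_keys:
  assumes "lin f" "lin g" "\<And>i. i \<in> keys p \<Longrightarrow>
    f (basis i) = g (basis i)"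
  shows "f p = g p"
proof -
  let ?e = "\<Sum>i\<in>keys p. pscale (lookup p i) (basis i)"
  have "f ?e = g ?e"
    using assms by (simp add: lin_sum[OF assms(1)] lin_sum[OF assms(2)] lin_scale)
  then show ?thesis using free_expansion[of "keys p" p] by simp
qed

lemma lin_in_subspace:
  assumes "lin f" "free.subspace U" "\<And>i. i \<in> keys p \<Longrightarrow> f (basis i) \<in> U"
  shows "f p \<in> U"
proof -
  have "f (\<Sum>i\<in>keys p. pscale (lookup p i) (basis i)) \<in> U"
    using assms by (simp add: lin_sum[OF assms(1)] lin_scale free.subspace_sum free.subspace_scale)
  then show ?thesis using free_expansion[of "keys p" p] by simp
qed

lemma lin_span_subset:
  assumes "lin f" "free.subspace U" "\<And>x. x \<in> S \<Longrightarrow> f x \<in> U" "x \<in> free.span S"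
  shows "f x \<in> U"
proof -
  have "f x \<in> free.span (f ` S)" using assms(4) by (simp add: lin_span_image[OF assms(1)])
  also have "\<dots> \<subseteq> U" using assms by (intro free.span_minimal) auto
  finally show ?thesis .
qed

lemma lin_compose: "lin f \<Longrightarrow> lin g \<Longrightarrow> lin (\<lambda>x. f (g x))"
  by (rule linI) (simp_all add: lin_add lin_scale)

lemma lin_id: "lin (\<lambda>x. x)"
  by (rule linI) auto

lemma lin_const_zero: "lin (\<lambda>x. 0)"
  by (rule linI) auto

lemma lin_plus: "lin f \<Longrightarrow> lin g \<Longrightarrow> lin (\<lambda>x. f x + g x)"
  by (rule linI) (simp_all add: lin_add lin_scale free.scale_right_distrib)

lemma lin_minus: "lin f \<Longrightarrow> lin g \<Longrightarrow> lin (\<lambda>x. f x - g x)"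
  by (rule linI) (simp_all add: lin_add lin_scale free.scale_right_diff_distrib)

lemma lin_pscale: "lin f \<Longrightarrow> lin (\<lambda>x. pscale c (f x))"
  by (rule linI) (simp_all add: lin_add lin_scale free.scale_right_distrib mult.commute)

lemma lin_setsum: "(\<And>a. a \<in> A \<Longrightarrow> lin (f a)) \<Longrightarrow> lin (\<lambda>x. \<Sum>a\<in>A. f a x)"
  by (induction A rule: infinite_finite_induct) (auto intro: lin_const_zero lin_plus)

lemmas lin_intros = lin_id lin_const_zero lin_plus lin_minus lin_pscale lin_setsum

lemma subspace_image: "lin f \<Longrightarrow> free.subspace U \<Longrightarrow> free.subspace (f ` U)"
  by (rule free_pair.linear_subspace_image)

lemma subspace_sums:
  assumes "\<And>i. i \<in> I \<Longrightarrow> free.subspace (U i)"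
  shows "free.subspace {\<Sum>i\<in>I. u i | u. \<forall>i\<in>I. u i \<in> U i}" (is "free.subspace ?S")
proof (rule free.subspaceI)
  have "(\<Sum>i\<in>I. 0) \<in> ?S" using free.subspace_0[OF assms] by blast
  then show "0 \<in> ?S" by simp
next
  fix x y assume "x \<in> ?S" "y \<in> ?S"
  then obtain u w where u: "x = (\<Sum>i\<in>I. u i)" "\<forall>i\<in>I. u i \<in> U i"
    and w: "y = (\<Sum>i\<in>I. w i)" "\<forall>i\<in>I. w i \<in> U i" by blast
  have "(\<Sum>i\<in>I. u i + w i) \<in> ?S" using u(2) w(2) free.subspace_add[OF assms] by blast
  then show "x + y \<in> ?S" by (simp add: u(1) w(1) sum.distrib)
next
  fix c x assume "x \<in> ?S"
  then obtain u where u: "x = (\<Sum>i\<in>I. u i)" "\<forall>i\<in>I. u i \<in> U i" by blast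
  have "(\<Sum>i\<in>I. pscale c (u i)) \<in> ?S" using u(2) free.subspace_scale[OF assms] by blast
  then show "pscale c x \<in> ?S" by (simp add: u(1) free.scale_sum_right)
qed

definition lin_extend :: "('i \<Rightarrow> ('j \<Rightarrow>\<^sub>0 'k::field)) \<Rightarrow> ('i \<Rightarrow>\<^sub>0 'k) \<Rightarrow> ('j \<Rightarrow>\<^sub>0 'k)" where
  "lin_extend h p = (\<Sum>i\<in>keys p. pscale (lookup p i) (h i))"

lemma lin_extend_superset:
  assumes "finite A" "keys p \<subseteq> A"
  shows "lin_extend h p = (\<Sum>i\<in>A. pscale (lookup p i) (h i))"
  unfolding lin_extend_def
  by (rule sum.mono_neutral_left) (use assms in \<open>auto simp: in_keys_iff\<close>)

lemma lin_lin_extend: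
  fixes h :: "'i \<Rightarrow> ('j \<Rightarrow>\<^sub>0 'k::field)"
  shows "lin (lin_extend h)"
proof (rule linI)
  fix x y :: "'i \<Rightarrow>\<^sub>0 'k" and c
  let ?A = "keys x \<union> keys y"
  have "keys (x + y) \<subseteq> ?A" by (rule Poly_Mapping.keys_add)
  then show "lin_extend h (x + y) = lin_extend h x + lin_extend h y"
    by (simp add: lin_extend_superset[of ?A] lookup_add free.scale_left_distrib sum.distrib)
  have "keys (pscale c x) \<subseteq> keys x"
    by (auto simp: in_keys_iff lookup_pscale)
  then show "lin_extend h (pscale c x) = pscale c (lin_extend h x)"
    by (simp add: lin_extend_superset[of "keys x"] lookup_pscale free.scale_sum_right)
qed

lemma lin_extend_single: "lin_extend h (Poly_Mapping.single i c) = pscale c (h i)"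
  by (simp add: lin_extend_superset[of "{i}"] lookup_single)

lemma pushforward_eq: "pushforward f = lin_extend (\<lambda>i. basis (f i))"
  by (rule ext) (simp add: pushforward_def lin_extend_def pscale_single)

lemma lin_pushforward: "lin (pushforward f)"
  by (simp add: pushforward_eq lin_lin_extend)

lemma pushforward_single: "pushforward f (Poly_Mapping.single i c) = Poly_Mapping.single (f i) c"
  by (simp add: pushforward_eq lin_extend_single pscale_single)

lemma keys_pushforward: "keys (pushforward f p) \<subseteq> f ` keys p"
proof -
  have "pushforward f p \<in> {q. keys q \<subseteq> f ` keys p}"
    by (rule lin_in_subspace[OF lin_pushforward subspace_keys]) (auto simp: pushforward_single split: if_splits)
  then show ?thesis by simp
qed

lemma pushforward_pushforward: "pushforward f (pushforward g p) = pushforward (\<lambda>i. f (g i)) p"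
  by (rule lin_eq_on_keys[OF lin_compose[OF lin_pushforward lin_pushforward] lin_pushforward])
    (simp add: pushforward_single)

lemma pushforward_ident: "pushforward (\<lambda>i. i) p = p"
  by (rule lin_eq_on_keys[OF lin_pushforward lin_id]) (simp add: pushforward_single)

lemma lin_projection_exists:
  assumes "free.subspace (U :: ('i \<Rightarrow>\<^sub>0 'k::field) set)"
  shows "\<exists>g. lin g \<and> range g \<subseteq> U \<and> (\<forall>x\<in>U. g x = x)"
  using free_pair.linear_exists_left_inverse_on[OF lin_id assms inj_on_id2]
  by auto

section \<open>The semigroup algebra\<close>

lemma alg_mult_eq:
  "p \<star> q = lin_extend (\<lambda>x. lin_extend (\<lambda>y. basis (x * y)) q) p"
  by (simp add: alg_mult_def lin_extend_def pscale_single free.scale_sum_right)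

lemma lin_alg_mult_left: "lin (\<lambda>p. p \<star> q)"
  by (simp add: alg_mult_eq lin_lin_extend)

lemma alg_mult_eq':
  "p \<star> q = lin_extend (\<lambda>y. lin_extend (\<lambda>x. basis (x * y)) p) q"
proof -
  have "p \<star> q = (\<Sum>y\<in>keys q. \<Sum>x\<in>keys p.
     Poly_Mapping.single (x * y) (lookup p x * lookup q y))"
    unfolding alg_mult_def by (rule sum.swap)
  then show ?thesis
    by (simp add: lin_extend_def pscale_single free.scale_sum_right mult.commute)
qed

lemma lin_alg_mult_right: "lin (\<lambda>q. p \<star> q)"
  by (simp add: alg_mult_eq' lin_lin_extend)

lemmas alg_mult_linear =
  lin_add[OF lin_alg_mult_left] lin_diff[OF lin_alg_mult_left] lin_scale[OF lin_alg_mult_left]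
  lin_zero[OF lin_alg_mult_left]
  lin_add[OF lin_alg_mult_right] lin_diff[OF lin_alg_mult_right] lin_scale[OF lin_alg_mult_right]
  lin_zero[OF lin_alg_mult_right]

lemma alg_mult_sum_left: "sum f A \<star> q = (\<Sum>a\<in>A. f a \<star> q)"
  by (rule lin_sum[OF lin_alg_mult_left])

lemma alg_mult_sum_right: "p \<star> sum f A = (\<Sum>a\<in>A. p \<star> f a)"
  by (rule lin_sum[OF lin_alg_mult_right])

lemma single_alg_mult_single:
  "Poly_Mapping.single x c \<star> Poly_Mapping.single y d = Poly_Mapping.single (x * y) (c * d)"
  by (simp add: alg_mult_eq lin_extend_single pscale_single)

lemma alg_mult_assoc: "(p \<star> q) \<star> r = p \<star> (q \<star> r)"
proof (rule lin_eq_on_keys[where p = p])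
  show "lin (\<lambda>p. (p \<star> q) \<star> r)" by (intro lin_compose[OF lin_alg_mult_left] lin_alg_mult_left)
  show "lin (\<lambda>p. p \<star> (q \<star> r))" by (rule lin_alg_mult_left)
  fix x
  show "(basis x \<star> q) \<star> r = basis x \<star> (q \<star> r)"
  proof (rule lin_eq_on_keys[where p = q])
    show "lin (\<lambda>q. (basis x \<star> q) \<star> r)"
      by (rule lin_compose[OF lin_alg_mult_left lin_alg_mult_right])
    show "lin (\<lambda>q. basis x \<star> (q \<star> r))"
      by (rule lin_compose[OF lin_alg_mult_right lin_alg_mult_left])
    fix y
    show "(basis x \<star> basis y) \<star> r
        = basis x \<star> (basis y \<star> r)"
      by (rule lin_eq_on_keys[where p = r])
        (auto intro!: lin_compose[OF lin_alg_mult_right] lin_alg_mult_right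
          simp: single_alg_mult_single mult.assoc)
  qed
qed

lemma keys_alg_mult: "keys (p \<star> q) \<subseteq> {x * y | x y. x \<in> keys p \<and> y \<in> keys q}"
proof -
  let ?S = "{x * y | x y. x \<in> keys p \<and> y \<in> keys q}"
  have "basis x \<star> q \<in> {r. keys r \<subseteq> ?S}" if "x \<in> keys p" for x
    by (rule lin_in_subspace[OF lin_alg_mult_right subspace_keys])
      (use that in \<open>auto simp: single_alg_mult_single split: if_splits\<close>)
  then have "p \<star> q \<in> {r. keys r \<subseteq> ?S}"
    by (rule lin_in_subspace[OF lin_alg_mult_left subspace_keys])
  then show ?thesis by simp
qed

lemma pushforward_alg_mult:
  assumes "\<And>x y. f (x * y) = f x * f y"
  shows "pushforward f (p \<star> q) = pushforward f p \<star> pushforward f q"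
proof (rule lin_eq_on_keys[where p = p])
  show "lin (\<lambda>p. pushforward f (p \<star> q))" by (rule lin_compose[OF lin_pushforward lin_alg_mult_left])
  show "lin (\<lambda>p. pushforward f p \<star> pushforward f q)"
    by (rule lin_compose[OF lin_alg_mult_left lin_pushforward])
  fix x
  show "pushforward f (basis x \<star> q)
      = pushforward f (basis x) \<star> pushforward f q"
    by (rule lin_eq_on_keys[where p = q])
      (auto intro!: lin_compose[OF lin_pushforward lin_alg_mult_right]
        lin_compose[OF lin_alg_mult_right lin_pushforward]
        simp: single_alg_mult_single pushforward_single assms)
qed

section \<open>Supports and characters\<close>

lemma mem_supp_iff: "c \<in> supp b \<longleftrightarrow> c * b = c" for b c :: "'b::left_regular_band"
  unfolding supp_def by (auto simp: mult.assoc band) metis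

lemma supp_subset_iff: "supp a \<subseteq> supp b \<longleftrightarrow> a * b = a" for a b :: "'b::left_regular_band"
proof
  assume "supp a \<subseteq> supp b"
  then show "a * b = a" using mem_supp_iff[of a a] mem_supp_iff[of a b] by (auto simp: band)
next
  assume *: "a * b = a"
  show "supp a \<subseteq> supp b"
  proof
    fix c assume "c \<in> supp a"
    then have "c * a = c" by (simp add: mem_supp_iff)
    then have "c * b = c" using * by (metis mult.assoc)
    then show "c \<in> supp b" by (simp add: mem_supp_iff)
  qed
qed

lemma supp_mult: "supp (a * b) = supp a \<inter> supp b" for a b :: "'b::left_regular_band"
proof (rule Set.set_eqI, rule iffI)
  fix c assume "c \<in> supp (a * b)"
  then have *: "c * (a * b) = c" by (simp add: mem_supp_iff)
  have "c * b = c" by (metis * band mult.assoc)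
  moreover have "c * a = c" by (metis * left_regular mult.assoc)
  ultimately show "c \<in> supp a \<inter> supp b" by (simp add: mem_supp_iff)
next
  fix c assume "c \<in> supp a \<inter> supp b"
  then show "c \<in> supp (a * b)" by (simp add: mem_supp_iff flip: mult.assoc)
qed

lemma self_in_supp [simp]: "b \<in> supp b" for b :: "'b::left_regular_band"
  by (simp add: mem_supp_iff band)

lemma supp_in_supports [simp]: "supp b \<in> supports"
  by (auto simp: supports_def)

lemma supportsE:
  assumes "X \<in> supports" obtains b where "supp b = X"
  using assms by (auto simp: supports_def)

lemma finite_supports [simp]: "finite (supports :: 'b::left_regular_band set set)"
  by (rule finite_subset[of _ UNIV]) auto

lemma band_less_supp:
  assumes "band_less a b" shows "supp a \<subset> supp b" "b * a = a" "a * b = a"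
proof -
  show ba: "b * a = a" using assms by (simp add: band_less_def band_le_def)
  then show ab: "a * b = a" by (metis left_regular mult.assoc)
  have "supp a \<noteq> supp b"
  proof
    assume "supp a = supp b"
    then have "b * a = b" using supp_subset_iff[of b a] by simp
    then show False using ba assms by (simp add: band_less_def)
  qed
  then show "supp a \<subset> supp b" using ab supp_subset_iff by blast
qed

lemma band_less_multI:
  assumes "\<not> supp b \<subseteq> supp a" shows "band_less (b * a) b"
proof -
  have "b * (b * a) = b * a" by (simp add: band flip: mult.assoc)
  moreover have "b * a \<noteq> b" using assms supp_subset_iff by blast
  ultimately show ?thesis by (simp add: band_less_def band_le_def)
qed

definition chi :: "'b::left_regular_band set \<Rightarrow> ('b \<Rightarrow>\<^sub>0 'k::field) \<Rightarrow> 'k" where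
  "chi X p = (\<Sum>b\<in>{b. X \<subseteq> supp b}. lookup p b)"

lemma chi_add: "chi X (p + q) = chi X p + chi X q"
  by (simp add: chi_def lookup_add sum.distrib)

lemma chi_diff: "chi X (p - q) = chi X p - chi X q"
  by (simp add: chi_def lookup_minus sum_subtractf)

lemma chi_pscale: "chi X (pscale c p) = c * chi X p"
  by (simp add: chi_def lookup_pscale sum_distrib_left)

lemma chi_zero [simp]: "chi X 0 = 0"
  by (simp add: chi_def)

lemma chi_sum: "chi X (sum f A) = (\<Sum>a\<in>A. chi X (f a))"
  by (induction A rule: infinite_finite_induct) (auto simp: chi_add)

lemma chi_single: "chi X (Poly_Mapping.single b c) = (if X \<subseteq> supp b then c else 0)"
  by (simp add: chi_def lookup_single when_def)

lemma chi_keys: "chi X p = (\<Sum>b\<in>keys p. if X \<subseteq> supp b then lookup p b else 0)"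
proof -
  have "chi X p = (\<Sum>b\<in>keys p \<inter> {b. X \<subseteq> supp b}. lookup p b)"
    unfolding chi_def by (rule sum.mono_neutral_right) (auto simp: in_keys_iff)
  then show ?thesis by (simp add: sum.inter_restrict)
qed

lemma chi_mult: "chi X (p \<star> q) = chi X p * chi X q"
  unfolding alg_mult_def chi_sum chi_single chi_keys[of X p] chi_keys[of X q] sum_product
  by (intro sum.cong) (auto simp: supp_mult)

text \<open>The coefficient of \<^term>\<open>c\<close> is what keeps products from dropping to smaller supports; the
  resulting filtration replaces nilpotency of the radical throughout.\<close>

lemma lookup_left_mult_self:
  "lookup (basis c \<star> p) c = chi (supp c) p"
proof -
  have "p = (\<Sum>x\<in>UNIV. pscale (lookup p x) (basis x))"
    by (rule free_expansion) auto
  then have "lookup (basis c \<star> p) c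
    = lookup (basis c \<star>
        (\<Sum>x\<in>UNIV. pscale (lookup p x) (basis x))) c" by simp
  also have "\<dots> = (\<Sum>x\<in>UNIV. if supp c \<subseteq> supp x then lookup p x else 0)"
    by (simp add: alg_mult_sum_right alg_mult_linear pscale_single single_alg_mult_single lookup_sum'
        lookup_single when_def supp_subset_iff)
  also have "\<dots> = chi (supp c) p"
    by (simp add: chi_def flip: sum.inter_filter)
  finally show ?thesis .
qed

lemma keys_left_mult:
  "keys (basis c \<star> p) \<subseteq> {d. supp d \<subseteq> supp c}"
  by (rule order_trans[OF keys_alg_mult]) (auto simp: supp_mult)

lemma keys_left_mult_strict:
  assumes "chi (supp c) p = 0"
  shows "keys (basis c \<star> p) \<subseteq> {d. supp d \<subset> supp c}"
proof
  fix d assume d: "d \<in> keys (basis c \<star> p)"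
  then obtain x where x: "d = c * x" using keys_alg_mult[of "basis c" p] by auto
  have "supp d \<noteq> supp c"
  proof
    assume "supp d = supp c"
    then have "c * x = c" using x supp_mult[of c x] supp_subset_iff[of c x] by blast
    then show False using d x assms lookup_left_mult_self[of c p] by (simp add: in_keys_iff)
  qed
  then show "d \<in> {d. supp d \<subset> supp c}" using x by (auto simp: supp_mult)
qed

text \<open>This is the Jacobson radical, of which only one inclusion is needed below.\<close>

definition rad :: "('b::left_regular_band \<Rightarrow>\<^sub>0 'k::field) set" where
  "rad = {p. \<forall>X\<in>supports. chi X p = 0}"

lemma radD: "p \<in> rad \<Longrightarrow> X \<in> supports \<Longrightarrow> chi X p = 0"
  by (simp add: rad_def)

lemma radI: "(\<And>X. X \<in> supports \<Longrightarrow> chi X p = 0) \<Longrightarrow> p \<in> rad"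
  by (simp add: rad_def)

lemma subspace_rad: "free.subspace rad"
  by (rule free.subspaceI) (auto simp: rad_def chi_add chi_pscale)

lemma rad_mult_left: "p \<in> rad \<Longrightarrow> a \<star> p \<in> rad"
  by (simp add: rad_def chi_mult)

lemma rad_mult_right: "p \<in> rad \<Longrightarrow> p \<star> a \<in> rad"
  by (simp add: rad_def chi_mult)

definition rad_sq :: "('b::left_regular_band \<Rightarrow>\<^sub>0 'k::field) set" where
  "rad_sq = free.span {p \<star> q | p q. p \<in> rad \<and> q \<in> rad}"

lemma subspace_rad_sq: "free.subspace rad_sq"
  by (simp add: rad_sq_def)

lemma rad_sqI: "p \<in> rad \<Longrightarrow> q \<in> rad \<Longrightarrow> p \<star> q \<in> rad_sq"
  unfolding rad_sq_def by (rule free.span_base) auto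

lemma rad_sq_subset: "rad_sq \<subseteq> rad"
  unfolding rad_sq_def
  by (rule free.span_minimal) (auto simp: subspace_rad rad_mult_left)

lemma rad_sq_mult_left:
  assumes "p \<in> rad_sq"
  shows "a \<star> p \<in> rad_sq"
  by (rule lin_span_subset[OF lin_alg_mult_right subspace_rad_sq _ assms[unfolded rad_sq_def]])
    (clarsimp simp flip: alg_mult_assoc, simp add: rad_sqI rad_mult_left)

lemma rad_sq_mult_right:
  assumes "p \<in> rad_sq"
  shows "p \<star> a \<in> rad_sq"
  by (rule lin_span_subset[OF lin_alg_mult_left subspace_rad_sq _ assms[unfolded rad_sq_def]])
    (clarsimp simp: alg_mult_assoc, simp add: rad_sqI rad_mult_right)

definition supp_filtration :: "nat \<Rightarrow> ('b::left_regular_band \<Rightarrow>\<^sub>0 'k::field) set" where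
  "supp_filtration n = {p. keys p \<subseteq> {c. card (supp c) \<le> n}}"

lemma subspace_supp_filtration: "free.subspace (supp_filtration n)"
  unfolding supp_filtration_def by (rule subspace_keys)

lemma supp_filtration_0: "p \<in> supp_filtration 0 \<Longrightarrow> p = 0"
proof -
  assume p: "p \<in> supp_filtration 0"
  have "supp c \<noteq> {}" for c :: 'a
    using self_in_supp[of c] by blast
  then have "keys p = {}"
    using p by (auto simp: supp_filtration_def)
  then show "p = 0" by simp
qed

lemma supp_filtration_UNIV: "p \<in> supp_filtration (card (UNIV :: 'b set))"
  for p :: "'b::left_regular_band \<Rightarrow>\<^sub>0 'k::field"
  by (auto simp: supp_filtration_def intro: card_mono)

lemma supp_filtration_mult:
  assumes "p \<in> supp_filtration (Suc n)" "q \<in> rad"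
  shows "p \<star> q \<in> supp_filtration n"
proof (rule lin_in_subspace[OF lin_alg_mult_left subspace_supp_filtration])
  fix c assume "c \<in> keys p"
  then have c: "card (supp c) \<le> Suc n" using assms by (auto simp: supp_filtration_def)
  have "keys (basis c \<star> q) \<subseteq> {d. supp d \<subset> supp c}"
    by (rule keys_left_mult_strict, rule radD[OF assms(2)]) simp
  also have "\<dots> \<subseteq> {d. card (supp d) \<le> n}"
  proof
    fix d assume "d \<in> {d. supp d \<subset> supp c}"
    then have "card (supp d) < card (supp c)" by (simp add: psubset_card_mono)
    then show "d \<in> {d. card (supp d) \<le> n}" using c by simp
  qed
  finally show "basis c \<star> q \<in> supp_filtration n"
    by (simp add: supp_filtration_def)
qed

section \<open>Idempotents indexed by supports\<close>

locale band_idempotents =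
  fixes E :: "'b::left_regular_band set \<Rightarrow> ('b \<Rightarrow>\<^sub>0 'k::field)"
  assumes chi_E: "X \<in> supports \<Longrightarrow> Y \<in> supports \<Longrightarrow> chi Y (E X) = (if X = Y then 1 else 0)"
    and E_idem: "X \<in> supports \<Longrightarrow> E X \<star> E X = E X"
    and E_orth: "X \<in> supports \<Longrightarrow> Y \<in> supports \<Longrightarrow> X \<noteq> Y \<Longrightarrow> E X \<star> E Y = 0"
    and E_unit_left: "(\<Sum>X\<in>supports. E X) \<star> a = a"
    and E_unit_right: "a \<star> (\<Sum>X\<in>supports. E X) = a"
begin

lemma mult_E_E: "X \<in> supports \<Longrightarrow> a \<star> E X \<star> E X = a \<star> E X"
  by (simp add: alg_mult_assoc E_idem)

lemma E_E_mult: "X \<in> supports \<Longrightarrow> E X \<star> (E X \<star> a) = E X \<star> a"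
  by (simp add: E_idem flip: alg_mult_assoc)

lemma E_nonzero: "X \<in> supports \<Longrightarrow> E X \<noteq> 0"
  using chi_E[of X X] by auto

lemma unit_decomp: "a = (\<Sum>Y\<in>supports. \<Sum>X\<in>supports. E Y \<star> a \<star> E X)"
proof -
  have "a = (\<Sum>Y\<in>supports. E Y) \<star> a \<star> (\<Sum>X\<in>supports. E X)"
    by (simp add: E_unit_left E_unit_right)
  also have "\<dots> = (\<Sum>Y\<in>supports. \<Sum>X\<in>supports. E Y \<star> a \<star> E X)"
    unfolding alg_mult_sum_left unfolding alg_mult_sum_right ..
  finally show ?thesis .
qed

lemma single_mult_E_eq_0:
  assumes "Z \<in> supports" "\<not> Z \<subseteq> supp c"
  shows "basis c \<star> E Z = 0"
  using assms(2)
proof (induction "card (supp c)" arbitrary: c rule: less_induct)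
  case less
  have "supp c \<noteq> Z" using less.prems by auto
  then have keys: "keys (basis c \<star> E Z) \<subseteq> {d. supp d \<subset> supp c}"
    using assms by (intro keys_left_mult_strict) (auto simp: chi_E)
  have "basis c \<star> E Z \<star> E Z = 0"
  proof (rule lin_eq_on_keys[OF lin_alg_mult_left lin_const_zero])
    fix d assume "d \<in> keys (basis c \<star> E Z)"
    then have d: "supp d \<subset> supp c" using keys by auto
    show "basis d \<star> E Z = 0"
      by (rule less.hyps) (use d less.prems in \<open>simp add: psubset_card_mono\<close>, use d less.prems in blast)
  qed
  then show ?case using assms by (simp add: mult_E_E)
qed

lemma keys_single_mult_E:
  assumes "Z \<in> supports"
  shows "keys (basis c \<star> E Z) \<subseteq> {d. supp d \<subseteq> Z}"
proof (induction "card (supp c)" arbitrary: c rule: less_induct)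
  case less
  show ?case
  proof (cases "supp c \<subseteq> Z")
    case True
    then show ?thesis using keys_left_mult[of c "E Z"] by auto
  next
    case False
    then have "supp c \<noteq> Z" by auto
    then have keys: "keys (basis c \<star> E Z) \<subseteq> {d. supp d \<subset> supp c}"
      using assms by (intro keys_left_mult_strict) (auto simp: chi_E)
    have "basis c \<star> E Z \<star> E Z \<in> {p. keys p \<subseteq> {d. supp d \<subseteq> Z}}"
    proof (rule lin_in_subspace[OF lin_alg_mult_left subspace_keys])
      fix d assume "d \<in> keys (basis c \<star> E Z)"
      then have d: "supp d \<subset> supp c" using keys by auto
      then show "basis d \<star> E Z \<in> {p. keys p \<subseteq> {d. supp d \<subseteq> Z}}"
        using less.hyps[of d] by (simp add: psubset_card_mono)
    qed
    then show ?thesis using assms by (simp add: mult_E_E)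
  qed
qed

lemma keys_E:
  assumes "Z \<in> supports"
  shows "keys (E Z) \<subseteq> {d. supp d \<subseteq> Z}"
proof -
  have "E Z \<star> E Z \<in> {p. keys p \<subseteq> {d. supp d \<subseteq> Z}}"
    by (rule lin_in_subspace[OF lin_alg_mult_left subspace_keys])
      (use keys_single_mult_E[OF assms] in auto)
  then show ?thesis using E_idem[OF assms] by simp
qed

lemma mult_E_eq_0:
  assumes "X \<in> supports" "\<And>c. c \<in> keys p \<Longrightarrow> \<not> X \<subseteq> supp c"
  shows "p \<star> E X = 0"
  by (rule lin_eq_on_keys[OF lin_alg_mult_left lin_const_zero])
    (use assms in \<open>auto intro: single_mult_E_eq_0\<close>)

lemma E_mult_E_eq_0:
  assumes "X \<in> supports" "Y \<in> supports" "\<not> X \<subseteq> Y"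
  shows "E Y \<star> a \<star> E X = 0"
proof (rule mult_E_eq_0[OF assms(1)])
  fix c assume "c \<in> keys (E Y \<star> a)"
  then obtain x y where "c = x * y" "x \<in> keys (E Y)"
    using keys_alg_mult[of "E Y" a] by auto
  then have "supp c \<subseteq> Y" using keys_E[OF assms(2)] by (auto simp: supp_mult)
  then show "\<not> X \<subseteq> supp c" using assms(3) by auto
qed

lemma E_rad_E_eq_0:
  assumes "X \<in> supports" "p \<in> rad"
  shows "E X \<star> p \<star> E X = 0"
proof (rule mult_E_eq_0[OF assms(1)])
  fix c assume c: "c \<in> keys (E X \<star> p)"
  have "E X \<star> p \<in> {q. keys q \<subseteq> {d. supp d \<subset> X}}"
  proof (rule lin_in_subspace[OF lin_alg_mult_left subspace_keys])
    fix d assume "d \<in> keys (E X)"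
    then have d: "supp d \<subseteq> X" using keys_E[OF assms(1)] by auto
    have "keys (basis d \<star> p) \<subseteq> {e. supp e \<subset> supp d}"
      by (rule keys_left_mult_strict, rule radD[OF assms(2)]) simp
    then show "basis d \<star> p \<in> {q. keys q \<subseteq> {d. supp d \<subset> X}}"
      using d by auto
  qed
  then show "\<not> X \<subseteq> supp c" using c by auto
qed

lemma E_mult_E_in_rad:
  assumes "X \<in> supports" "Y \<in> supports" "X \<noteq> Y"
  shows "E Y \<star> a \<star> E X \<in> rad"
  using assms by (intro radI) (auto simp: chi_mult chi_E)

lemma mult_E_in_rad:
  assumes "X \<in> supports" "chi X p = 0"
  shows "p \<star> E X \<in> rad"
  using assms by (intro radI) (auto simp: chi_mult chi_E)

lemma E_mult_in_rad:
  assumes "X \<in> supports" "chi X p = 0"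
  shows "E X \<star> p \<in> rad"
  using assms by (intro radI) (auto simp: chi_mult chi_E)

end

section \<open>Concrete models of representations\<close>

lemma
  shows rcarrier_sub_rep [simp]: "rcarrier (sub_rep V act) = V"
    and radd_sub_rep [simp]: "radd (sub_rep V act) = (+)"
    and rscale_sub_rep [simp]: "rscale (sub_rep V act) = pscale"
    and ract_sub_rep [simp]: "ract (sub_rep V act) = act"
  by (simp_all add: sub_rep_def)

lemma mem_rcoset_sub_rep: "a \<in> rcoset (sub_rep V act) U v \<longleftrightarrow> a - v \<in> U"
  by (auto simp: rcoset_def image_iff algebra_simps intro!: bexI[of _ "a - v"])

lemma rcoset_sub_rep_eq_iff:
  assumes "free.subspace U"
  shows "rcoset (sub_rep V act) U v = rcoset (sub_rep V act) U w \<longleftrightarrow> v - w \<in> U"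
proof
  assume "rcoset (sub_rep V act) U v = rcoset (sub_rep V act) U w"
  moreover have "v \<in> rcoset (sub_rep V act) U v"
    using free.subspace_0[OF assms] by (simp add: mem_rcoset_sub_rep)
  ultimately show "v - w \<in> U" by (simp add: mem_rcoset_sub_rep)
next
  assume vw: "v - w \<in> U"
  have "a - v \<in> U \<longleftrightarrow> a - w \<in> U" for a
    using free.subspace_add[OF assms _ vw, of "a - v"] free.subspace_diff[OF assms _ vw, of "a - w"]
    by auto
  then show "rcoset (sub_rep V act) U v = rcoset (sub_rep V act) U w"
    by (auto simp: mem_rcoset_sub_rep)
qed

lemma UN_rcoset:
  assumes "free.subspace U" "\<And>a. a - v \<in> U \<Longrightarrow> h a - w \<in> U"
  shows "(\<Union>a\<in>rcoset (sub_rep V act) U v. rcoset (sub_rep V act) U (h a)) = rcoset (sub_rep V act) U w"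
proof -
  have "rcoset (sub_rep V act) U (h a) = rcoset (sub_rep V act) U w"
    if "a \<in> rcoset (sub_rep V act) U v" for a
    using that assms(2)[of a] by (simp add: mem_rcoset_sub_rep rcoset_sub_rep_eq_iff[OF assms(1)])
  moreover have "v \<in> rcoset (sub_rep V act) U v"
    using free.subspace_0[OF assms(1)] by (simp add: mem_rcoset_sub_rep)
  ultimately show ?thesis by blast
qed

lemma rcarrier_quotient_rep: "rcarrier (quotient_rep (sub_rep V act) U) = rcoset (sub_rep V act) U ` V"
  by (simp add: quotient_rep_def)

lemma radd_quotient_rep:
  assumes "free.subspace U"
  shows "radd (quotient_rep (sub_rep V act) U) (rcoset (sub_rep V act) U v) (rcoset (sub_rep V act) U w)
    = rcoset (sub_rep V act) U (v + w)"
proof -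
  have "(\<Union>a'\<in>rcoset (sub_rep V act) U w. rcoset (sub_rep V act) U (a + a')) = rcoset (sub_rep V act) U (a + w)" for a
    by (rule UN_rcoset[OF assms]) simp
  moreover have "(\<Union>a\<in>rcoset (sub_rep V act) U v. rcoset (sub_rep V act) U (a + w)) = rcoset (sub_rep V act) U (v + w)"
    by (rule UN_rcoset[OF assms]) simp
  ultimately show ?thesis by (simp add: quotient_rep_def)
qed

lemma rscale_quotient_rep:
  assumes "free.subspace U"
  shows "rscale (quotient_rep (sub_rep V act) U) c (rcoset (sub_rep V act) U v)
    = rcoset (sub_rep V act) U (pscale c v)"
proof -
  have "(\<Union>a\<in>rcoset (sub_rep V act) U v. rcoset (sub_rep V act) U (pscale c a)) = rcoset (sub_rep V act) U (pscale c v)"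
    by (rule UN_rcoset[OF assms]) (simp add: free.subspace_scale[OF assms] flip: free.scale_right_diff_distrib)
  then show ?thesis by (simp add: quotient_rep_def)
qed

lemma ract_quotient_rep:
  assumes "free.subspace U" "\<And>a. a - v \<in> U \<Longrightarrow> act s a - act s v \<in> U"
  shows "ract (quotient_rep (sub_rep V act) U) s (rcoset (sub_rep V act) U v)
    = rcoset (sub_rep V act) U (act s v)"
proof -
  have "(\<Union>a\<in>rcoset (sub_rep V act) U v. rcoset (sub_rep V act) U (act s a)) = rcoset (sub_rep V act) U (act s v)"
    by (rule UN_rcoset[OF assms(1)]) (rule assms(2))
  then show ?thesis by (simp add: quotient_rep_def)
qed

text \<open>Models replace the nested quotients of the statement by honest subspaces, here always of the
  semigroup algebra, so that sets of cosets are never manipulated beyond this section.\<close>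

definition models ::
  "'s set \<Rightarrow> ('k::field, 's, 'v) rep \<Rightarrow> ('i \<Rightarrow>\<^sub>0 'k) set \<Rightarrow> ('s \<Rightarrow> ('i \<Rightarrow>\<^sub>0 'k) \<Rightarrow> ('i \<Rightarrow>\<^sub>0 'k))
    \<Rightarrow> ('v \<Rightarrow> ('i \<Rightarrow>\<^sub>0 'k)) \<Rightarrow> bool" where
  "models S V W \<beta> t \<longleftrightarrow> free.subspace W \<and> bij_betw t (rcarrier V) W
     \<and> (\<forall>u\<in>rcarrier V. \<forall>w\<in>rcarrier V. radd V u w \<in> rcarrier V \<and> t (radd V u w) = t u + t w)
     \<and> (\<forall>c. \<forall>u\<in>rcarrier V. rscale V c u \<in> rcarrier V \<and> t (rscale V c u) = pscale c (t u))
     \<and> (\<forall>s\<in>S. \<forall>u\<in>rcarrier V. ract V s u \<in> rcarrier V \<and> t (ract V s u) = \<beta> s (t u))"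

lemma
  assumes "models S V W \<beta> t"
  shows models_subspace: "free.subspace W"
    and models_bij: "bij_betw t (rcarrier V) W"
    and models_in: "u \<in> rcarrier V \<Longrightarrow> t u \<in> W"
    and models_inj: "u \<in> rcarrier V \<Longrightarrow> w \<in> rcarrier V \<Longrightarrow> t u = t w \<Longrightarrow> u = w"
    and models_surj: "x \<in> W \<Longrightarrow> \<exists>u\<in>rcarrier V. t u = x"
    and models_add_closed: "u \<in> rcarrier V \<Longrightarrow> w \<in> rcarrier V \<Longrightarrow> radd V u w \<in> rcarrier V"
    and models_add: "u \<in> rcarrier V \<Longrightarrow> w \<in> rcarrier V \<Longrightarrow> t (radd V u w) = t u + t w"
    and models_scale_closed: "u \<in> rcarrier V \<Longrightarrow> rscale V c u \<in> rcarrier V"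
    and models_scale: "u \<in> rcarrier V \<Longrightarrow> t (rscale V c u) = pscale c (t u)"
    and models_act_closed: "s \<in> S \<Longrightarrow> u \<in> rcarrier V \<Longrightarrow> ract V s u \<in> rcarrier V"
    and models_act: "s \<in> S \<Longrightarrow> u \<in> rcarrier V \<Longrightarrow> t (ract V s u) = \<beta> s (t u)"
  using assms unfolding models_def bij_betw_def inj_on_def by (blast+)

definition coset_map :: "('v \<Rightarrow> 'w) \<Rightarrow> 'v set \<Rightarrow> 'w" where
  "coset_map f A = f (SOME a. a \<in> A)"

lemma coset_map_rcoset:
  assumes "free.subspace U" "lin f" "\<And>u. u \<in> U \<Longrightarrow> f u = 0"
  shows "coset_map f (rcoset (sub_rep V act) U v) = f v"
proof -
  have "v \<in> rcoset (sub_rep V act) U v"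
    using free.subspace_0[OF assms(1)] by (simp add: mem_rcoset_sub_rep)
  then have "(SOME a. a \<in> rcoset (sub_rep V act) U v) \<in> rcoset (sub_rep V act) U v"
    by (rule someI)
  then have "f ((SOME a. a \<in> rcoset (sub_rep V act) U v) - v) = 0"
    by (simp add: mem_rcoset_sub_rep assms(3))
  then show ?thesis by (simp add: coset_map_def lin_diff[OF assms(2)])
qed

lemma models_quotient_rep:
  assumes V: "free.subspace V" and U: "free.subspace U" "U \<subseteq> V" and f: "lin f"
    and ker: "\<And>v. v \<in> V \<Longrightarrow> f v = 0 \<longleftrightarrow> v \<in> U"
    and act: "\<And>s v. s \<in> S \<Longrightarrow> v \<in> V \<Longrightarrow> act s v \<in> V \<and> f (act s v) = \<beta> s (f v)"
  shows "models S (quotient_rep (sub_rep V act) U) (f ` V) \<beta> (coset_map f)"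
proof -
  let ?Q = "quotient_rep (sub_rep V act) U" and ?r = "rcoset (sub_rep V act) U"
  have fU: "f u = 0" if "u \<in> U" for u using ker that U by blast
  have map: "coset_map f (?r v) = f v" for v
    by (rule coset_map_rcoset[OF U(1) f fU])
  have inj: "?r v = ?r w" if "v \<in> V" "w \<in> V" "f v = f w" for v w
    using that ker[of "v - w"] free.subspace_diff[OF V]
    by (simp add: rcoset_sub_rep_eq_iff[OF U(1)] lin_diff[OF f])
  have ract: "ract ?Q s (?r v) = ?r (act s v)" if "s \<in> S" "v \<in> V" for s v
  proof (rule ract_quotient_rep[OF U(1)])
    fix a assume a: "a - v \<in> U"
    then have "a - v + v \<in> V" using U that by (blast intro: free.subspace_add[OF V])
    then have "a \<in> V" by simp
    moreover have "f a = f v" using fU[OF a] by (simp add: lin_diff[OF f])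
    ultimately have "f (act s a - act s v) = 0" using act that by (simp add: lin_diff[OF f])
    moreover have "act s a - act s v \<in> V" using act that \<open>a \<in> V\<close> by (blast intro: free.subspace_diff[OF V])
    ultimately show "act s a - act s v \<in> U" using ker by blast
  qed
  have "bij_betw (coset_map f) (rcarrier ?Q) (f ` V)"
    unfolding bij_betw_def rcarrier_quotient_rep
  proof
    show "inj_on (coset_map f) (?r ` V)" by (rule inj_onI, clarify, rule inj) (simp_all add: map)
    show "coset_map f ` ?r ` V = f ` V" by (simp add: image_image map)
  qed
  moreover have "free.subspace (f ` V)" by (rule subspace_image[OF f V])
  moreover have "radd ?Q A B \<in> rcarrier ?Q \<and> coset_map f (radd ?Q A B) = coset_map f A + coset_map f B"
    if "A \<in> rcarrier ?Q" "B \<in> rcarrier ?Q" for A B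
    using that free.subspace_add[OF V]
    by (auto simp: rcarrier_quotient_rep radd_quotient_rep[OF U(1)] map lin_add[OF f])
  moreover have "rscale ?Q c A \<in> rcarrier ?Q \<and> coset_map f (rscale ?Q c A) = pscale c (coset_map f A)"
    if "A \<in> rcarrier ?Q" for c A
    using that free.subspace_scale[OF V]
    by (auto simp: rcarrier_quotient_rep rscale_quotient_rep[OF U(1)] map lin_scale[OF f])
  moreover have "ract ?Q s A \<in> rcarrier ?Q \<and> coset_map f (ract ?Q s A) = \<beta> s (coset_map f A)"
    if "s \<in> S" "A \<in> rcarrier ?Q" for s A
    using that act by (auto simp: rcarrier_quotient_rep ract map)
  ultimately show ?thesis unfolding models_def by blast
qed

section \<open>Characters of a standardly indexed family\<close>

lemma maximal_left_ideal_chi: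
  assumes "X \<in> supports"
  shows "maximal_left_ideal {p :: 'b::left_regular_band \<Rightarrow>\<^sub>0 'k::field. chi X p = 0}"
proof -
  let ?K = "{p :: 'b \<Rightarrow>\<^sub>0 'k. chi X p = 0}"
  obtain b where b: "supp b = X" using assms by (rule supportsE)
  have "left_ideal ?K"
    unfolding left_ideal_def by (auto intro!: free.subspaceI simp: chi_add chi_pscale chi_mult)
  moreover have "?K \<noteq> UNIV"
  proof
    assume "?K = UNIV"
    then have "chi X (Poly_Mapping.single b (1::'k)) = 0" by blast
    then show False by (simp add: chi_single b)
  qed
  moreover have "L = ?K \<or> L = UNIV" if L: "left_ideal L" "?K \<subseteq> L" for L
  proof (rule disjCI)
    assume "L \<noteq> UNIV"
    show "L = ?K"
    proof (rule ccontr)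
      assume "L \<noteq> ?K"
      then obtain x where x: "x \<in> L" "chi X x \<noteq> 0" using L by blast
      have sub: "free.subspace L" using L by (simp add: left_ideal_def)
      have "p \<in> L" for p
      proof -
        let ?c = "chi X p / chi X x"
        have "p - pscale ?c x \<in> L" using L x by (auto simp: chi_diff chi_pscale)
        then have "p - pscale ?c x + pscale ?c x \<in> L"
          using x by (intro free.subspace_add[OF sub] free.subspace_scale[OF sub])
        then show ?thesis by simp
      qed
      then show False using \<open>L \<noteq> UNIV\<close> by blast
    qed
  qed
  ultimately show ?thesis unfolding maximal_left_ideal_def by blast
qed

lemma jacobson_radical_subset: "jacobson_radical \<subseteq> rad"
  using maximal_left_ideal_chi unfolding jacobson_radical_def rad_def by blast

lemma left_ideal_jacobson_radical: "left_ideal jacobson_radical"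
  unfolding jacobson_radical_def maximal_left_ideal_def left_ideal_def
  by (auto intro!: free.subspace_Inter)

lemma idempotent_rad_eq_0:
  assumes "e \<star> e = e" "e \<in> rad"
  shows "e = 0"
proof -
  have "e \<in> supp_filtration (n - k)" if "e \<in> supp_filtration n" for n k
  proof (induction k)
    case (Suc k)
    show ?case
    proof (cases "n \<le> k")
      case False
      then have "e \<in> supp_filtration (Suc (n - Suc k))" using Suc by (simp add: Suc_diff_Suc)
      then show ?thesis using supp_filtration_mult[OF _ assms(2)] assms(1) by metis
    qed (use Suc in simp)
  qed (use that in simp)
  from this[OF supp_filtration_UNIV, of "card (UNIV :: 'a set)"]
  show ?thesis by (simp add: supp_filtration_0)
qed

lemma chi_standardly_indexed:
  fixes E :: "'b::left_regular_band set \<Rightarrow> ('b \<Rightarrow>\<^sub>0 'k::field)"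
  assumes "cfpoi E" "standardly_indexed E" "X \<in> supports" "Y \<in> supports"
  shows "chi Y (E X) = (if X = Y then 1 else 0)"
proof -
  let ?U = "{r \<star> E X | r. r \<in> jacobson_radical}" and ?V = "{a \<star> E X | a. True}"
  let ?W = "sub_rep ?V left_mult"
  let ?Q = "quotient_rep ?W ?U" and ?r = "rcoset ?W ?U"
  have idem: "E X \<star> E X = E X" "E X \<noteq> 0"
    using assms by (auto simp: cfpoi_def primitive_idempotent_def idempotent_def)
  have chi_idem: "chi Z (E X) = 1" if "chi Z (E X) \<noteq> 0" for Z
    using that idem chi_mult[of Z "E X" "E X"] by simp
  have jac: "free.subspace jacobson_radical" "\<And>a x. x \<in> jacobson_radical \<Longrightarrow> a \<star> x \<in> jacobson_radical"
    using left_ideal_jacobson_radical by (auto simp: left_ideal_def)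
  have U: "free.subspace ?U"
  proof -
    have "?U = (\<lambda>r. r \<star> E X) ` jacobson_radical" by auto
    then show ?thesis by (simp add: subspace_image[OF lin_alg_mult_left jac(1)])
  qed
  have Uchi: "chi Z u = 0" if "u \<in> ?U" "Z \<in> supports" for u Z
    using that radD[OF subsetD[OF jacobson_radical_subset]] by (clarsimp simp: chi_mult)
  have Umult: "a \<star> u \<in> ?U" if "u \<in> ?U" for a u
    using that jac(2) by (clarsimp simp flip: alg_mult_assoc) blast
  obtain f where f: "f \<in> rep_hom UNIV ?Q (simple_module X)"
    and bij: "bij_betw f (rcarrier ?Q) (rcarrier (simple_module X))"
    using assms by (auto simp: standardly_indexed_def rep_iso_def)
  have EQ: "?r (a \<star> E X) \<in> rcarrier ?Q" for a by (auto simp: rcarrier_quotient_rep)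
  have EX: "?r (E X) \<in> rcarrier ?Q" using EQ[of "E X"] by (simp add: idem)
  have key: "chi Z (basis b) * chi Z (E X) = chi X (basis b) * chi Z (E X)"
    if Z: "Z \<in> supports" for Z b
  proof -
    let ?c = "chi X (Poly_Mapping.single b (1::'k))"
    have 1: "ract ?Q b (?r (E X)) = ?r (basis b \<star> E X)"
      unfolding left_mult_def[symmetric]
      by (rule ract_quotient_rep[OF U]) (use Umult in \<open>simp add: left_mult_def flip: alg_mult_linear\<close>)
    have 2: "rscale ?Q ?c (?r (E X)) = ?r (pscale ?c (E X))"
      by (rule rscale_quotient_rep[OF U])
    have "f (ract ?Q b (?r (E X))) = f (rscale ?Q ?c (?r (E X)))"
      using f EX by (simp add: rep_hom_def simple_module_def chi_single)
    moreover have "pscale ?c (E X) = pscale ?c (E X) \<star> E X" by (simp add: alg_mult_linear idem)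
    then have "?r (pscale ?c (E X)) \<in> rcarrier ?Q" using EQ[of "pscale ?c (E X)"] by simp
    ultimately have "?r (basis b \<star> E X) = ?r (pscale ?c (E X))"
      using bij EQ unfolding 1 2 bij_betw_def inj_on_def by blast
    then have "basis b \<star> E X - pscale ?c (E X) \<in> ?U"
      by (simp add: rcoset_sub_rep_eq_iff[OF U])
    from Uchi[OF this Z] show ?thesis by (simp add: chi_diff chi_mult chi_pscale)
  qed
  have eq: "Z = X" if Z: "Z \<in> supports" and nz: "chi Z (E X) \<noteq> 0" for Z
  proof -
    obtain x where x: "supp x = X" using assms(3) by (rule supportsE)
    obtain z where z: "supp z = Z" using Z by (rule supportsE)
    show "Z = X"
      using key[OF Z, of x] key[OF Z, of z] nz x z
      by (auto simp: chi_single split: if_splits)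
  qed
  have "E X \<notin> rad" using idempotent_rad_eq_0 idem by blast
  then obtain Z where "Z \<in> supports" "chi Z (E X) \<noteq> 0" by (auto simp: rad_def)
  then have "chi X (E X) = 1" using eq chi_idem by blast
  then show ?thesis using eq assms by auto
qed

lemma band_idempotents_cfpoi:
  assumes "cfpoi E" "standardly_indexed E"
  shows "band_idempotents E"
proof
  show "\<And>X Y. X \<in> supports \<Longrightarrow> Y \<in> supports \<Longrightarrow> chi Y (E X) = (if X = Y then 1 else 0)"
    by (rule chi_standardly_indexed[OF assms])
qed (use assms in \<open>auto simp: cfpoi_def primitive_idempotent_def idempotent_def\<close>)

section \<open>Arrows and freeness\<close>

lemma projective_dual_basis:
  fixes L :: "('b::left_regular_band \<Rightarrow>\<^sub>0 'k::field) set" and e :: "'b \<Rightarrow>\<^sub>0 'k"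
  assumes L: "left_ideal L" and proj: "projective (sub_rep L left_mult)"
    and unit: "\<And>a. a \<star> e = a"
  obtains f :: "('b \<Rightarrow>\<^sub>0 'k) \<Rightarrow> ('b \<Rightarrow>\<^sub>0 'k) \<Rightarrow> ('b \<Rightarrow>\<^sub>0 'k)" and x :: "('b \<Rightarrow>\<^sub>0 'k) \<Rightarrow> ('b \<Rightarrow>\<^sub>0 'k)"
  where "\<And>j. x j \<in> L"
    and "\<And>j y z. y \<in> L \<Longrightarrow> z \<in> L \<Longrightarrow> f j (y + z) = f j y + f j z"
    and "\<And>j a y. y \<in> L \<Longrightarrow> f j (a \<star> y) = a \<star> f j y"
    and "\<And>y. y \<in> L \<Longrightarrow> finite {j. f j y \<noteq> 0}"
    and "\<And>y. y \<in> L \<Longrightarrow> y = (\<Sum>j | f j y \<noteq> 0. f j y \<star> x j)"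
proof -
  let ?F = "free_module :: ('k, 'b, ('b \<Rightarrow>\<^sub>0 'k) \<Rightarrow>\<^sub>0 ('b \<Rightarrow>\<^sub>0 'k)) rep"
  have sub: "free.subspace L" and mult: "a \<star> y \<in> L" if "y \<in> L" for a y
    using L that by (auto simp: left_ideal_def)
  obtain i p where i: "i \<in> rep_hom UNIV (sub_rep L left_mult) ?F"
    and p: "p \<in> rep_hom UNIV ?F (sub_rep L left_mult)" and pi: "\<And>y. y \<in> L \<Longrightarrow> p (i y) = y"
    using proj by (auto simp: projective_def)
  define f where "f j y = lookup (i y) j" for j y
  define x where "x j = p (Poly_Mapping.single j e)" for j
  have padd: "p (u + w) = p u + p w" for u w
    using p by (simp add: rep_hom_def free_module_def)
  have pscal: "p (Poly_Mapping.map (pscale c) u) = pscale c (p u)" for c u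
    using p by (simp add: rep_hom_def free_module_def)
  have pact: "p (Poly_Mapping.map (left_mult b) u) = left_mult b (p u)" for b u
    using p by (simp add: rep_hom_def free_module_def)
  have p0: "p 0 = 0" using padd[of 0 0] by simp
  have psum: "p (sum h A) = (\<Sum>a\<in>A. p (h a))" for h :: "'c \<Rightarrow> _" and A
    by (induction A rule: infinite_finite_induct) (auto simp: p0 padd)
  have map_single: "Poly_Mapping.map g (Poly_Mapping.single j u) = Poly_Mapping.single j (g u)" 
    if "g 0 = 0" for g :: "('b \<Rightarrow>\<^sub>0 'k) \<Rightarrow> ('b \<Rightarrow>\<^sub>0 'k)" and j :: "'b \<Rightarrow>\<^sub>0 'k" and u
    by (rule poly_mapping_eqI) (simp add: Poly_Mapping.map.rep_eq lookup_single when_def that)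
  have lm0: "left_mult b 0 = 0" for b :: 'b
    by (simp add: left_mult_def alg_mult_linear)
  have psingle: "p (Poly_Mapping.single j a) = a \<star> x j" for j a
  proof (rule lin_eq_on_keys[where p = a])
    show "lin (\<lambda>a. p (Poly_Mapping.single j a))"
      using padd[of "Poly_Mapping.single j _" "Poly_Mapping.single j _"]
        pscal[of _ "Poly_Mapping.single j _"]
      by (intro linI) (simp_all add: map_single single_add)
    show "lin (\<lambda>a. a \<star> x j)" by (rule lin_alg_mult_left)
    fix b
    have "Poly_Mapping.single j (basis b) = Poly_Mapping.map (left_mult b) (Poly_Mapping.single j e)"
      by (simp add: map_single lm0) (simp add: left_mult_def unit)
    then show "p (Poly_Mapping.single j (basis b)) = basis b \<star> x j"
      by (simp add: pact x_def) (simp add: left_mult_def)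
  qed
  have pexp: "p y = (\<Sum>j\<in>keys y. lookup y j \<star> x j)" for y
  proof -
    have "y = (\<Sum>j\<in>keys y. Poly_Mapping.single j (lookup y j))"
      by (rule poly_mapping_eqI) (auto simp: lookup_sum' lookup_single when_def in_keys_iff)
    then have "p y = (\<Sum>j\<in>keys y. p (Poly_Mapping.single j (lookup y j)))"
      using psum by metis
    then show ?thesis by (simp add: psingle)
  qed
  have keys: "{j. f j y \<noteq> 0} = keys (i y)" for y
    by (auto simp: f_def in_keys_iff)
  have fadd: "f j (y + z) = f j y + f j z" if "y \<in> L" "z \<in> L" for j y z
    using i that by (simp add: rep_hom_def free_module_def f_def lookup_add)
  have fscale: "f j (pscale c y) = pscale c (f j y)" if "y \<in> L" for j c y
    using i that by (simp add: rep_hom_def free_module_def f_def Poly_Mapping.map.rep_eq when_def)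
  have fact: "f j (left_mult b y) = left_mult b (f j y)" if "y \<in> L" for j b y
    using i that by (simp add: rep_hom_def free_module_def f_def Poly_Mapping.map.rep_eq when_def lm0)
  show thesis
  proof
    show "x j \<in> L" for j using p by (simp add: rep_hom_def free_module_def x_def)
    show "f j (a \<star> y) = a \<star> f j y" if "y \<in> L" for j a y
    proof (rule lin_eq_on_keys[where p = a])
      show "lin (\<lambda>a. f j (a \<star> y))"
        using that by (intro linI) (simp_all add: alg_mult_linear fadd fscale mult)
      show "lin (\<lambda>a. a \<star> f j y)" by (rule lin_alg_mult_left)
    qed (use fact[OF that] in \<open>simp add: left_mult_def\<close>)
    show "y = (\<Sum>j | f j y \<noteq> 0. f j y \<star> x j)" if "y \<in> L" for y
      using pi[OF that] pexp[of "i y"] by (simp add: keys) (simp add: f_def)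
  qed (auto simp: fadd keys)
qed

text \<open>The parameter \<^term>\<open>P\<close> is a projection onto the square of the radical; its kernel in the
  radical is spanned by lifts of the arrows of the quiver.\<close>

locale hereditary_idempotents = band_idempotents E
  for E :: "'b::left_regular_band set \<Rightarrow> ('b \<Rightarrow>\<^sub>0 'k::field)" +
  fixes P :: "('b \<Rightarrow>\<^sub>0 'k) \<Rightarrow> ('b \<Rightarrow>\<^sub>0 'k)"
  assumes hereditary: "left_ideal L \<Longrightarrow> projective (sub_rep (L :: ('b \<Rightarrow>\<^sub>0 'k) set) left_mult)"
    and lin_P: "lin P"
    and P_in: "P x \<in> rad_sq"
    and P_id: "x \<in> rad_sq \<Longrightarrow> P x = x"
    and P_left: "Y \<in> supports \<Longrightarrow> P (E Y \<star> x) = E Y \<star> P x"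
    and P_right: "X \<in> supports \<Longrightarrow> P (x \<star> E X) = P x \<star> E X"
begin

definition arrows :: "'b set \<Rightarrow> 'b set \<Rightarrow> ('b \<Rightarrow>\<^sub>0 'k) set" where
  "arrows Z X = {x \<in> rad. P x = 0 \<and> E Z \<star> x = x \<and> x \<star> E X = x}"

lemma arrowsD:
  assumes "x \<in> arrows Z X"
  shows "x \<in> rad" "P x = 0" "E Z \<star> x = x" "x \<star> E X = x"
  using assms by (auto simp: arrows_def)

lemma arrows_strict:
  assumes "X \<in> supports" "Z \<in> supports" "x \<in> arrows Z X" "x \<noteq> 0"
  shows "X \<subset> Z"
proof -
  have x: "E Z \<star> x \<star> E X = x" "x \<in> rad" using arrowsD[OF assms(3)] by auto
  then have "X \<subseteq> Z" using E_mult_E_eq_0[OF assms(1,2)] assms(4) by metis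
  moreover have "X \<noteq> Z" using E_rad_E_eq_0[OF assms(1) x(2)] x(1) assms(4) by metis
  ultimately show ?thesis by auto
qed

lemma arrow_part:
  assumes "x \<in> rad" "X \<in> supports" "Z \<in> supports" "E Z \<star> x = x" "x \<star> E X = x"
  shows "x - P x \<in> arrows Z X"
proof -
  have "P x \<in> rad" using P_in rad_sq_subset by blast
  moreover have "E Z \<star> P x = P x" "P x \<star> E X = P x"
    using assms P_left[of Z x] P_right[of X x] by auto
  ultimately show ?thesis
    using assms by (auto simp: arrows_def lin_diff[OF lin_P] P_id[OF P_in] alg_mult_linear
        intro: free.subspace_diff[OF subspace_rad])
qed

definition arrow_basis :: "'b set \<Rightarrow> 'b set \<Rightarrow> ('b \<Rightarrow>\<^sub>0 'k) set" where
  "arrow_basis Z X = (SOME B. B \<subseteq> arrows Z X \<and> free.independent B \<and> arrows Z X \<subseteq> free.span B)"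

lemma
  shows arrow_basis_subset: "arrow_basis Z X \<subseteq> arrows Z X"
    and independent_arrow_basis: "free.independent (arrow_basis Z X)"
    and arrows_subset_span: "arrows Z X \<subseteq> free.span (arrow_basis Z X)"
proof -
  have "\<exists>B. B \<subseteq> arrows Z X \<and> free.independent B \<and> arrows Z X \<subseteq> free.span B"
    by (metis free.maximal_independent_subset)
  from someI_ex[OF this, folded arrow_basis_def]
  show "arrow_basis Z X \<subseteq> arrows Z X" "free.independent (arrow_basis Z X)"
    "arrows Z X \<subseteq> free.span (arrow_basis Z X)" by auto
qed

lemma finite_arrow_basis [simp]: "finite (arrow_basis Z X)"
proof -
  have "arrow_basis Z X \<subseteq> free.span ((\<lambda>b. basis b) ` UNIV)"
    by (auto simp: span_singles)
  then show ?thesis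
    using free.independent_span_bound[of "range (\<lambda>b. basis b)" "arrow_basis Z X"]
    by (simp add: independent_arrow_basis)
qed

lemma arrow_basis_arrow: "v \<in> arrow_basis Z X \<Longrightarrow> v \<in> arrows Z X"
  using arrow_basis_subset by blast

definition arrow_index :: "'b set \<Rightarrow> ('b set \<times> ('b \<Rightarrow>\<^sub>0 'k)) set" where
  "arrow_index X = Sigma supports (\<lambda>Z. arrow_basis Z X)"

lemma finite_arrow_index [simp]: "finite (arrow_index X)"
  by (simp add: arrow_index_def)

lemma arrow_indexD:
  assumes "i \<in> arrow_index X"
  shows "fst i \<in> supports" "snd i \<in> arrow_basis (fst i) X" "snd i \<in> arrows (fst i) X"
  using assms by (auto simp: arrow_index_def arrow_basis_arrow)

lemma arrow_index_independent:
  assumes sum0: "(\<Sum>i\<in>arrow_index X. pscale (r i) (snd i)) = 0" and i: "i \<in> arrow_index X"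
  shows "r i = 0"
proof -
  obtain Z v where Zv: "i = (Z, v)" "Z \<in> supports" "v \<in> arrow_basis Z X"
    using i by (auto simp: arrow_index_def)
  have *: "E Z \<star> w = (if Z' = Z then w else 0)" if "Z' \<in> supports" "w \<in> arrow_basis Z' X" for Z' w
  proof -
    have w: "E Z' \<star> w = w" using that arrow_basis_subset arrowsD by blast
    have "E Z \<star> E Z' \<star> w = E Z \<star> w" by (simp add: alg_mult_assoc w)
    then show ?thesis using E_orth[OF Zv(2) that(1)] w by (cases "Z' = Z") (simp_all add: alg_mult_linear)
  qed
  have "0 = E Z \<star> (\<Sum>i\<in>arrow_index X. pscale (r i) (snd i))" by (simp add: sum0 alg_mult_linear)
  also have "\<dots> = (\<Sum>Z'\<in>supports. \<Sum>w\<in>arrow_basis Z' X. pscale (r (Z', w)) (E Z \<star> w))"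
    by (simp add: alg_mult_sum_right alg_mult_linear arrow_index_def sum.Sigma case_prod_beta)
  also have "\<dots> = (\<Sum>Z'\<in>supports. if Z' = Z then \<Sum>w\<in>arrow_basis Z' X. pscale (r (Z', w)) w else 0)"
    by (intro sum.cong) (auto simp: *)
  also have "\<dots> = (\<Sum>w\<in>arrow_basis Z X. pscale (r (Z, w)) w)"
    using Zv by simp
  finally have "(\<Sum>w\<in>arrow_basis Z X. pscale (r (Z, w)) w) = 0" ..
  then have "r (Z, v) = 0"
    using free.independentD[OF independent_arrow_basis finite_arrow_basis order_refl _ Zv(3),
        of "\<lambda>w. r (Z, w)"] by simp
  then show ?thesis by (simp add: Zv)
qed

definition arrow_combination :: "'b set \<Rightarrow> ('b set \<times> ('b \<Rightarrow>\<^sub>0 'k) \<Rightarrow> ('b \<Rightarrow>\<^sub>0 'k)) \<Rightarrow> ('b \<Rightarrow>\<^sub>0 'k)" where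
  "arrow_combination X c = (\<Sum>i\<in>arrow_index X. c i \<star> snd i)"

definition arrow_coefficients :: "'b set \<Rightarrow> ('b set \<times> ('b \<Rightarrow>\<^sub>0 'k) \<Rightarrow> ('b \<Rightarrow>\<^sub>0 'k)) set" where
  "arrow_coefficients X = {c. \<forall>i\<in>arrow_index X. c i \<star> E (fst i) = c i}"

abbreviation arrow_module :: "'b set \<Rightarrow> ('b \<Rightarrow>\<^sub>0 'k) set" where
  "arrow_module X \<equiv> arrow_combination X ` arrow_coefficients X"

lemma subspace_arrow_module: "free.subspace (arrow_module X)"
proof (rule free.subspaceI)
  have "arrow_combination X (\<lambda>_. 0) = 0" "(\<lambda>_. 0) \<in> arrow_coefficients X"
    by (auto simp: arrow_combination_def arrow_coefficients_def alg_mult_linear)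
  then show "0 \<in> arrow_module X" by force
next
  fix x y assume "x \<in> arrow_module X" "y \<in> arrow_module X"
  then obtain c d where c: "x = arrow_combination X c" "c \<in> arrow_coefficients X"
    and d: "y = arrow_combination X d" "d \<in> arrow_coefficients X" by auto
  then have "x + y = arrow_combination X (\<lambda>i. c i + d i)" "(\<lambda>i. c i + d i) \<in> arrow_coefficients X"
    by (auto simp: arrow_combination_def arrow_coefficients_def alg_mult_linear sum.distrib)
  then show "x + y \<in> arrow_module X" by force
next
  fix r x assume "x \<in> arrow_module X"
  then obtain c where c: "x = arrow_combination X c" "c \<in> arrow_coefficients X" by auto
  then have "pscale r x = arrow_combination X (\<lambda>i. pscale r (c i))" "(\<lambda>i. pscale r (c i)) \<in> arrow_coefficients X"
    by (auto simp: arrow_combination_def arrow_coefficients_def alg_mult_linear free.scale_sum_right)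
  then show "pscale r x \<in> arrow_module X" by force
qed

lemma arrow_module_mult_left:
  assumes "x \<in> arrow_module X"
  shows "a \<star> x \<in> arrow_module X"
proof -
  obtain c where c: "x = arrow_combination X c" "c \<in> arrow_coefficients X" using assms by auto
  then have "a \<star> x = arrow_combination X (\<lambda>i. a \<star> c i)" "(\<lambda>i. a \<star> c i) \<in> arrow_coefficients X"
    by (auto simp: arrow_combination_def arrow_coefficients_def alg_mult_sum_right alg_mult_assoc)
  then show ?thesis by force
qed

lemma arrows_subset_module:
  assumes "Z \<in> supports"
  shows "arrows Z X \<subseteq> arrow_module X"
proof -
  have "v \<in> arrow_module X" if v: "v \<in> arrow_basis Z X" for v
  proof
    let ?c = "\<lambda>i. if i = (Z, v) then E Z else 0"
    have i: "(Z, v) \<in> arrow_index X" using v assms by (simp add: arrow_index_def)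
    have "arrow_combination X ?c = (\<Sum>i\<in>arrow_index X. if i = (Z, v) then E Z \<star> v else 0)"
      unfolding arrow_combination_def by (intro sum.cong) (auto simp: alg_mult_linear)
    also have "\<dots> = v" using i arrowsD(3)[of v Z X] v arrow_basis_subset by auto
    finally show "v = arrow_combination X ?c" by simp
    show "?c \<in> arrow_coefficients X"
      using assms by (auto simp: arrow_coefficients_def E_idem alg_mult_linear)
  qed
  then have "free.span (arrow_basis Z X) \<subseteq> arrow_module X"
    by (intro free.span_minimal subspace_arrow_module) auto
  then show ?thesis using arrows_subset_span by blast
qed

lemma arrows_generate_aux:
  assumes X: "X \<in> supports"
  shows "p \<in> supp_filtration n \<Longrightarrow> q \<in> rad \<Longrightarrow> p \<star> q \<star> E X \<in> arrow_module X"
proof (induction n arbitrary: p q)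
  case 0
  then have "p = 0" by (rule_tac supp_filtration_0)
  then show ?case
    by (simp add: alg_mult_linear free.subspace_0[OF subspace_arrow_module])
next
  case (Suc n)
  let ?M = "arrow_module X"
  define y where "y = q \<star> E X"
  have y: "y \<in> rad" "y \<star> E X = y"
    using Suc.prems X by (simp_all add: y_def rad_mult_right mult_E_E)
  have "E Z \<star> (y - P y) \<in> arrows Z X" if "Z \<in> supports" for Z
    using arrow_part[of "E Z \<star> y" X Z] that X y
    by (simp add: alg_mult_linear P_left rad_mult_left E_E_mult alg_mult_assoc)
  then have "(\<Sum>Z\<in>supports. E Z \<star> (y - P y)) \<in> ?M"
    using arrows_subset_module by (intro free.subspace_sum[OF subspace_arrow_module]) blast
  then have "y - P y \<in> ?M" by (simp add: E_unit_left flip: alg_mult_sum_left)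
  then have 1: "p \<star> (y - P y) \<in> ?M" by (rule arrow_module_mult_left)
  have "lin (\<lambda>s. p \<star> s \<star> E X)" by (rule lin_compose[OF lin_alg_mult_left lin_alg_mult_right])
  then have "p \<star> P y \<star> E X \<in> ?M"
  proof (rule lin_span_subset[OF _ subspace_arrow_module _ P_in[unfolded rad_sq_def]])
    fix s :: "'b \<Rightarrow>\<^sub>0 'k" assume "s \<in> {p \<star> q |p q. p \<in> rad \<and> q \<in> rad}"
    then obtain r t where rt: "s = r \<star> t" "r \<in> rad" "t \<in> rad" by auto
    have "p \<star> r \<star> t \<star> E X \<in> ?M"
      by (rule Suc.IH[OF supp_filtration_mult[OF Suc.prems(1) rt(2)] rt(3)])
    then show "p \<star> s \<star> E X \<in> ?M" by (simp add: rt alg_mult_assoc)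
  qed
  moreover have "P y \<star> E X = P y" using P_right[OF X, of y] y by simp
  ultimately have 2: "p \<star> P y \<in> ?M" by (simp add: alg_mult_assoc)
  have "p \<star> (y - P y) + p \<star> P y \<in> ?M"
    by (rule free.subspace_add[OF subspace_arrow_module 1 2])
  then show ?case by (simp add: alg_mult_linear y_def alg_mult_assoc)
qed

lemma arrows_generate:
  assumes "X \<in> supports" "x \<in> rad" "x \<star> E X = x"
  obtains c where "c \<in> arrow_coefficients X" "x = arrow_combination X c"
proof -
  have "(\<Sum>Z\<in>supports. E Z) \<star> x \<star> E X \<in> arrow_module X"
    by (rule arrows_generate_aux[OF assms(1) supp_filtration_UNIV assms(2)])
  then show ?thesis using that assms by (auto simp: E_unit_left)
qed

text \<open>The dual basis yields a matrix \<^term>\<open>m\<close> over the algebra that is the identity modulo the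
  radical and is annihilated by every relation, so relations lie in all layers of the filtration.\<close>

theorem arrows_free:
  assumes X: "X \<in> supports" and a: "a \<in> arrow_coefficients X"
    and rel: "arrow_combination X a = 0" and i: "i \<in> arrow_index X"
  shows "a i = 0"
proof -
  let ?I = "arrow_index X" and ?L = "{x \<in> rad. x \<star> E X = x}"
  have L: "left_ideal ?L"
    unfolding left_ideal_def
    by (auto intro!: free.subspaceI simp: alg_mult_linear rad_mult_left alg_mult_assoc
        free.subspace_0[OF subspace_rad] free.subspace_add[OF subspace_rad]
        free.subspace_scale[OF subspace_rad])
  then have Lsub: "free.subspace ?L" by (simp add: left_ideal_def)
  show ?thesis
  proof (rule projective_dual_basis[OF L hereditary[OF L] E_unit_right])
    fix f x assume xL: "\<And>j. x j \<in> ?L"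
      and fadd: "\<And>j y z. y \<in> ?L \<Longrightarrow> z \<in> ?L \<Longrightarrow> f j (y + z) = f j y + f j z"
      and fmult: "\<And>j a y. y \<in> ?L \<Longrightarrow> f j (a \<star> y) = a \<star> f j y"
      and ffin: "\<And>y. y \<in> ?L \<Longrightarrow> finite {j. f j y \<noteq> 0}"
      and fsum: "\<And>y. y \<in> ?L \<Longrightarrow> y = (\<Sum>j | f j y \<noteq> 0. f j y \<star> x j)"
    have vL: "snd l \<in> ?L" if "l \<in> ?I" for l
      using arrow_indexD(3)[OF that] arrowsD by blast
    define K where "K = (\<Union>l\<in>?I. {j. f j (snd l) \<noteq> 0})"
    have finK: "finite K" unfolding K_def by (rule finite_UN_I[OF finite_arrow_index ffin[OF vL]])
    have v_exp: "snd l = (\<Sum>j\<in>K. f j (snd l) \<star> x j)" if "l \<in> ?I" for l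
    proof -
      have "(\<Sum>j | f j (snd l) \<noteq> 0. f j (snd l) \<star> x j) = (\<Sum>j\<in>K. f j (snd l) \<star> x j)"
        by (rule sum.mono_neutral_left) (use that finK in \<open>auto simp: K_def alg_mult_linear\<close>)
      then show ?thesis using fsum[OF vL[OF that]] by simp
    qed
    have "\<forall>j. \<exists>c\<in>arrow_coefficients X. x j = arrow_combination X c"
      using arrows_generate[OF X] xL by blast
    then obtain c where c: "\<And>j. c j \<in> arrow_coefficients X" "\<And>j. x j = arrow_combination X (c j)"
      by metis
    define m where "m l i = (\<Sum>j\<in>K. f j (snd l) \<star> c j i)" for l i :: "'b set \<times> ('b \<Rightarrow>\<^sub>0 'k)"
    have mE: "m l i \<star> E (fst i) = m l i" if "i \<in> ?I" for l i
      using c(1) that by (simp add: m_def arrow_coefficients_def alg_mult_sum_left alg_mult_assoc)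
    have v_m: "snd l = (\<Sum>i\<in>?I. m l i \<star> snd i)" if "l \<in> ?I" for l
    proof -
      have "snd l = (\<Sum>j\<in>K. \<Sum>i\<in>?I. f j (snd l) \<star> c j i \<star> snd i)"
        using v_exp[OF that] by (simp add: c(2) arrow_combination_def alg_mult_sum_right alg_mult_assoc)
      also have "\<dots> = (\<Sum>i\<in>?I. m l i \<star> snd i)"
        unfolding m_def alg_mult_sum_left by (rule sum.swap)
      finally show ?thesis .
    qed
    define e where "e l i = chi (fst i) (m l i)" for l i
    define n where "n l i = pscale (e l i) (E (fst i)) - m l i" for l i
    have nJ: "n l i \<in> rad" if i: "i \<in> ?I" for l i
    proof (rule radI)
      fix W :: "'b set" assume W: "W \<in> supports"
      have "chi W (m l i) = chi W (m l i) * chi W (E (fst i))"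
        using mE[OF i, of l] by (metis chi_mult)
      then show "chi W (n l i) = 0"
        using W arrow_indexD(1)[OF i]
        by (cases "W = fst i") (simp_all add: n_def e_def chi_diff chi_pscale chi_E)
    qed
    have delta: "e l i = (if i = l then 1 else 0)" if l: "l \<in> ?I" and i: "i \<in> ?I" for l i
    proof -
      let ?r = "\<lambda>i. e l i - (if i = l then 1 else 0)"
      let ?s = "\<Sum>i\<in>?I. pscale (?r i) (snd i)"
      have "(\<Sum>i\<in>?I. pscale (if i = l then 1 else 0) (snd i)) = (\<Sum>i\<in>?I. if i = l then snd i else 0)"
        by (intro sum.cong) auto
      also have "\<dots> = snd l" using l by simp
      finally have "?s = (\<Sum>i\<in>?I. pscale (e l i) (snd i)) - snd l"
        by (simp add: free.scale_left_diff_distrib sum_subtractf)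
      also have "\<dots> = (\<Sum>i\<in>?I. pscale (e l i) (E (fst i) \<star> snd i) - m l i \<star> snd i)"
        using v_m[OF l] by (simp add: sum_subtractf arrowsD(3)[OF arrow_indexD(3)])
      also have "\<dots> = (\<Sum>i\<in>?I. n l i \<star> snd i)"
        by (simp add: n_def alg_mult_linear)
      finally have s: "?s = (\<Sum>i\<in>?I. n l i \<star> snd i)" .
      have "(\<Sum>i\<in>?I. n l i \<star> snd i) \<in> rad_sq"
        using nJ vL by (intro free.subspace_sum[OF subspace_rad_sq] rad_sqI) auto
      then have "P ?s = ?s" unfolding s by (rule P_id)
      moreover have "P ?s = 0"
        by (simp add: lin_sum[OF lin_P] lin_scale[OF lin_P] arrowsD(2)[OF arrow_indexD(3)])
      ultimately have "?s = 0" by simp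
      from arrow_index_independent[OF this i] show ?thesis by simp
    qed
    have am0: "(\<Sum>l\<in>?I. a l \<star> m l i) = 0" if i: "i \<in> ?I" for i
    proof -
      have fI: "f j (\<Sum>l\<in>A. a l \<star> snd l) = (\<Sum>l\<in>A. a l \<star> f j (snd l)) \<and> (\<Sum>l\<in>A. a l \<star> snd l) \<in> ?L"
        if "finite A" "A \<subseteq> ?I" for A j
        using that
      proof (induction A rule: finite_induct)
        case empty
        have "0 \<in> ?L" by (rule free.subspace_0[OF Lsub])
        then show ?case using fadd[of 0 0 j] by simp
      next
        case (insert l A)
        have "a l \<star> snd l \<in> ?L" using vL L insert.prems unfolding left_ideal_def by blast
        moreover have "(\<Sum>l\<in>A. a l \<star> snd l) \<in> ?L" using insert by blast
        moreover have "a l \<star> snd l + (\<Sum>l\<in>A. a l \<star> snd l) \<in> ?L"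
          by (rule free.subspace_add[OF Lsub]) (fact calculation)+
        moreover have "f j (a l \<star> snd l) = a l \<star> f j (snd l)"
          using fmult vL insert.prems by blast
        ultimately show ?case using insert fadd[of "a l \<star> snd l" "\<Sum>l\<in>A. a l \<star> snd l" j] by simp
      qed
      have 0: "(\<Sum>l\<in>?I. a l \<star> f j (snd l)) = 0" for j
      proof -
        have "0 \<in> ?L" by (rule free.subspace_0[OF Lsub])
        then have "f j 0 = 0" using fadd[of 0 0 j] by simp
        then show ?thesis using fI[OF finite_arrow_index order_refl, of j] rel by (simp add: arrow_combination_def)
      qed
      have "(\<Sum>l\<in>?I. a l \<star> m l i) = (\<Sum>l\<in>?I. \<Sum>j\<in>K. a l \<star> f j (snd l) \<star> c j i)"
        by (simp add: m_def alg_mult_sum_right alg_mult_assoc)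
      also have "\<dots> = (\<Sum>j\<in>K. (\<Sum>l\<in>?I. a l \<star> f j (snd l)) \<star> c j i)"
        unfolding alg_mult_sum_left by (rule sum.swap)
      also have "\<dots> = 0" by (simp add: 0 alg_mult_linear)
      finally show ?thesis .
    qed
    have step: "a i = (\<Sum>l\<in>?I. a l \<star> n l i)" if i: "i \<in> ?I" for i
    proof -
      have "(\<Sum>l\<in>?I. a l \<star> pscale (e l i) (E (fst i))) = (\<Sum>l\<in>?I. if l = i then a l \<star> E (fst i) else 0)"
        by (intro sum.cong) (auto simp: delta i alg_mult_linear)
      also have "\<dots> = a i" using i a by (simp add: arrow_coefficients_def)
      finally have "(\<Sum>l\<in>?I. a l \<star> n l i) = a i - (\<Sum>l\<in>?I. a l \<star> m l i)"
        by (simp add: n_def alg_mult_linear sum_subtractf)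
      then show ?thesis by (simp add: am0[OF i])
    qed
    define N where "N = card (UNIV :: 'b set)"
    have "\<forall>i\<in>?I. a i \<in> supp_filtration (N - k)" for k
    proof (induction k)
      case 0
      show ?case by (simp add: N_def supp_filtration_UNIV)
    next
      case (Suc k)
      show ?case
      proof (cases "N \<le> k")
        case False
        then have "\<forall>l\<in>?I. a l \<in> supp_filtration (Suc (N - Suc k))" using Suc by (simp add: Suc_diff_Suc)
        then have "(\<Sum>l\<in>?I. a l \<star> n l i) \<in> supp_filtration (N - Suc k)" if "i \<in> ?I" for i
          using nJ[OF that] by (intro free.subspace_sum[OF subspace_supp_filtration] supp_filtration_mult) auto
        then show ?thesis using step by (auto simp only:)
      qed (use Suc in simp)
    qed
    from this[of N] i show "a i = 0" by (simp add: supp_filtration_0)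
  qed
qed

end

section \<open>Tensor products of arrow spaces\<close>

lemma mem_listset_iff:
  "vs \<in> listset As \<longleftrightarrow> length vs = length As \<and> (\<forall>i<length As. vs ! i \<in> As ! i)"
proof (induction As arbitrary: vs)
  case (Cons A As)
  show ?case
    by (cases vs) (auto simp: set_Cons_def Cons nth_Cons split: nat.splits)
qed simp

lemma Cons_mem_set_Cons [simp]: "v # vs \<in> set_Cons A B \<longleftrightarrow> v \<in> A \<and> vs \<in> B"
  by (auto simp: set_Cons_def)

lemma listset_ConsE:
  assumes "ws \<in> listset (A # As)"
  obtains v vs where "ws = v # vs" "v \<in> A" "vs \<in> listset As"
  using assms by (auto simp: set_Cons_def)

lemma keys_pushforward_Cons:
  assumes "keys q \<subseteq> listset As" "v \<in> A"
  shows "keys (pushforward ((#) v) q) \<subseteq> listset (A # As)"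
proof -
  have "(#) v ` keys q \<subseteq> listset (A # As)" using assms by auto
  then show ?thesis using keys_pushforward[of "(#) v" q] by (rule order_trans[rotated])
qed

lemma tensor_relation_add:
  assumes "vs \<in> listset (map rcarrier Vs)" "i < length Vs" "u \<in> rcarrier (Vs ! i)" "w \<in> rcarrier (Vs ! i)"
  shows "basis (vs[i := radd (Vs ! i) u w])
        - basis (vs[i := u]) - basis (vs[i := w]) \<in> tensor_relations Vs"
  using assms unfolding tensor_relations_def by blast

lemma tensor_relation_scale:
  assumes "vs \<in> listset (map rcarrier Vs)" "i < length Vs" "u \<in> rcarrier (Vs ! i)"
  shows "basis (vs[i := rscale (Vs ! i) c u])
        - pscale c (basis (vs[i := u])) \<in> tensor_relations Vs"
  using assms unfolding tensor_relations_def by blast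

lemma tensor_relationsE:
  assumes "r \<in> tensor_relations Vs"
  obtains vs i u w where "vs \<in> listset (map rcarrier Vs)" "i < length Vs" "u \<in> rcarrier (Vs ! i)"
      "w \<in> rcarrier (Vs ! i)"
      "r = basis (vs[i := radd (Vs ! i) u w])
        - basis (vs[i := u]) - basis (vs[i := w])"
  | vs i u c where "vs \<in> listset (map rcarrier Vs)" "i < length Vs" "u \<in> rcarrier (Vs ! i)"
      "r = basis (vs[i := rscale (Vs ! i) c u])
        - pscale c (basis (vs[i := u]))"
  using assms unfolding tensor_relations_def by blast

lemma pushforward_Cons_tensor_relations:
  fixes q :: "'v list \<Rightarrow>\<^sub>0 'k::field"
  assumes "q \<in> free.span (tensor_relations Vs)" "v \<in> rcarrier V"
  shows "pushforward ((#) v) q \<in> free.span (tensor_relations (V # Vs))"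
proof (rule lin_span_subset[OF lin_pushforward free.subspace_span _ assms(1)])
  fix r assume "r \<in> tensor_relations Vs"
  then show "pushforward ((#) v) r \<in> free.span (tensor_relations (V # Vs))"
  proof (cases rule: tensor_relationsE)
    case (1 vs i u w)
    then show ?thesis
      using tensor_relation_add[of "v # vs" "V # Vs" "Suc i" u w] assms(2)
      by (intro free.span_base) (simp add: lin_diff[OF lin_pushforward] pushforward_single)
  next
    case (2 vs i u c)
    then show ?thesis
      using tensor_relation_scale[of "v # vs" "V # Vs" "Suc i" u c] assms(2)
      by (intro free.span_base)
        (simp add: lin_diff[OF lin_pushforward] lin_scale[OF lin_pushforward] pushforward_single)
  qed
qed

lemma tensor_head_expansion:
  fixes Vs :: "('k::field, 's, 'v) rep list"
  assumes t: "models S V W \<beta> t" and vs: "vs \<in> listset (map rcarrier Vs)"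
    and "finite B"
  shows "B \<subseteq> W \<Longrightarrow> v \<in> rcarrier V \<Longrightarrow> t v = (\<Sum>b\<in>B. pscale (r b) b) \<Longrightarrow>
    basis (v # vs)
      - (\<Sum>b\<in>B. pscale (r b) (basis (inv_into (rcarrier V) t b # vs)))
    \<in> free.span (tensor_relations (V # Vs))"
  using assms(3)
proof (induction B arbitrary: v rule: finite_induct)
  case empty
  then have "t (rscale V 0 v) = t v" by (simp add: models_scale[OF t])
  then have v: "rscale V 0 v = v"
    using models_inj[OF t] models_scale_closed[OF t] empty by blast
  have "basis (v # vs) \<in> tensor_relations (V # Vs)"
    using tensor_relation_scale[of "v # vs" "V # Vs" 0 v 0] vs empty by (simp add: v)
  then show ?case by (simp add: free.span_base)
next
  case (insert b B)
  let ?s = "inv_into (rcarrier V) t" and ?R = "free.span (tensor_relations (V # Vs))"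
  let ?e = "\<lambda>v. Poly_Mapping.single (v # vs) (1::'k)"
  have sW: "?s x \<in> rcarrier V \<and> t (?s x) = x" if "x \<in> W" for x
    using that models_bij[OF t] by (metis bij_betw_imp_surj_on f_inv_into_f inv_into_into)
  have rest: "(\<Sum>b\<in>B. pscale (r b) b) \<in> W"
    using insert.prems(1)
    by (intro free.subspace_sum[OF models_subspace[OF t]] free.subspace_scale[OF models_subspace[OF t]]) auto
  define y where "y = rscale V (r b) (?s b)"
  define w where "w = ?s (\<Sum>b\<in>B. pscale (r b) b)"
  have b: "?s b \<in> rcarrier V" "t (?s b) = b" using sW insert.prems(1) by auto
  have y: "y \<in> rcarrier V" "t y = pscale (r b) b"
    using models_scale_closed[OF t b(1)] models_scale[OF t b(1)] b(2) by (auto simp: y_def)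
  have w: "w \<in> rcarrier V" "t w = (\<Sum>b\<in>B. pscale (r b) b)" using sW[OF rest] by (auto simp: w_def)
  have "t (radd V y w) = t v"
    using insert.hyps insert.prems(3) by (simp add: models_add[OF t y(1) w(1)] y w)
  then have v: "radd V y w = v"
    using models_inj[OF t] models_add_closed[OF t y(1) w(1)] insert.prems(2) by blast
  have 1: "?e v - ?e y - ?e w \<in> ?R"
    using tensor_relation_add[of "v # vs" "V # Vs" 0 y w] vs insert.prems(2) y w
    by (simp add: v free.span_base)
  have 2: "?e y - pscale (r b) (?e (?s b)) \<in> ?R"
    using tensor_relation_scale[of "v # vs" "V # Vs" 0 "?s b" "r b"] vs insert.prems(2) b
    by (simp add: y_def free.span_base)
  have 3: "?e w - (\<Sum>b\<in>B. pscale (r b) (?e (?s b))) \<in> ?R"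
    using insert.IH[of w] insert.prems(1) w by blast
  have mem: "(?e v - ?e y - ?e w) + (?e y - pscale (r b) (?e (?s b))) + (?e w - (\<Sum>b\<in>B. pscale (r b) (?e (?s b)))) \<in> ?R"
    by (intro free.span_add 1 2 3)
  have eq: "(?e v - ?e y - ?e w) + (?e y - pscale (r b) (?e (?s b))) + (?e w - (\<Sum>b\<in>B. pscale (r b) (?e (?s b))))
    = ?e v - (\<Sum>b\<in>insert b B. pscale (r b) (?e (?s b)))"
    using insert.hyps by (simp add: algebra_simps)
  show ?case using mem unfolding eq .
qed

context hereditary_idempotents
begin

fun chain_space :: "'b set list \<Rightarrow> ('b \<Rightarrow>\<^sub>0 'k) set" where
  "chain_space [] = {0}"
| "chain_space [X] = range (\<lambda>c. pscale c (E X))"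
| "chain_space (X # Z # C) = free.span {a \<star> v | a v. a \<in> chain_space (Z # C) \<and> v \<in> arrows Z X}"

lemma subspace_chain_space: "free.subspace (chain_space C)"
proof (cases C rule: chain_space.cases)
  case (2 X)
  have "range (\<lambda>c. pscale c (E X)) = free.span {E X}" by (simp add: free.span_singleton)
  then show ?thesis using 2 by simp
qed auto

lemma chain_space_right_unit:
  assumes "X \<in> supports" "a \<in> chain_space (X # C)"
  shows "a \<star> E X = a"
proof (cases C)
  case Nil
  then show ?thesis using assms by (auto simp: alg_mult_linear E_idem)
next
  case (Cons Z C')
  have sub: "free.subspace {a. a \<star> E X = a}"
    by (rule free.subspaceI) (auto simp: alg_mult_linear)
  have "chain_space (X # C) \<subseteq> {a. a \<star> E X = a}"
    unfolding Cons chain_space.simps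
    by (rule free.span_minimal[OF _ sub]) (auto simp: alg_mult_assoc arrowsD)
  then show ?thesis using assms by auto
qed

lemma chain_space_left_unit:
  assumes "C \<noteq> []" "set C \<subseteq> supports" "a \<in> chain_space C"
  shows "E (last C) \<star> a = a"
  using assms
proof (induction C arbitrary: a rule: chain_space.induct)
  case (2 X)
  then show ?case by (auto simp: alg_mult_linear E_idem)
next
  case (3 X Z C)
  have sub: "free.subspace {a. E (last (Z # C)) \<star> a = a}"
    by (rule free.subspaceI) (auto simp: alg_mult_linear)
  have "chain_space (X # Z # C) \<subseteq> {a. E (last (Z # C)) \<star> a = a}"
    unfolding chain_space.simps
  proof (rule free.span_minimal[OF _ sub], clarify)
    fix a v assume "a \<in> chain_space (Z # C)"
    then have "E (last (Z # C)) \<star> a = a" using 3 by auto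
    then show "E (last (Z # C)) \<star> (a \<star> v) = a \<star> v" by (simp only: alg_mult_assoc[symmetric])
  qed
  then show ?case using 3 by auto
qed simp

fun product_eval :: "('v \<Rightarrow> ('b \<Rightarrow>\<^sub>0 'k)) list \<Rightarrow> ('b \<Rightarrow>\<^sub>0 'k) \<Rightarrow> 'v list \<Rightarrow> ('b \<Rightarrow>\<^sub>0 'k)" where
  "product_eval [] e vs = e"
| "product_eval (t # ts) e vs = product_eval ts e (tl vs) \<star> t (hd vs)"

fun chain_models :: "'s set \<Rightarrow> ('s \<Rightarrow> ('b \<Rightarrow>\<^sub>0 'k) \<Rightarrow> ('b \<Rightarrow>\<^sub>0 'k)) \<Rightarrow> 'b set list
    \<Rightarrow> ('k, 's, 'v) rep list \<Rightarrow> ('v \<Rightarrow> ('b \<Rightarrow>\<^sub>0 'k)) list \<Rightarrow> bool" where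
  "chain_models S \<beta> [X] [] [] \<longleftrightarrow> True"
| "chain_models S \<beta> (X # Z # C) (V # Vs) (t # ts) \<longleftrightarrow>
     models S V (arrows Z X) \<beta> t \<and> chain_models S \<beta> (Z # C) Vs ts"
| "chain_models S \<beta> _ _ _ \<longleftrightarrow> False"

lemma chain_models_nth:
  assumes "chain_models S \<beta> C Vs ts"
  shows "length ts = length Vs \<and> (\<forall>i<length Vs. \<exists>W. models S (Vs ! i) W \<beta> (ts ! i))"
  using assms
  by (induction S \<beta> C Vs ts rule: chain_models.induct) (auto simp: nth_Cons split: nat.splits)

lemma chain_models_nthE:
  assumes "chain_models S \<beta> C Vs ts" "i < length Vs"
  obtains W where "models S (Vs ! i) W \<beta> (ts ! i)"
  using chain_models_nth[OF assms(1)] assms(2) by blast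

lemma product_eval_add:
  assumes "length ts = length Vs" "i < length Vs" "length vs = length Vs"
    "(ts ! i) x = (ts ! i) u + (ts ! i) w"
  shows "product_eval ts e (vs[i := x]) = product_eval ts e (vs[i := u]) + product_eval ts e (vs[i := w])"
  using assms
proof (induction ts arbitrary: i vs Vs)
  case (Cons t ts)
  then obtain v vs' V Vs' where v: "vs = v # vs'" "Vs = V # Vs'" by (cases vs; cases Vs) auto
  show ?case
  proof (cases i)
    case 0
    then show ?thesis using Cons.prems v by (simp add: alg_mult_linear)
  next
    case (Suc j)
    then show ?thesis using Cons.prems v Cons.IH[of Vs' j vs'] by (simp add: alg_mult_linear)
  qed
qed simp

lemma product_eval_scale:
  assumes "length ts = length Vs" "i < length Vs" "length vs = length Vs"
    "(ts ! i) x = pscale c ((ts ! i) u)"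
  shows "product_eval ts e (vs[i := x]) = pscale c (product_eval ts e (vs[i := u]))"
  using assms
proof (induction ts arbitrary: i vs Vs)
  case (Cons t ts)
  then obtain v vs' V Vs' where v: "vs = v # vs'" "Vs = V # Vs'" by (cases vs; cases Vs) auto
  show ?case
  proof (cases i)
    case 0
    then show ?thesis using Cons.prems v by (simp add: alg_mult_linear)
  next
    case (Suc j)
    then show ?thesis using Cons.prems v Cons.IH[of Vs' j vs'] by (simp add: alg_mult_linear)
  qed
qed simp

lemma tensor_relations_subset:
  fixes Vs :: "('k, 's, 'v) rep list"
  assumes "chain_models S \<beta> C Vs ts"
  shows "free.span (tensor_relations Vs) \<subseteq> {p. keys p \<subseteq> listset (map rcarrier Vs)}"
proof (rule free.span_minimal[OF _ subspace_keys], rule subsetI)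
  let ?V = "{p :: 'v list \<Rightarrow>\<^sub>0 'k. keys p \<subseteq> listset (map rcarrier Vs)}"
  have sing: "basis vs \<in> ?V" if "vs \<in> listset (map rcarrier Vs)" for vs
    using that by simp
  have upd: "vs[i := x] \<in> listset (map rcarrier Vs)"
    if "vs \<in> listset (map rcarrier Vs)" "i < length Vs" "x \<in> rcarrier (Vs ! i)" for vs i x
    using that by (auto simp: mem_listset_iff nth_list_update)
  fix r :: "'v list \<Rightarrow>\<^sub>0 'k" assume "r \<in> tensor_relations Vs"
  then show "r \<in> ?V"
  proof (cases rule: tensor_relationsE)
    case (1 vs i u w)
    have "radd (Vs ! i) u w \<in> rcarrier (Vs ! i)"
      by (rule chain_models_nthE[OF assms 1(2)]) (erule models_add_closed; fact)
    then show ?thesis unfolding 1(5)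
      by (intro free.subspace_diff[OF subspace_keys] sing upd 1)
  next
    case (2 vs i u c)
    have "rscale (Vs ! i) c u \<in> rcarrier (Vs ! i)"
      by (rule chain_models_nthE[OF assms 2(2)]) (erule models_scale_closed; fact)
    then show ?thesis unfolding 2(4)
      by (intro free.subspace_diff[OF subspace_keys] free.subspace_scale[OF subspace_keys] sing upd 2)
  qed
qed

lemma product_eval_relations:
  fixes Vs :: "('k, 's, 'v) rep list"
  assumes "chain_models S \<beta> C Vs ts" "r \<in> free.span (tensor_relations Vs)"
  shows "lin_extend (product_eval ts e) r = 0"
proof -
  have "lin_extend (product_eval ts e) r \<in> {0}"
  proof (rule lin_span_subset[OF lin_lin_extend free.subspace_single_0 _ assms(2)])
    fix r :: "'v list \<Rightarrow>\<^sub>0 'k" assume "r \<in> tensor_relations Vs"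
    then show "lin_extend (product_eval ts e) r \<in> {0}"
    proof (cases rule: tensor_relationsE)
      case (1 vs i u w)
      have "(ts ! i) (radd (Vs ! i) u w) = (ts ! i) u + (ts ! i) w"
        by (rule chain_models_nthE[OF assms(1) 1(2)]) (erule models_add; fact)
      then have "product_eval ts e (vs[i := radd (Vs ! i) u w])
          = product_eval ts e (vs[i := u]) + product_eval ts e (vs[i := w])"
        using 1 chain_models_nth[OF assms(1)] by (intro product_eval_add[of _ Vs]) (auto simp: mem_listset_iff)
      then show ?thesis
        by (simp add: 1 lin_diff[OF lin_lin_extend] lin_extend_single)
    next
      case (2 vs i u c)
      have "(ts ! i) (rscale (Vs ! i) c u) = pscale c ((ts ! i) u)"
        by (rule chain_models_nthE[OF assms(1) 2(2)]) (erule models_scale; fact)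
      then have "product_eval ts e (vs[i := rscale (Vs ! i) c u]) = pscale c (product_eval ts e (vs[i := u]))"
        using 2 chain_models_nth[OF assms(1)] by (intro product_eval_scale[of _ Vs]) (auto simp: mem_listset_iff)
      then show ?thesis
        by (simp add: 2 lin_diff[OF lin_lin_extend] lin_scale[OF lin_lin_extend] lin_extend_single)
    qed
  qed
  then show ?thesis by simp
qed

lemma product_eval_Cons:
  "lin_extend (product_eval (t # ts) e) (pushforward ((#) v) q) = lin_extend (product_eval ts e) q \<star> t v"
  by (rule lin_eq_on_keys[OF lin_compose[OF lin_lin_extend lin_pushforward] lin_compose[OF lin_alg_mult_left lin_lin_extend]])
    (simp add: pushforward_single lin_extend_single alg_mult_linear)

lemma product_eval_image:
  fixes Vs :: "('k, 's, 'v) rep list"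
  assumes "chain_models S \<beta> C Vs ts"
  shows "lin_extend (product_eval ts (E (last C))) ` {p. keys p \<subseteq> listset (map rcarrier Vs)} = chain_space C"
  using assms
proof (induction S \<beta> C Vs ts rule: chain_models.induct)
  case (1 S \<beta> X)
  show ?case
  proof (intro equalityI subsetI)
    fix x assume "x \<in> chain_space [X]"
    then obtain c where "x = pscale c (E X)" by auto
    then have "x = lin_extend (product_eval [] (E X)) (Poly_Mapping.single [] c :: 'v list \<Rightarrow>\<^sub>0 'k)"
      by (simp add: lin_extend_single)
    moreover have "keys (Poly_Mapping.single [] c :: 'v list \<Rightarrow>\<^sub>0 'k) \<subseteq> {[]}" by simp
    ultimately show "x \<in> lin_extend (product_eval [] (E (last [X]))) `
        {p :: 'v list \<Rightarrow>\<^sub>0 'k. keys p \<subseteq> listset (map rcarrier [])}" by auto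
  next
    fix x assume "x \<in> lin_extend (product_eval [] (E (last [X]))) `
        {p :: 'v list \<Rightarrow>\<^sub>0 'k. keys p \<subseteq> listset (map rcarrier [])}"
    then obtain p :: "'v list \<Rightarrow>\<^sub>0 'k" where p: "keys p \<subseteq> {[]}"
      "x = lin_extend (product_eval [] (E X)) p" by auto
    then have "x = pscale (lookup p []) (E X)"
      using lin_extend_superset[of "{[]}" p "product_eval [] (E X)"] by simp
    then show "x \<in> chain_space [X]" by auto
  qed
next
  case (2 S \<beta> X Z C V Vs t ts)
  let ?V = "{p :: 'v list \<Rightarrow>\<^sub>0 'k. keys p \<subseteq> listset (map rcarrier (V # Vs))}"
  let ?V' = "{p :: 'v list \<Rightarrow>\<^sub>0 'k. keys p \<subseteq> listset (map rcarrier Vs)}"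
  let ?e = "E (last (Z # C))"
  let ?f = "lin_extend (product_eval (t # ts) ?e)"
  have t: "models S V (arrows Z X) \<beta> t" using 2 by simp
  have IH: "lin_extend (product_eval ts ?e) ` ?V' = chain_space (Z # C)" using 2 by simp
  show ?case
  proof
    have "?f ` ?V \<subseteq> chain_space (X # Z # C)"
    proof (rule image_subsetI, unfold mem_Collect_eq)
      fix p :: "'v list \<Rightarrow>\<^sub>0 'k" assume p: "keys p \<subseteq> listset (map rcarrier (V # Vs))"
      show "?f p \<in> chain_space (X # Z # C)"
      proof (rule lin_in_subspace[OF lin_lin_extend subspace_chain_space])
        fix vs assume "vs \<in> keys p"
        then have "vs \<in> listset (rcarrier V # map rcarrier Vs)" using p by auto
        then obtain v ws where vs: "vs = v # ws" "v \<in> rcarrier V" "ws \<in> listset (map rcarrier Vs)"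
          by (rule listset_ConsE)
        have "lin_extend (product_eval ts ?e) (basis ws) \<in> chain_space (Z # C)"
          unfolding IH[symmetric] using vs by (intro imageI) simp
        then have "product_eval ts ?e ws \<in> chain_space (Z # C)" by (simp add: lin_extend_single)
        then have "product_eval ts ?e ws \<star> t v \<in> chain_space (X # Z # C)"
          using models_in[OF t vs(2)] unfolding chain_space.simps by (intro free.span_base) blast
        then show "?f (basis vs) \<in> chain_space (X # Z # C)"
          by (simp add: lin_extend_single vs)
      qed
    qed
    then show "lin_extend (product_eval (t # ts) (E (last (X # Z # C)))) ` ?V \<subseteq> chain_space (X # Z # C)"
      by simp
    have "chain_space (X # Z # C) \<subseteq> ?f ` ?V"
      unfolding chain_space.simps
    proof (rule free.span_minimal[OF _ subspace_image[OF lin_lin_extend subspace_keys]], clarify)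
      fix a v assume a: "a \<in> chain_space (Z # C)" and "v \<in> arrows Z X"
      then obtain u where u: "u \<in> rcarrier V" "t u = v" using models_surj[OF t] by blast
      obtain q where q: "q \<in> ?V'" "a = lin_extend (product_eval ts ?e) q" using a IH by blast
      have "pushforward ((#) u) q \<in> ?V" using q(1) u(1) by (simp add: keys_pushforward_Cons del: listset.simps)
      moreover have "a \<star> v = ?f (pushforward ((#) u) q)" by (simp only: product_eval_Cons q u)
      ultimately show "a \<star> v \<in> ?f ` ?V" by blast
    qed
    then show "chain_space (X # Z # C) \<subseteq> lin_extend (product_eval (t # ts) (E (last (X # Z # C)))) ` ?V"
      by simp
  qed
qed simp_all

lemma tensor_reduction:
  fixes V :: "('k, 's, 'v) rep"
  assumes t: "models S V W \<beta> t" and B: "finite B" "B \<subseteq> W" "W \<subseteq> free.span B"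
    and p: "keys p \<subseteq> listset (map rcarrier (V # Vs))"
  obtains q where "\<And>b. keys (q b) \<subseteq> listset (map rcarrier Vs)"
    and "p - (\<Sum>b\<in>B. pushforward ((#) (inv_into (rcarrier V) t b)) (q b)) \<in> free.span (tensor_relations (V # Vs))"
proof -
  let ?s = "inv_into (rcarrier V) t"
  have "\<exists>r. t v = (\<Sum>b\<in>B. pscale (r b) b)" if "v \<in> rcarrier V" for v
  proof -
    have "t v \<in> free.span B" using models_in[OF t that] B by auto
    then show ?thesis unfolding free.span_finite[OF B(1)] by auto
  qed
  then obtain r where r: "\<And>v. v \<in> rcarrier V \<Longrightarrow> t v = (\<Sum>b\<in>B. pscale (r v b) b)" by metis
  define q where "q b = lin_extend (\<lambda>vs. pscale (r (hd vs) b) (basis (tl vs)))" for b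
  have linq: "lin (q b)" for b unfolding q_def by (rule lin_lin_extend)
  have head: thesis' if "vs \<in> listset (map rcarrier (V # Vs))"
    "\<And>v ws. vs = v # ws \<Longrightarrow> v \<in> rcarrier V \<Longrightarrow> ws \<in> listset (map rcarrier Vs) \<Longrightarrow> thesis'" for vs thesis'
    using that by (auto simp: set_Cons_def)
  show thesis
  proof
    fix b
    show "keys (q b p) \<subseteq> listset (map rcarrier Vs)"
    proof -
      have "q b p \<in> {p. keys p \<subseteq> listset (map rcarrier Vs)}"
      proof (rule lin_in_subspace[OF linq subspace_keys])
        fix vs assume "vs \<in> keys p"
        then have "vs \<in> listset (map rcarrier (V # Vs))" using p by blast
        then show "q b (basis vs) \<in> {p. keys p \<subseteq> listset (map rcarrier Vs)}"
          by (rule head) (auto simp: q_def lin_extend_single pscale_single split: if_splits)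
      qed
      then show ?thesis by simp
    qed
  next
    show "p - (\<Sum>b\<in>B. pushforward ((#) (?s b)) (q b p)) \<in> free.span (tensor_relations (V # Vs))"
    proof (rule lin_in_subspace[where p = p, OF _ free.subspace_span])
      show "lin (\<lambda>p. p - (\<Sum>b\<in>B. pushforward ((#) (?s b)) (q b p)))"
        by (intro lin_intros lin_compose[OF lin_pushforward] linq)
      fix vs assume "vs \<in> keys p"
      then have "vs \<in> listset (map rcarrier (V # Vs))" using p by blast
      then obtain v ws where vs: "vs = v # ws" "v \<in> rcarrier V" "ws \<in> listset (map rcarrier Vs)"
        by (rule head)
      show "basis vs - (\<Sum>b\<in>B. pushforward ((#) (?s b)) (q b (basis vs)))
          \<in> free.span (tensor_relations (V # Vs))"
        using tensor_head_expansion[OF t vs(3) B(1,2) vs(2) r[OF vs(2)]]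
        by (simp add: vs q_def lin_extend_single lin_scale[OF lin_pushforward] pushforward_single)
    qed
  qed
qed

lemma product_eval_kernel:
  fixes Vs :: "('k, 's, 'v) rep list"
  assumes "chain_models S \<beta> C Vs ts" "set C \<subseteq> supports"
    and "keys p \<subseteq> listset (map rcarrier Vs)"
    and "lin_extend (product_eval ts (E (last C))) p = 0"
  shows "p \<in> free.span (tensor_relations Vs)"
  using assms
proof (induction S \<beta> C Vs ts arbitrary: p rule: chain_models.induct)
  case (1 S \<beta> X)
  then have "p = pscale (lookup p []) (basis [])"
    using free_expansion[of "{[]}" p] by simp
  then have p: "p = Poly_Mapping.single [] (lookup p [])" by (simp add: pscale_single)
  have "pscale (lookup p []) (E X) = 0"
    using 1 lin_extend_superset[of "{[]}" p "\<lambda>_. E X"] by simp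
  then have "lookup p [] = 0" using E_nonzero[of X] 1 by simp
  then have "p = 0" using p by simp
  then show ?case by (simp add: free.span_zero)
next
  case (2 S \<beta> X Z C V Vs t ts)
  let ?e = "E (last (Z # C))" and ?s = "inv_into (rcarrier V) t"
  let ?B = "arrow_basis Z X"
  have t: "models S V (arrows Z X) \<beta> t" and cm: "chain_models S \<beta> (Z # C) Vs ts"
    using "2.prems"(1) by auto
  have XZ: "X \<in> supports" "Z \<in> supports" "set (Z # C) \<subseteq> supports" using "2.prems"(2) by auto
  obtain q where q: "\<And>b. keys (q b) \<subseteq> listset (map rcarrier Vs)"
    and pq: "p - (\<Sum>b\<in>?B. pushforward ((#) (?s b)) (q b)) \<in> free.span (tensor_relations (V # Vs))"
    by (rule tensor_reduction[OF t finite_arrow_basis arrow_basis_subset arrows_subset_span "2.prems"(3)])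
      (rule that, blast+)
  let ?f = "lin_extend (product_eval (t # ts) ?e)" and ?g = "lin_extend (product_eval ts ?e)"
  have s: "?s b \<in> rcarrier V" "t (?s b) = b" if "b \<in> ?B" for b
    using arrow_basis_arrow[OF that] models_bij[OF t]
    by (metis bij_betw_imp_surj_on inv_into_into, metis bij_betw_imp_surj_on f_inv_into_f)
  have "last (X # Z # C) = last (Z # C)" by simp
  with "2.prems"(4) have fp: "?f p = 0" by (simp only:)
  have "?f (p - (\<Sum>b\<in>?B. pushforward ((#) (?s b)) (q b))) = 0"
    by (rule product_eval_relations[OF "2.prems"(1) pq])
  then have "(\<Sum>b\<in>?B. ?f (pushforward ((#) (?s b)) (q b))) = 0"
    by (simp add: lin_diff[OF lin_lin_extend] lin_sum[OF lin_lin_extend] fp del: product_eval.simps last.simps)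
  then have sum0: "(\<Sum>b\<in>?B. ?g (q b) \<star> b) = 0"
    unfolding product_eval_Cons by (simp add: s del: product_eval.simps last.simps)
  have gE: "?g (q b) \<star> E Z = ?g (q b)" for b
    by (rule chain_space_right_unit[OF XZ(2)], subst product_eval_image[OF cm, symmetric])
      (use q in auto)
  define a where "a = (\<lambda>i. if fst i = Z then ?g (q (snd i)) else 0)"
  have "a \<in> arrow_coefficients X"
    by (auto simp: a_def arrow_coefficients_def gE alg_mult_linear simp del: last.simps)
  moreover have "arrow_combination X a = 0"
  proof -
    have "arrow_combination X a = (\<Sum>Z'\<in>supports. \<Sum>v\<in>arrow_basis Z' X. a (Z', v) \<star> v)"
      by (simp add: arrow_combination_def arrow_index_def sum.Sigma case_prod_beta)
    also have "\<dots> = (\<Sum>Z'\<in>supports. if Z' = Z then \<Sum>v\<in>?B. ?g (q v) \<star> v else 0)"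
    proof (rule sum.cong[OF refl])
      fix Z'
      show "(\<Sum>v\<in>arrow_basis Z' X. a (Z', v) \<star> v) = (if Z' = Z then \<Sum>v\<in>?B. ?g (q v) \<star> v else 0)"
        by (cases "Z' = Z") (simp_all add: a_def alg_mult_linear del: last.simps)
    qed
    also have "\<dots> = 0" by (simp add: sum0 del: last.simps)
    finally show ?thesis .
  qed
  ultimately have a0: "a i = 0" if "i \<in> arrow_index X" for i
    using arrows_free[OF XZ(1)] that by blast
  have "?g (q b) = 0" if "b \<in> ?B" for b
    using a0[of "(Z, b)"] that XZ by (simp add: a_def arrow_index_def del: last.simps)
  then have "q b \<in> free.span (tensor_relations Vs)" if "b \<in> ?B" for b
    using "2.IH"[OF cm XZ(3) q] that by blast
  then have "(\<Sum>b\<in>?B. pushforward ((#) (?s b)) (q b)) \<in> free.span (tensor_relations (V # Vs))"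
    by (intro free.span_sum pushforward_Cons_tensor_relations s)
  from free.span_add[OF pq this] show ?case by simp
qed simp_all

lemma product_eval_act:
  fixes Vs :: "('k, 's, 'v) rep list"
  assumes "chain_models S \<beta> C Vs ts" "s \<in> S" "vs \<in> listset (map rcarrier Vs)"
    and "\<beta> s e = e" "\<And>a b. \<beta> s (a \<star> b) = \<beta> s a \<star> \<beta> s b"
  shows "map2 (\<lambda>V v. ract V s v) Vs vs \<in> listset (map rcarrier Vs)
    \<and> product_eval ts e (map2 (\<lambda>V v. ract V s v) Vs vs) = \<beta> s (product_eval ts e vs)"
  using assms
proof (induction S \<beta> C Vs ts arbitrary: vs rule: chain_models.induct)
  case (2 S \<beta> X Z C V Vs t ts)
  have t: "models S V (arrows Z X) \<beta> t" using "2.prems"(1) by simp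
  from "2.prems"(3) obtain v ws where vs: "vs = v # ws" "v \<in> rcarrier V" "ws \<in> listset (map rcarrier Vs)"
    by (auto simp: set_Cons_def)
  show ?case
    using "2.IH"[OF _ "2.prems"(2) vs(3) "2.prems"(4,5)] "2.prems"(1,2,5) vs
      models_act_closed[OF t "2.prems"(2) vs(2)] models_act[OF t "2.prems"(2) vs(2)]
    by auto
qed simp_all

theorem models_tensor_rep:
  fixes Vs :: "('k, 's, 'v) rep list"
  assumes cm: "chain_models S \<beta> C Vs ts" and C: "set C \<subseteq> supports"
    and e: "\<And>s. s \<in> S \<Longrightarrow> \<beta> s (E (last C)) = E (last C)"
    and hom: "\<And>s a b. s \<in> S \<Longrightarrow> \<beta> s (a \<star> b) = \<beta> s a \<star> \<beta> s b"
    and lin: "\<And>s. s \<in> S \<Longrightarrow> lin (\<beta> s)"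
  shows "models S (tensor_rep Vs) (chain_space C) \<beta>
    (coset_map (lin_extend (product_eval ts (E (last C)))))"
proof -
  let ?f = "lin_extend (product_eval ts (E (last C)))"
  let ?V = "{p. keys p \<subseteq> listset (map rcarrier Vs)}"
  show ?thesis
    unfolding tensor_rep_def product_eval_image[OF cm, symmetric]
  proof (rule models_quotient_rep[OF subspace_keys free.subspace_span tensor_relations_subset[OF cm] lin_lin_extend])
    fix p :: "'v list \<Rightarrow>\<^sub>0 'k" assume "p \<in> ?V"
    then show "?f p = 0 \<longleftrightarrow> p \<in> free.span (tensor_relations Vs)"
      using product_eval_kernel[OF cm C] product_eval_relations[OF cm] by blast
  next
    fix s and p :: "'v list \<Rightarrow>\<^sub>0 'k" assume s: "s \<in> S" and p: "p \<in> ?V"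
    let ?m = "map2 (\<lambda>V v. ract V s v) Vs"
    note act = product_eval_act[OF cm s _ e[OF s] hom[OF s]]
    have "keys (pushforward ?m p) \<subseteq> ?m ` keys p"
      by (rule keys_pushforward)
    also have "\<dots> \<subseteq> listset (map rcarrier Vs)" using act p by blast
    finally have "pushforward ?m p \<in> ?V" by simp
    moreover have "?f (pushforward ?m p) = \<beta> s (?f p)"
      by (rule lin_eq_on_keys[OF lin_compose[OF lin_lin_extend lin_pushforward] lin_compose[OF lin[OF s] lin_lin_extend]])
        (use act p in \<open>auto simp: pushforward_single lin_extend_single\<close>)
    ultimately show "pushforward ?m p \<in> ?V \<and> ?f (pushforward ?m p) = \<beta> s (?f p)" by simp
  qed
qed

end

section \<open>The path decomposition of the algebra\<close>

definition strict_chains :: "'b::left_regular_band set list set" where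
  "strict_chains = {C. C \<noteq> [] \<and> set C \<subseteq> supports \<and> sorted_wrt (\<subset>) C}"

definition chains_from :: "'b::left_regular_band set \<Rightarrow> 'b set list set" where
  "chains_from X = {C \<in> strict_chains. hd C = X}"

lemma strict_chainsD:
  assumes "C \<in> strict_chains"
  shows "C \<noteq> []" "set C \<subseteq> supports" "sorted_wrt (\<subset>) C" "hd C \<in> supports" "last C \<in> supports"
  using assms by (auto simp: strict_chains_def)

lemma finite_strict_chains [simp]: "finite (strict_chains :: 'b::left_regular_band set list set)"
proof (rule finite_subset)
  have "distinct C" if "sorted_wrt (\<subset>) C" for C :: "'b set list"
    using that by (induction C) auto
  then show "strict_chains \<subseteq> {C :: 'b set list. set C \<subseteq> supports \<and> distinct C}" by (auto simp: strict_chains_def)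
  show "finite {C :: 'b set list. set C \<subseteq> supports \<and> distinct C}"
    using finite_subset_distinct[OF finite_supports] by (simp add: conj_commute)
qed

lemma finite_chains_from [simp]: "finite (chains_from X)"
  by (simp add: chains_from_def)

lemma Cons_chains_from_iff:
  assumes "D \<in> chains_from Z"
  shows "X # D \<in> chains_from X \<longleftrightarrow> X \<in> supports \<and> X \<subset> Z"
proof -
  obtain D' where D: "D = Z # D'" using assms by (cases D) (auto simp: chains_from_def strict_chains_def)
  then show ?thesis using assms by (auto simp: chains_from_def strict_chains_def)
qed

lemma singleton_chains_from: "X \<in> supports \<Longrightarrow> [X] \<in> chains_from X"
  by (simp add: chains_from_def strict_chains_def)

lemma chains_from_Cons:
  assumes "C \<in> chains_from X" "C \<noteq> [X]"
  obtains Z D where "C = X # D" "D \<in> chains_from Z" "Z \<in> supports" "X \<subset> Z"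
proof -
  obtain Z D where "C = X # Z # D"
    using assms by (cases C rule: remdups_adj.cases) (auto simp: chains_from_def strict_chains_def)
  then show ?thesis using assms that[of "Z # D" Z] by (auto simp: chains_from_def strict_chains_def)
qed

lemma chains_from_eq:
  assumes "X \<in> supports"
  shows "chains_from X = insert [X] (\<Union>Z\<in>{Z\<in>supports. X \<subset> Z}. (#) X ` chains_from Z)"
proof (intro equalityI subsetI)
  fix C assume C: "C \<in> chains_from X"
  show "C \<in> insert [X] (\<Union>Z\<in>{Z\<in>supports. X \<subset> Z}. (#) X ` chains_from Z)"
  proof (cases "C = [X]")
    case False
    then obtain Z D where "C = X # D" "D \<in> chains_from Z" "Z \<in> supports" "X \<subset> Z"
      by (rule chains_from_Cons[OF C])
    then show ?thesis by auto
  qed simp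
next
  fix C assume "C \<in> insert [X] (\<Union>Z\<in>{Z\<in>supports. X \<subset> Z}. (#) X ` chains_from Z)"
  then show "C \<in> chains_from X"
    using singleton_chains_from Cons_chains_from_iff assms by auto
qed

lemma sum_chains_from:
  fixes u :: "'b::left_regular_band set list \<Rightarrow> 'c::comm_monoid_add"
  assumes "X \<in> supports"
  shows "(\<Sum>C\<in>chains_from X. u C) = u [X] + (\<Sum>Z\<in>{Z\<in>supports. X \<subset> Z}. \<Sum>D\<in>chains_from Z. u (X # D))"
proof -
  let ?S = "{Z\<in>supports. X \<subset> Z}"
  have fin: "finite ?S" by simp
  have "[X] \<notin> (\<Union>Z\<in>?S. (#) X ` chains_from Z)" by (auto simp: chains_from_def strict_chains_def)
  then have "(\<Sum>C\<in>chains_from X. u C) = u [X] + (\<Sum>C\<in>(\<Union>Z\<in>?S. (#) X ` chains_from Z). u C)"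
    unfolding chains_from_eq[OF assms] using fin by (subst sum.insert) auto
  also have "(\<Sum>C\<in>(\<Union>Z\<in>?S. (#) X ` chains_from Z). u C) = (\<Sum>Z\<in>?S. \<Sum>C\<in>(#) X ` chains_from Z. u C)"
    by (rule sum.UNION_disjoint[OF fin]) (auto simp: chains_from_def)
  also have "\<dots> = (\<Sum>Z\<in>?S. \<Sum>D\<in>chains_from Z. u (X # D))"
    by (rule sum.cong[OF refl]) (simp add: sum.reindex)
  finally show ?thesis .
qed

context hereditary_idempotents
begin

lemma chain_space_expansion:
  assumes "u \<in> chain_space (X # Z # C)"
  shows "\<exists>a. (\<forall>v. a v \<in> chain_space (Z # C)) \<and> u = (\<Sum>v\<in>arrow_basis Z X. a v \<star> v)"
proof -
  let ?T = "{u. \<exists>a. (\<forall>v. a v \<in> chain_space (Z # C)) \<and> u = (\<Sum>v\<in>arrow_basis Z X. a v \<star> v)}"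
  note sub = subspace_chain_space[of "Z # C"]
  have "free.subspace ?T"
  proof (rule free.subspaceI)
    show "0 \<in> ?T"
      using free.subspace_0[OF sub] by (intro CollectI exI[of _ "\<lambda>_. 0"]) (simp add: alg_mult_linear)
  next
    fix x y assume "x \<in> ?T" "y \<in> ?T"
    then obtain a b where "\<forall>v. a v \<in> chain_space (Z # C)" "x = (\<Sum>v\<in>arrow_basis Z X. a v \<star> v)"
      "\<forall>v. b v \<in> chain_space (Z # C)" "y = (\<Sum>v\<in>arrow_basis Z X. b v \<star> v)" by blast
    then show "x + y \<in> ?T"
      using free.subspace_add[OF sub]
      by (intro CollectI exI[of _ "\<lambda>v. a v + b v"]) (simp add: alg_mult_linear sum.distrib)
  next
    fix c x assume "x \<in> ?T"
    then obtain a where "\<forall>v. a v \<in> chain_space (Z # C)" "x = (\<Sum>v\<in>arrow_basis Z X. a v \<star> v)" by blast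
    then show "pscale c x \<in> ?T"
      using free.subspace_scale[OF sub]
      by (intro CollectI exI[of _ "\<lambda>v. pscale c (a v)"]) (simp add: alg_mult_linear free.scale_sum_right)
  qed
  moreover have "a \<star> w \<in> ?T" if a: "a \<in> chain_space (Z # C)" and w: "w \<in> arrows Z X" for a w
  proof -
    have "w \<in> free.span (arrow_basis Z X)" using w arrows_subset_span by blast
    then obtain r where "w = (\<Sum>v\<in>arrow_basis Z X. pscale (r v) v)"
      unfolding free.span_finite[OF finite_arrow_basis] by auto
    then show ?thesis
      using a free.subspace_scale[OF sub]
      by (intro CollectI exI[of _ "\<lambda>v. pscale (r v) a"]) (simp add: alg_mult_linear alg_mult_sum_right)
  qed
  ultimately have "chain_space (X # Z # C) \<subseteq> ?T"
    unfolding chain_space.simps by (intro free.span_minimal) auto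
  then show ?thesis using assms by blast
qed

lemma arrow_basis_strict:
  assumes "X \<in> supports" "Z \<in> supports" "v \<in> arrow_basis Z X"
  shows "X \<subset> Z"
proof (rule arrows_strict[OF assms(1,2) arrow_basis_arrow[OF assms(3)]])
  show "v \<noteq> 0" using free.dependent_zero[of "arrow_basis Z X"] independent_arrow_basis assms(3) by blast
qed

lemma sum_arrow_index:
  assumes "X \<in> supports"
  shows "(\<Sum>i\<in>arrow_index X. f i) = (\<Sum>Z\<in>{Z\<in>supports. X \<subset> Z}. \<Sum>v\<in>arrow_basis Z X. f (Z, v))"
proof -
  have "(\<Sum>i\<in>arrow_index X. f i) = (\<Sum>Z\<in>supports. \<Sum>v\<in>arrow_basis Z X. f (Z, v))"
    by (simp add: arrow_index_def sum.Sigma case_prod_beta)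
  also have "\<dots> = (\<Sum>Z\<in>{Z\<in>supports. X \<subset> Z}. \<Sum>v\<in>arrow_basis Z X. f (Z, v))"
  proof (rule sum.mono_neutral_right)
    show "\<forall>Z\<in>supports - {Z \<in> supports. X \<subset> Z}. (\<Sum>v\<in>arrow_basis Z X. f (Z, v)) = 0"
    proof
      fix Z assume "Z \<in> supports - {Z \<in> supports. X \<subset> Z}"
      then have "arrow_basis Z X = {}" using arrow_basis_strict[OF assms, of Z] by auto
      then show "(\<Sum>v\<in>arrow_basis Z X. f (Z, v)) = 0" by simp
    qed
  qed auto
  finally show ?thesis .
qed

lemma chain_space_mult_E:
  assumes "X \<in> supports" "C \<in> strict_chains" "u \<in> chain_space C"
  shows "u \<star> E X = (if hd C = X then u else 0)"
proof -
  have "C = hd C # tl C" "hd C \<in> supports" using strict_chainsD[OF assms(2)] by auto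
  then have u: "u \<star> E (hd C) = u" using chain_space_right_unit[of "hd C" u "tl C"] assms(3) by simp
  show ?thesis
  proof (cases "hd C = X")
    case False
    have "u \<star> E X = u \<star> (E (hd C) \<star> E X)" by (simp add: u flip: alg_mult_assoc)
    then show ?thesis using E_orth[of "hd C" X] False \<open>hd C \<in> supports\<close> assms(1) by (simp add: alg_mult_linear)
  qed (use u in simp)
qed

lemma E_mult_chain_space:
  assumes "Y \<in> supports" "C \<in> strict_chains" "u \<in> chain_space C"
  shows "E Y \<star> u = (if last C = Y then u else 0)"
proof -
  have C: "C \<noteq> []" "set C \<subseteq> supports" "last C \<in> supports" using strict_chainsD[OF assms(2)] by auto
  have u: "E (last C) \<star> u = u" by (rule chain_space_left_unit[OF C(1,2) assms(3)])
  show ?thesis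
  proof (cases "last C = Y")
    case False
    have "E Y \<star> u = E Y \<star> E (last C) \<star> u" by (simp add: u alg_mult_assoc)
    then show ?thesis using E_orth[of Y "last C"] False C(3) assms(1) by (simp add: alg_mult_linear)
  qed (use u in simp)
qed

lemma chains_from_independent:
  assumes "X \<in> supports" "\<And>C. C \<in> chains_from X \<Longrightarrow> u C \<in> chain_space C"
    and "(\<Sum>C\<in>chains_from X. u C) = 0" "C \<in> chains_from X"
  shows "u C = 0"
  using assms
proof (induction "card (UNIV :: 'b set) - card X" arbitrary: X u C rule: less_induct)
  case less
  note X = less.prems(1) and u = less.prems(2)
  let ?S = "{Z\<in>supports. X \<subset> Z}"
  have ex: "\<exists>a. (\<forall>v. a v \<in> chain_space D) \<and> u (X # D) = (\<Sum>v\<in>arrow_basis Z X. a v \<star> v)"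
    if Z: "Z \<in> ?S" and D: "D \<in> chains_from Z" for Z D
  proof -
    obtain D' where D': "D = Z # D'" using D by (cases D) (auto simp: chains_from_def strict_chains_def)
    have "X # D \<in> chains_from X" using Cons_chains_from_iff[OF D] X Z by blast
    from u[OF this] show ?thesis unfolding D' by (rule chain_space_expansion)
  qed
  define a where "a Z D = (SOME a. (\<forall>v. a v \<in> chain_space D)
    \<and> u (X # D) = (\<Sum>v\<in>arrow_basis Z X. a v \<star> v))" for Z D
  have aD: "(\<forall>v. a Z D v \<in> chain_space D) \<and> u (X # D) = (\<Sum>v\<in>arrow_basis Z X. a Z D v \<star> v)"
    if "Z \<in> ?S" "D \<in> chains_from Z" for Z D
    unfolding a_def by (rule someI_ex[OF ex[OF that]])
  have a: "a Z D v \<in> chain_space D" if "Z \<in> ?S" "D \<in> chains_from Z" for Z D v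
    using aD[OF that] by blast
  have ua: "u (X # D) = (\<Sum>v\<in>arrow_basis Z X. a Z D v \<star> v)" if "Z \<in> ?S" "D \<in> chains_from Z" for Z D
    using aD[OF that] by blast
  define c where "c = (\<lambda>i. \<Sum>D\<in>chains_from (fst i). a (fst i) D (snd i))"
  have "u [X] \<in> chain_space [X]" using u singleton_chains_from X by blast
  then obtain r where r: "u [X] = pscale r (E X)" by auto
  have comb: "arrow_combination X c = (\<Sum>Z\<in>?S. \<Sum>D\<in>chains_from Z. u (X # D))"
  proof -
    have "arrow_combination X c = (\<Sum>Z\<in>?S. \<Sum>v\<in>arrow_basis Z X. \<Sum>D\<in>chains_from Z. a Z D v \<star> v)"
      by (simp add: arrow_combination_def sum_arrow_index[OF X] c_def alg_mult_sum_left)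
    also have "\<dots> = (\<Sum>Z\<in>?S. \<Sum>D\<in>chains_from Z. \<Sum>v\<in>arrow_basis Z X. a Z D v \<star> v)"
      by (intro sum.cong refl sum.swap)
    also have "\<dots> = (\<Sum>Z\<in>?S. \<Sum>D\<in>chains_from Z. u (X # D))"
      by (intro sum.cong refl) (simp add: ua)
    finally show ?thesis .
  qed
  have sum0: "pscale r (E X) + arrow_combination X c = 0"
    using less.prems(3) by (simp add: sum_chains_from[OF X] r comb)
  have "chi X (arrow_combination X c) = 0"
  proof -
    have "arrow_combination X c \<in> rad"
      unfolding arrow_combination_def
      by (intro free.subspace_sum[OF subspace_rad] rad_mult_left arrowsD(1)[OF arrow_indexD(3)])
    then show ?thesis using X by (rule radD)
  qed
  then have "chi X (pscale r (E X) + arrow_combination X c) = r"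
    using X by (simp add: chi_add chi_pscale chi_E)
  then have r0: "r = 0" by (simp add: sum0)
  have aE: "a Z D v \<star> E Z = a Z D v" if "Z \<in> ?S" "D \<in> chains_from Z" for Z D v
    using chain_space_mult_E[of Z D "a Z D v"] a[OF that] that by (auto simp: chains_from_def)
  have idx: "fst i \<in> ?S" if "i \<in> arrow_index X" for i
    using arrow_indexD[OF that] arrow_basis_strict[OF X] by blast
  have coeff: "c \<in> arrow_coefficients X"
    using idx aE by (auto simp: arrow_coefficients_def c_def alg_mult_sum_left intro!: sum.cong)
  have c0: "c i = 0" if "i \<in> arrow_index X" for i
    by (rule arrows_free[OF X coeff _ that]) (use sum0 r0 in simp)
  have uXD: "u (X # D) = 0" if Z: "Z \<in> ?S" and D: "D \<in> chains_from Z" for Z D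
  proof -
    have "card X < card Z" "card Z \<le> card (UNIV :: 'b set)"
      using Z by (auto intro!: psubset_card_mono card_mono)
    then have lt: "card (UNIV :: 'b set) - card Z < card (UNIV :: 'b set) - card X" by simp
    have "a Z D v = 0" if v: "v \<in> arrow_basis Z X" for v
    proof (rule less.hyps[of Z "\<lambda>D. a Z D v" D, OF lt _ _ _ D])
      have "(Z, v) \<in> arrow_index X" using Z v by (simp add: arrow_index_def)
      from c0[OF this] show "(\<Sum>D\<in>chains_from Z. a Z D v) = 0" by (simp add: c_def)
    qed (use Z a in auto)
    then show ?thesis by (simp add: ua[OF Z D] alg_mult_linear)
  qed
  show ?case
  proof (cases "C = [X]")
    case True
    then show ?thesis by (simp add: r r0)
  next
    case False
    then obtain Z D where "C = X # D" "D \<in> chains_from Z" "Z \<in> supports" "X \<subset> Z"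
      by (rule chains_from_Cons[OF less.prems(4)])
    then show ?thesis using uXD[of Z D] by simp
  qed
qed

lemma chains_from_span:
  assumes "X \<in> supports" "x \<star> E X = x"
  shows "\<exists>u. (\<forall>C\<in>chains_from X. u C \<in> chain_space C) \<and> x = (\<Sum>C\<in>chains_from X. u C)"
  using assms
proof (induction "card (UNIV :: 'b set) - card X" arbitrary: X x rule: less_induct)
  case less
  note X = less.prems(1)
  let ?S = "{Z\<in>supports. X \<subset> Z}"
  define y where "y = x - pscale (chi X x) (E X)"
  have yE: "y \<star> E X = y" using less.prems by (simp add: y_def alg_mult_linear E_idem)
  have "chi X y = 0" using X by (simp add: y_def chi_diff chi_pscale chi_E)
  then have "y \<in> rad" using mult_E_in_rad[OF X, of y] by (simp add: yE)
  then obtain c where c: "c \<in> arrow_coefficients X" "y = arrow_combination X c"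
    by (rule arrows_generate[OF X _ yE])
  have ex: "\<exists>w. (\<forall>C\<in>chains_from Z. w C \<in> chain_space C) \<and> c (Z, v) = (\<Sum>C\<in>chains_from Z. w C)"
    if Z: "Z \<in> ?S" and v: "v \<in> arrow_basis Z X" for Z v
  proof (rule less.hyps)
    have "card X < card Z" "card Z \<le> card (UNIV :: 'b set)"
      using Z by (auto intro!: psubset_card_mono card_mono)
    then show "card (UNIV :: 'b set) - card Z < card (UNIV :: 'b set) - card X" by simp
    show "Z \<in> supports" using Z by simp
    have "(Z, v) \<in> arrow_index X" using Z v by (simp add: arrow_index_def)
    then show "c (Z, v) \<star> E Z = c (Z, v)" using c(1) by (force simp: arrow_coefficients_def)
  qed
  define w where "w Z v = (SOME w. (\<forall>C\<in>chains_from Z. w C \<in> chain_space C)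
    \<and> c (Z, v) = (\<Sum>C\<in>chains_from Z. w C))" for Z v
  have wv: "(\<forall>C\<in>chains_from Z. w Z v C \<in> chain_space C) \<and> c (Z, v) = (\<Sum>C\<in>chains_from Z. w Z v C)"
    if "Z \<in> ?S" "v \<in> arrow_basis Z X" for Z v
    unfolding w_def by (rule someI_ex[OF ex[OF that]])
  have w: "w Z v C \<in> chain_space C" if "Z \<in> ?S" "v \<in> arrow_basis Z X" "C \<in> chains_from Z" for Z v C
    using wv[OF that(1,2)] that(3) by blast
  have cw: "c (Z, v) = (\<Sum>C\<in>chains_from Z. w Z v C)" if "Z \<in> ?S" "v \<in> arrow_basis Z X" for Z v
    using wv[OF that] by blast
  define u where "u C = (if C = [X] then pscale (chi X x) (E X)
      else \<Sum>v\<in>arrow_basis (hd (tl C)) X. w (hd (tl C)) v (tl C) \<star> v)" for C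
  have "u C \<in> chain_space C" if C: "C \<in> chains_from X" for C
  proof (cases "C = [X]")
    case False
    then obtain Z D where D: "C = X # D" "D \<in> chains_from Z" "Z \<in> ?S"
      using chains_from_Cons[OF C False] by blast
    obtain D' where D': "D = Z # D'" using D(2) by (cases D) (auto simp: chains_from_def strict_chains_def)
    have "w Z v D \<star> v \<in> chain_space C" if "v \<in> arrow_basis Z X" for v
      using w[OF D(3) that D(2)] arrow_basis_arrow[OF that]
      unfolding D(1) D' chain_space.simps by (intro free.span_base) blast
    then have "(\<Sum>v\<in>arrow_basis Z X. w Z v D \<star> v) \<in> chain_space C"
      by (rule free.subspace_sum[OF subspace_chain_space])
    then show ?thesis using False by (simp add: u_def D(1) D' del: chain_space.simps)
  qed (auto simp: u_def)
  moreover have "x = (\<Sum>C\<in>chains_from X. u C)"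
  proof -
    have "y = (\<Sum>Z\<in>?S. \<Sum>v\<in>arrow_basis Z X. \<Sum>D\<in>chains_from Z. w Z v D \<star> v)"
      by (simp add: c(2) arrow_combination_def sum_arrow_index[OF X] cw alg_mult_sum_left)
    also have "\<dots> = (\<Sum>Z\<in>?S. \<Sum>D\<in>chains_from Z. \<Sum>v\<in>arrow_basis Z X. w Z v D \<star> v)"
      by (intro sum.cong refl sum.swap)
    also have "\<dots> = (\<Sum>Z\<in>?S. \<Sum>D\<in>chains_from Z. u (X # D))"
      by (intro sum.cong refl) (auto simp: u_def chains_from_def strict_chains_def)
    finally have "pscale (chi X x) (E X) + y = (\<Sum>C\<in>chains_from X. u C)"
      by (simp add: sum_chains_from[OF X] u_def)
    then show ?thesis by (simp add: y_def)
  qed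
  ultimately show ?case by blast
qed

theorem chain_spaces_independent:
  assumes u: "\<And>C. C \<in> strict_chains \<Longrightarrow> u C \<in> chain_space C"
    and sum: "(\<Sum>C\<in>strict_chains. u C) = 0" and C: "C \<in> strict_chains"
  shows "u C = 0"
proof (rule chains_from_independent)
  show X: "hd C \<in> supports" by (rule strict_chainsD(4)[OF C])
  show "C \<in> chains_from (hd C)" using C by (simp add: chains_from_def)
  show "u D \<in> chain_space D" if "D \<in> chains_from (hd C)" for D
    using u that by (simp add: chains_from_def)
  have "0 = (\<Sum>D\<in>strict_chains. u D \<star> E (hd C))"
    using sum by (simp add: alg_mult_linear flip: alg_mult_sum_left)
  also have "\<dots> = (\<Sum>D\<in>strict_chains. if hd D = hd C then u D else 0)"
    using u X by (intro sum.cong) (auto simp: chain_space_mult_E)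
  also have "\<dots> = (\<Sum>D\<in>chains_from (hd C). u D)"
    by (simp add: chains_from_def flip: sum.inter_filter)
  finally show "(\<Sum>D\<in>chains_from (hd C). u D) = 0" ..
qed

theorem chain_spaces_span:
  "\<exists>u. (\<forall>C\<in>strict_chains. u C \<in> chain_space C) \<and> x = (\<Sum>C\<in>strict_chains. u C)"
proof -
  have "\<exists>u. (\<forall>C\<in>chains_from X. u C \<in> chain_space C) \<and> x \<star> E X = (\<Sum>C\<in>chains_from X. u C)"
    if "X \<in> supports" for X
    by (rule chains_from_span) (use that in \<open>simp_all add: mult_E_E\<close>)
  then obtain u where u: "\<And>X C. X \<in> supports \<Longrightarrow> C \<in> chains_from X \<Longrightarrow> u X C \<in> chain_space C"
    and xu: "\<And>X. X \<in> supports \<Longrightarrow> x \<star> E X = (\<Sum>C\<in>chains_from X. u X C)" by metis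
  have un: "strict_chains = (\<Union>X\<in>supports. chains_from X)"
    by (auto simp: chains_from_def strict_chainsD(4))
  show ?thesis
  proof (rule exI[of _ "\<lambda>C. u (hd C) C"], intro conjI ballI)
    show "u (hd C) C \<in> chain_space C" if "C \<in> strict_chains" for C
      using u[of "hd C" C] that by (simp add: chains_from_def strict_chainsD(4))
    have "x = (\<Sum>X\<in>supports. x \<star> E X)"
      using E_unit_right[of x] by (simp flip: alg_mult_sum_right)
    also have "\<dots> = (\<Sum>X\<in>supports. \<Sum>C\<in>chains_from X. u (hd C) C)"
      by (intro sum.cong refl) (auto simp: xu chains_from_def intro!: sum.cong)
    also have "\<dots> = (\<Sum>C\<in>strict_chains. u (hd C) C)"
      unfolding un by (rule sum.UNION_disjoint[symmetric]) (auto simp: chains_from_def)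
    finally show "x = (\<Sum>C\<in>strict_chains. u (hd C) C)" .
  qed
qed

end

section \<open>Equivariance\<close>

locale band_action = group G
  for G :: "('g, 'm) monoid_scheme" +
  fixes \<alpha> :: "'g \<Rightarrow> 'b::left_regular_band \<Rightarrow> 'b"
  assumes acts: "acts_by_automorphisms G \<alpha>"
begin

abbreviation act :: "'g \<Rightarrow> ('b \<Rightarrow>\<^sub>0 'k::field) \<Rightarrow> ('b \<Rightarrow>\<^sub>0 'k)" where
  "act g \<equiv> pushforward (\<alpha> g)"

lemma action: "group_action G UNIV \<alpha>"
  using acts by (simp add: acts_by_automorphisms_def)

lemma alpha_mult: "g \<in> carrier G \<Longrightarrow> \<alpha> g (x * y) = \<alpha> g x * \<alpha> g y"
  using acts by (simp add: acts_by_automorphisms_def)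

lemma alpha_comp: "g \<in> carrier G \<Longrightarrow> h \<in> carrier G \<Longrightarrow> \<alpha> g (\<alpha> h x) = \<alpha> (g \<otimes>\<^bsub>G\<^esub> h) x"
  using group_action.composition_rule[OF action] by simp

lemma alpha_one: "\<alpha> \<one>\<^bsub>G\<^esub> x = x"
  using group_action.id_eq_one[OF action] by (metis UNIV_I restrict_apply)

lemma alpha_inv_left: "g \<in> carrier G \<Longrightarrow> \<alpha> (inv\<^bsub>G\<^esub> g) (\<alpha> g x) = x"
  by (simp add: alpha_comp alpha_one)

lemma alpha_inv_right: "g \<in> carrier G \<Longrightarrow> \<alpha> g (\<alpha> (inv\<^bsub>G\<^esub> g) x) = x"
  by (simp add: alpha_comp alpha_one)

lemma inj_alpha: "g \<in> carrier G \<Longrightarrow> inj (\<alpha> g)"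
  by (rule inj_on_inverseI[of _ "\<alpha> (inv\<^bsub>G\<^esub> g)"]) (simp add: alpha_inv_left)

lemma supp_act_supp:
  assumes "g \<in> carrier G"
  shows "supp_act \<alpha> g (supp b) = supp (\<alpha> g b)"
proof (intro equalityI subsetI)
  fix c assume "c \<in> supp_act \<alpha> g (supp b)"
  then show "c \<in> supp (\<alpha> g b)"
    using assms by (auto simp: supp_act_def mem_supp_iff simp flip: alpha_mult)
next
  fix c assume c: "c \<in> supp (\<alpha> g b)"
  have "\<alpha> (inv\<^bsub>G\<^esub> g) c * b = \<alpha> (inv\<^bsub>G\<^esub> g) (c * \<alpha> g b)"
    using assms by (simp add: alpha_mult alpha_inv_left)
  then have "\<alpha> (inv\<^bsub>G\<^esub> g) c \<in> supp b" using c by (simp add: mem_supp_iff)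
  then have "\<alpha> g (\<alpha> (inv\<^bsub>G\<^esub> g) c) \<in> supp_act \<alpha> g (supp b)" unfolding supp_act_def by (rule imageI)
  then show "c \<in> supp_act \<alpha> g (supp b)" using assms by (simp add: alpha_inv_right)
qed

lemma supp_act_supports [simp]: "g \<in> carrier G \<Longrightarrow> X \<in> supports \<Longrightarrow> supp_act \<alpha> g X \<in> supports"
  by (auto elim!: supportsE simp: supp_act_supp)

lemma supp_act_comp:
  "g \<in> carrier G \<Longrightarrow> h \<in> carrier G \<Longrightarrow> supp_act \<alpha> g (supp_act \<alpha> h X) = supp_act \<alpha> (g \<otimes>\<^bsub>G\<^esub> h) X"
  by (simp add: supp_act_def image_image alpha_comp)

lemma supp_act_one: "supp_act \<alpha> \<one>\<^bsub>G\<^esub> X = X"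
  by (simp add: supp_act_def alpha_one)

lemma supp_act_subset_iff:
  "g \<in> carrier G \<Longrightarrow> supp_act \<alpha> g X \<subseteq> supp_act \<alpha> g Y \<longleftrightarrow> X \<subseteq> Y"
  unfolding supp_act_def by (rule inj_image_subset_iff[OF inj_alpha])

lemma supp_act_psubset_iff:
  "g \<in> carrier G \<Longrightarrow> supp_act \<alpha> g X \<subset> supp_act \<alpha> g Y \<longleftrightarrow> X \<subset> Y"
  by (simp add: less_le_not_le supp_act_subset_iff)

lemma act_comp:
  "g \<in> carrier G \<Longrightarrow> h \<in> carrier G \<Longrightarrow> act g (act h p) = act (g \<otimes>\<^bsub>G\<^esub> h) p"
  by (simp add: pushforward_pushforward alpha_comp)

lemma act_one: "act \<one>\<^bsub>G\<^esub> p = p"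
  by (simp add: alpha_one[abs_def] pushforward_ident)

lemma act_mult: "g \<in> carrier G \<Longrightarrow> act g (p \<star> q) = act g p \<star> act g q"
  by (rule pushforward_alg_mult) (rule alpha_mult)

lemma chi_act:
  assumes "g \<in> carrier G"
  shows "chi (supp_act \<alpha> g X) (act g p) = chi X p"
  unfolding pushforward_def chi_sum chi_single chi_keys[of X p]
  using assms by (simp add: supp_act_subset_iff flip: supp_act_supp)

lemma act_rad:
  assumes "g \<in> carrier G" "p \<in> rad"
  shows "act g p \<in> rad"
proof (rule radI)
  fix X :: "'b set" assume "X \<in> supports"
  then have "supp_act \<alpha> (inv\<^bsub>G\<^esub> g) X \<in> supports" using assms by simp
  then have "chi (supp_act \<alpha> g (supp_act \<alpha> (inv\<^bsub>G\<^esub> g) X)) (act g p) = 0"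
    using assms by (simp only: chi_act radD)
  then show "chi X (act g p) = 0" using assms by (simp add: supp_act_comp supp_act_one)
qed

lemma act_rad_sq:
  assumes "g \<in> carrier G" "p \<in> rad_sq"
  shows "act g p \<in> rad_sq"
  by (rule lin_span_subset[OF lin_pushforward subspace_rad_sq _ assms(2)[unfolded rad_sq_def]])
    (use assms(1) in \<open>auto simp: act_mult rad_sqI act_rad\<close>)

lemma chain_act_comp:
  "g \<in> carrier G \<Longrightarrow> h \<in> carrier G \<Longrightarrow> chain_act \<alpha> g (chain_act \<alpha> h C) = chain_act \<alpha> (g \<otimes>\<^bsub>G\<^esub> h) C"
  by (simp add: chain_act_def supp_act_comp)

lemma chain_act_one: "chain_act \<alpha> \<one>\<^bsub>G\<^esub> C = C"
  unfolding chain_act_def by (rule map_idI) (rule supp_act_one)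

lemma chain_act_strict_chains [simp]:
  "g \<in> carrier G \<Longrightarrow> C \<in> strict_chains \<Longrightarrow> chain_act \<alpha> g C \<in> strict_chains"
  by (auto simp: strict_chains_def chain_act_def sorted_wrt_map supp_act_psubset_iff)

lemma chain_stabilizer_eq:
  assumes "C \<noteq> []"
  shows "chain_stabilizer G \<alpha> C = {g \<in> carrier G. chain_act \<alpha> g C = C}"
proof -
  have "chain_act \<alpha> g C = C \<longleftrightarrow> (\<forall>X\<in>set C. supp_act \<alpha> g X = X)" for g
    using map_eq_conv[of "supp_act \<alpha> g" C id] by (simp add: chain_act_def)
  then show ?thesis using assms by (cases C) (auto simp: chain_stabilizer_def stabilizer_def)
qed

end

locale equivariant_idempotents = hereditary_idempotents E P + band_action G \<alpha>
  for E :: "'b::left_regular_band set \<Rightarrow> ('b \<Rightarrow>\<^sub>0 'k::field)" and P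
    and G :: "('g, 'm) monoid_scheme" and \<alpha> :: "'g \<Rightarrow> 'b \<Rightarrow> 'b" +
  assumes E_invariant: "g \<in> carrier G \<Longrightarrow> X \<in> supports \<Longrightarrow> pushforward (\<alpha> g) (E X) = E (supp_act \<alpha> g X)"
    and P_equivariant: "g \<in> carrier G \<Longrightarrow> P (pushforward (\<alpha> g) x) = pushforward (\<alpha> g) (P x)"
begin

lemma act_arrows:
  assumes "g \<in> carrier G" "X \<in> supports" "Z \<in> supports" "x \<in> arrows Z X"
  shows "act g x \<in> arrows (supp_act \<alpha> g Z) (supp_act \<alpha> g X)"
proof -
  note x = arrowsD[OF assms(4)]
  have "P (act g x) = 0" using assms(1) x(2) by (simp add: P_equivariant lin_zero[OF lin_pushforward])
  moreover have "E (supp_act \<alpha> g Z) \<star> act g x = act g (E Z \<star> x)"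
    "act g x \<star> E (supp_act \<alpha> g X) = act g (x \<star> E X)"
    using assms by (simp_all add: act_mult E_invariant)
  ultimately show ?thesis using x act_rad[OF assms(1) x(1)] by (simp add: arrows_def)
qed

lemma act_chain_space:
  assumes "g \<in> carrier G" "set C \<subseteq> supports" "u \<in> chain_space C"
  shows "act g u \<in> chain_space (chain_act \<alpha> g C)"
  using assms
proof (induction C arbitrary: u rule: chain_space.induct)
  case 1
  then show ?case by (simp add: chain_act_def lin_zero[OF lin_pushforward])
next
  case (2 X)
  then show ?case by (auto simp: chain_act_def lin_scale[OF lin_pushforward] E_invariant)
next
  case (3 X Z C)
  show ?case
  proof (rule lin_span_subset[OF lin_pushforward subspace_chain_space _ "3.prems"(3)[unfolded chain_space.simps]])
    fix y assume "y \<in> {a \<star> v | a v. a \<in> chain_space (Z # C) \<and> v \<in> arrows Z X}"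
    then obtain a v where y: "y = a \<star> v" "a \<in> chain_space (Z # C)" "v \<in> arrows Z X" by auto
    have "act g a \<in> chain_space (chain_act \<alpha> g (Z # C))" using 3 y by simp
    moreover have "act g v \<in> arrows (supp_act \<alpha> g Z) (supp_act \<alpha> g X)"
      using 3 y by (intro act_arrows) auto
    ultimately show "act g y \<in> chain_space (chain_act \<alpha> g (X # Z # C))"
      unfolding y act_mult[OF \<open>g \<in> carrier G\<close>] chain_act_def list.map chain_space.simps
      by (intro free.span_base) blast
  qed
qed

lemma chain_space_act_surj:
  assumes "g \<in> carrier G" "set C \<subseteq> supports" "v \<in> chain_space (chain_act \<alpha> g C)"
  obtains u where "u \<in> chain_space C" "act g u = v"
proof
  have "set (chain_act \<alpha> g C) \<subseteq> supports" using assms by (auto simp: chain_act_def)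
  from act_chain_space[OF _ this assms(3), of "inv\<^bsub>G\<^esub> g"]
  show "act (inv\<^bsub>G\<^esub> g) v \<in> chain_space C"
    using assms(1) by (simp add: chain_act_comp chain_act_one)
  show "act g (act (inv\<^bsub>G\<^esub> g) v) = v"
    using assms(1) by (simp add: act_comp act_one)
qed

definition chain_orbit :: "'b set list \<Rightarrow> 'b set list set" where
  "chain_orbit C = orbit G (chain_act \<alpha>) C"

lemma mem_chain_orbit: "D \<in> chain_orbit C \<longleftrightarrow> (\<exists>g\<in>carrier G. D = chain_act \<alpha> g C)"
  by (auto simp: chain_orbit_def orbit_def)

lemma chain_orbit_subset: "C \<in> strict_chains \<Longrightarrow> chain_orbit C \<subseteq> strict_chains"
  by (auto simp: mem_chain_orbit)

lemma finite_chain_orbit: "C \<in> strict_chains \<Longrightarrow> finite (chain_orbit C)"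
  using chain_orbit_subset finite_strict_chains by (rule finite_subset)

definition orbit_space :: "'b set list \<Rightarrow> ('b \<Rightarrow>\<^sub>0 'k) set" where
  "orbit_space C = {\<Sum>D\<in>chain_orbit C. u D | u. \<forall>D\<in>chain_orbit C. u D \<in> chain_space D}"

lemma subspace_orbit_space: "free.subspace (orbit_space C)"
  unfolding orbit_space_def by (rule subspace_sums) (rule subspace_chain_space)

lemma chain_space_subset_orbit_space:
  assumes "C \<in> strict_chains" "D \<in> chain_orbit C" "x \<in> chain_space D"
  shows "x \<in> orbit_space C"
proof -
  have "x = (\<Sum>D'\<in>chain_orbit C. if D' = D then x else 0)"
    using finite_chain_orbit[OF assms(1)] assms(2) by simp
  moreover have "\<forall>D'\<in>chain_orbit C. (if D' = D then x else 0) \<in> chain_space D'"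
    using assms(3) free.subspace_0[OF subspace_chain_space] by auto
  ultimately show ?thesis unfolding orbit_space_def by blast
qed

definition induced_eval :: "('w \<Rightarrow> ('b \<Rightarrow>\<^sub>0 'k)) \<Rightarrow> 'g \<times> 'w \<Rightarrow> ('b \<Rightarrow>\<^sub>0 'k)" where
  "induced_eval t = (\<lambda>(x, w). act x (t w))"

lemma induced_relations_cases:
  assumes "r \<in> induced_relations G H W"
  obtains (add) x w w' where "x \<in> carrier G" "w \<in> rcarrier W" "w' \<in> rcarrier W"
      "r = basis (x, radd W w w')
        - basis (x, w) - basis (x, w')"
  | (scale) x w c where "x \<in> carrier G" "w \<in> rcarrier W"
      "r = basis (x, rscale W c w) - pscale c (basis (x, w))"
  | (act) x h w where "x \<in> carrier G" "h \<in> H" "w \<in> rcarrier W"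
      "r = basis (x \<otimes>\<^bsub>G\<^esub> h, w) - basis (x, ract W h w)"
  using assms unfolding induced_relations_def by blast

lemma
  fixes W :: "('k, 'g, 'w) rep"
  assumes x: "x \<in> carrier G" and w: "w \<in> rcarrier W"
  shows induced_relation_add: "w' \<in> rcarrier W \<Longrightarrow> basis (x, radd W w w')
        - basis (x, w) - basis (x, w') \<in> free.span (induced_relations G H W)"
    and induced_relation_scale: "basis (x, rscale W c w)
        - pscale c (basis (x, w)) \<in> free.span (induced_relations G H W)"
    and induced_relation_act: "h \<in> H \<Longrightarrow> basis (x \<otimes>\<^bsub>G\<^esub> h, w)
        - basis (x, ract W h w) \<in> free.span (induced_relations G H W)"
  using x w by (auto intro!: free.span_base simp: induced_relations_def) blast+

text \<open>The chains in the orbit stand for the cosets of \<^term>\<open>H\<close>, with representatives \<^term>\<open>x\<close>.\<close>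

lemma induced_reduction:
  fixes W :: "('k, 'g, 'w) rep"
  assumes C: "C \<in> strict_chains" and t: "models H W (chain_space C) act t"
    and H: "H = {g \<in> carrier G. chain_act \<alpha> g C = C}"
    and x: "\<And>D. D \<in> chain_orbit C \<Longrightarrow> x D \<in> carrier G \<and> chain_act \<alpha> (x D) C = D"
    and p: "keys p \<subseteq> carrier G \<times> rcarrier W"
  shows "\<exists>w. (\<forall>D\<in>chain_orbit C. w D \<in> rcarrier W) \<and>
    p - (\<Sum>D\<in>chain_orbit C. basis (x D, w D)) \<in> free.span (induced_relations G H W)"
proof -
  let ?O = "chain_orbit C" and ?R = "free.span (induced_relations G H W)"
  let ?s = "\<lambda>w. \<Sum>D\<in>?O. Poly_Mapping.single (x D, w D) (1 :: 'k)"
  let ?T = "{p. \<exists>w. (\<forall>D\<in>?O. w D \<in> rcarrier W) \<and> p - ?s w \<in> ?R}"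
  have xO: "x D \<in> carrier G" if "D \<in> ?O" for D using x[OF that] by simp
  obtain z where z: "z \<in> rcarrier W" "t z = 0"
    using models_surj[OF t free.subspace_0[OF subspace_chain_space]] by blast
  have zR: "basis (g, z) \<in> ?R" if "g \<in> carrier G" for g
  proof -
    have "t (rscale W 0 z) = t z" by (simp add: models_scale[OF t z(1)] z(2))
    then have "rscale W 0 z = z" using models_inj[OF t] models_scale_closed[OF t z(1)] z(1) by blast
    then show ?thesis using induced_relation_scale[OF that z(1), of 0 H] by simp
  qed
  have TI: "p \<in> ?T" if "\<And>D. D \<in> ?O \<Longrightarrow> w D \<in> rcarrier W" "p - ?s w \<in> ?R" for p w
    using that by blast
  have "free.subspace ?T"
  proof (rule free.subspaceI)
    have "?s (\<lambda>_. z) \<in> ?R" by (intro free.span_sum zR xO)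
    then have "0 - ?s (\<lambda>_. z) \<in> ?R" by (simp add: free.span_neg)
    with z(1) show "0 \<in> ?T" by (rule TI)
  next
    fix p q assume "p \<in> ?T" "q \<in> ?T"
    then obtain v w where v: "\<And>D. D \<in> ?O \<Longrightarrow> v D \<in> rcarrier W" "p - ?s v \<in> ?R"
      and w: "\<And>D. D \<in> ?O \<Longrightarrow> w D \<in> rcarrier W" "q - ?s w \<in> ?R" by blast
    have "(\<Sum>D\<in>?O. basis (x D, radd W (v D) (w D))
        - basis (x D, v D) - basis (x D, w D)) \<in> ?R"
      by (intro free.span_sum induced_relation_add v w xO)
    then have "?s (\<lambda>D. radd W (v D) (w D)) - ?s v - ?s w \<in> ?R"
      by (simp add: sum_subtractf)
    then have "(p - ?s v) + (q - ?s w) - (?s (\<lambda>D. radd W (v D) (w D)) - ?s v - ?s w) \<in> ?R"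
      by (rule free.span_diff[OF free.span_add[OF v(2) w(2)]])
    then have "p + q - ?s (\<lambda>D. radd W (v D) (w D)) \<in> ?R" by (simp add: algebra_simps)
    with models_add_closed[OF t v(1) w(1)] show "p + q \<in> ?T" by (rule TI)
  next
    fix c p assume "p \<in> ?T"
    then obtain v where v: "\<And>D. D \<in> ?O \<Longrightarrow> v D \<in> rcarrier W" "p - ?s v \<in> ?R" by blast
    have "(\<Sum>D\<in>?O. basis (x D, rscale W c (v D))
        - pscale c (basis (x D, v D))) \<in> ?R"
      by (intro free.span_sum induced_relation_scale v xO)
    then have "?s (\<lambda>D. rscale W c (v D)) - pscale c (?s v) \<in> ?R"
      by (simp add: sum_subtractf free.scale_sum_right)
    then have "pscale c (p - ?s v) - (?s (\<lambda>D. rscale W c (v D)) - pscale c (?s v)) \<in> ?R"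
      by (rule free.span_diff[OF free.span_scale[OF v(2)]])
    then have "pscale c p - ?s (\<lambda>D. rscale W c (v D)) \<in> ?R"
      by (simp add: free.scale_right_diff_distrib)
    with models_scale_closed[OF t v(1)] show "pscale c p \<in> ?T" by (rule TI)
  qed
  moreover have "basis i \<in> ?T" if gw: "i \<in> carrier G \<times> rcarrier W" for i
  proof -
    obtain g w where i: "i = (g, w)" "g \<in> carrier G" "w \<in> rcarrier W" using gw by auto
    define D where "D = chain_act \<alpha> g C"
    have D: "D \<in> ?O" using i by (auto simp: D_def mem_chain_orbit)
    define h where "h = inv\<^bsub>G\<^esub> (x D) \<otimes>\<^bsub>G\<^esub> g"
    have g: "g = x D \<otimes>\<^bsub>G\<^esub> h" using xO[OF D] i(2) by (simp add: h_def flip: m_assoc)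
    have "chain_act \<alpha> h C = chain_act \<alpha> (inv\<^bsub>G\<^esub> (x D)) (chain_act \<alpha> g C)"
      using xO[OF D] i(2) by (simp add: h_def chain_act_comp)
    also have "\<dots> = chain_act \<alpha> (inv\<^bsub>G\<^esub> (x D)) (chain_act \<alpha> (x D) C)"
      using x[OF D] by (simp add: D_def)
    also have "\<dots> = C" using xO[OF D] by (simp add: chain_act_comp chain_act_one)
    finally have h: "h \<in> H" using xO[OF D] i(2) by (simp add: H h_def)
    let ?w = "\<lambda>D'. if D' = D then ract W h w else z"
    have hw: "ract W h w \<in> rcarrier W" by (rule models_act_closed[OF t h i(3)])
    have "?s ?w = basis (x D, ract W h w) + (\<Sum>D'\<in>?O - {D}. basis (x D', z))"
      using D finite_chain_orbit[OF C] by (subst sum.remove[of _ D]) (auto intro!: sum.cong)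
    then have "basis i - ?s ?w = (basis (x D \<otimes>\<^bsub>G\<^esub> h, w)
        - basis (x D, ract W h w)) - (\<Sum>D'\<in>?O - {D}. basis (x D', z))"
      using i(1) g by simp
    also have "\<dots> \<in> ?R"
      by (intro free.span_diff[OF induced_relation_act free.span_sum] zR xO D i h) auto
    finally show ?thesis by (rule TI[rotated]) (simp add: hw z(1))
  qed
  ultimately have "p \<in> ?T"
    using p by (intro lin_in_subspace[OF lin_id, of ?T p]) (simp, blast)
  then show ?thesis by blast
qed

theorem models_induced_rep:
  fixes W :: "('k, 'g, 'w) rep"
  assumes C: "C \<in> strict_chains" and t: "models H W (chain_space C) act t"
    and H: "H = {g \<in> carrier G. chain_act \<alpha> g C = C}"
  shows "models (carrier G) (induced_rep G H W) (orbit_space C) act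
    (coset_map (lin_extend (induced_eval t)))"
proof -
  let ?f = "lin_extend (induced_eval t)" and ?R = "free.span (induced_relations G H W)"
  let ?V = "{p :: 'g \<times> 'w \<Rightarrow>\<^sub>0 'k. keys p \<subseteq> carrier G \<times> rcarrier W}" and ?O = "chain_orbit C"
  have Cs: "set C \<subseteq> supports" by (rule strict_chainsD(2)[OF C])
  have sing: "basis (x, w) \<in> ?V" if "x \<in> carrier G" "w \<in> rcarrier W" for x w
    using that by simp
  have Hsub: "h \<in> carrier G" if "h \<in> H" for h using that H by simp
  have RV: "?R \<subseteq> ?V"
  proof (rule free.span_minimal[OF _ subspace_keys], rule subsetI)
    fix r assume "r \<in> induced_relations G H W"
    then show "r \<in> ?V"
    proof (cases rule: induced_relations_cases)
      case add
      then show ?thesis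
        unfolding add(4) by (intro free.subspace_diff[OF subspace_keys] sing models_add_closed[OF t])
    next
      case scale
      then show ?thesis
        unfolding scale(3)
        by (intro free.subspace_diff[OF subspace_keys] free.subspace_scale[OF subspace_keys] sing
            models_scale_closed[OF t])
    next
      case (act x h w)
      then show ?thesis
        unfolding act(4) using Hsub
        by (intro free.subspace_diff[OF subspace_keys] sing models_act_closed[OF t] m_closed) auto
    qed
  qed
  have fR: "?f r = 0" if "r \<in> ?R" for r
  proof -
    have "?f r \<in> {0}"
    proof (rule lin_span_subset[OF lin_lin_extend free.subspace_single_0 _ that])
      fix r assume "r \<in> induced_relations G H W"
      then show "?f r \<in> {0}"
      proof (cases rule: induced_relations_cases)
        case add
        then show ?thesis
          by (simp add: lin_diff[OF lin_lin_extend] lin_extend_single induced_eval_def models_add[OF t]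
              lin_add[OF lin_pushforward])
      next
        case scale
        then show ?thesis
          by (simp add: lin_diff[OF lin_lin_extend] lin_scale[OF lin_lin_extend] lin_extend_single
              induced_eval_def models_scale[OF t] lin_scale[OF lin_pushforward])
      next
        case (act x h w)
        then show ?thesis
          using Hsub[OF act(2)]
          by (simp add: lin_diff[OF lin_lin_extend] lin_extend_single induced_eval_def
              models_act[OF t] act_comp)
      qed
    qed
    then show ?thesis by simp
  qed
  have ker: "p \<in> ?R" if p: "p \<in> ?V" and fp: "?f p = 0" for p
  proof -
    define x where "x D = (SOME g. g \<in> carrier G \<and> chain_act \<alpha> g C = D)" for D
    have x: "x D \<in> carrier G \<and> chain_act \<alpha> (x D) C = D" if "D \<in> ?O" for D
      unfolding x_def by (rule someI_ex) (use that in \<open>auto simp: mem_chain_orbit\<close>)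
    have "keys p \<subseteq> carrier G \<times> rcarrier W" using p by simp
    from induced_reduction[OF C t H x this] obtain w
      where w: "\<And>D. D \<in> ?O \<Longrightarrow> w D \<in> rcarrier W"
        and pw: "p - (\<Sum>D\<in>?O. basis (x D, w D)) \<in> ?R" by blast
    let ?u = "\<lambda>D. if D \<in> ?O then act (x D) (t (w D)) else 0"
    have u: "?u D \<in> chain_space D" if "D \<in> strict_chains" for D
    proof (cases "D \<in> ?O")
      case True
      then have "act (x D) (t (w D)) \<in> chain_space (chain_act \<alpha> (x D) C)"
        using x w by (intro act_chain_space[OF _ Cs] models_in[OF t]) auto
      then show ?thesis using x True by simp
    qed (simp add: free.subspace_0[OF subspace_chain_space])
    have "(\<Sum>D\<in>?O. act (x D) (t (w D))) = 0"
      using fR[OF pw] fp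
      by (simp add: lin_diff[OF lin_lin_extend] lin_sum[OF lin_lin_extend] lin_extend_single induced_eval_def)
    then have sum0: "(\<Sum>D\<in>strict_chains. ?u D) = 0"
      using chain_orbit_subset[OF C] by (simp add: sum.inter_restrict[symmetric] Int_absorb1)
    have u0: "act (x D) (t (w D)) = 0" if D: "D \<in> ?O" for D
    proof -
      have "D \<in> strict_chains" using D chain_orbit_subset[OF C] by blast
      from chain_spaces_independent[of ?u, OF u sum0 this] show ?thesis using D by simp
    qed
    have "basis (x D, w D) \<in> ?R" if D: "D \<in> ?O" for D
    proof -
      have "t (w D) = act (inv\<^bsub>G\<^esub> (x D)) (act (x D) (t (w D)))"
        using x[OF D] by (simp add: act_comp act_one)
      then have tw: "t (w D) = 0" using u0[OF D] by (simp add: lin_zero[OF lin_pushforward])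
      then have "t (rscale W 0 (w D)) = t (w D)" by (simp add: models_scale[OF t w[OF D]])
      then have "rscale W 0 (w D) = w D"
        using models_inj[OF t] models_scale_closed[OF t w[OF D]] w[OF D] by blast
      then show ?thesis using induced_relation_scale[OF _ w[OF D], of "x D" 0 H] x[OF D] by simp
    qed
    then have "(\<Sum>D\<in>?O. basis (x D, w D)) \<in> ?R" by (intro free.span_sum)
    from free.span_add[OF pw this] show ?thesis by simp
  qed
  have image: "?f ` ?V = orbit_space C"
  proof
    show "?f ` ?V \<subseteq> orbit_space C"
    proof (rule image_subsetI)
      fix p assume p: "p \<in> ?V"
      show "?f p \<in> orbit_space C"
      proof (rule lin_in_subspace[OF lin_lin_extend subspace_orbit_space])
        fix i assume "i \<in> keys p"
        then obtain x w where i: "i = (x, w)" "x \<in> carrier G" "w \<in> rcarrier W" using p by auto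
        have "act x (t w) \<in> chain_space (chain_act \<alpha> x C)"
          by (intro act_chain_space[OF i(2) Cs] models_in[OF t i(3)])
        then have "act x (t w) \<in> orbit_space C"
          by (rule chain_space_subset_orbit_space[OF C, rotated]) (use i in \<open>auto simp: mem_chain_orbit\<close>)
        then show "?f (basis i) \<in> orbit_space C"
          by (simp add: i lin_extend_single induced_eval_def)
      qed
    qed
    show "orbit_space C \<subseteq> ?f ` ?V"
    proof
      fix y assume "y \<in> orbit_space C"
      then obtain u where y: "y = (\<Sum>D\<in>?O. u D)" and u: "\<And>D. D \<in> ?O \<Longrightarrow> u D \<in> chain_space D"
        unfolding orbit_space_def by blast
      have "u D \<in> ?f ` ?V" if D: "D \<in> ?O" for D
      proof -
        obtain g where g: "g \<in> carrier G" "D = chain_act \<alpha> g C" using D by (auto simp: mem_chain_orbit)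
        obtain v where v: "v \<in> chain_space C" "act g v = u D"
          using chain_space_act_surj[OF g(1) Cs] u[OF D] unfolding g(2) by blast
        obtain w where w: "w \<in> rcarrier W" "t w = v" using models_surj[OF t v(1)] by blast
        have "u D = ?f (basis (g, w))"
          by (simp add: lin_extend_single induced_eval_def w v)
        then show ?thesis using sing[OF g(1) w(1)] by blast
      qed
      then show "y \<in> ?f ` ?V"
        unfolding y by (intro free.subspace_sum subspace_image[OF lin_lin_extend subspace_keys])
    qed
  qed
  show ?thesis
    unfolding induced_rep_def image[symmetric]
  proof (rule models_quotient_rep[OF subspace_keys free.subspace_span RV lin_lin_extend])
    show "?f p = 0 \<longleftrightarrow> p \<in> ?R" if "p \<in> ?V" for p using ker[OF that] fR by blast
  next
    fix g p assume g: "g \<in> carrier G" and p: "p \<in> ?V"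
    let ?m = "\<lambda>(x, w). (g \<otimes>\<^bsub>G\<^esub> x, w)"
    have "keys (pushforward ?m p) \<subseteq> ?m ` keys p" by (rule keys_pushforward)
    also have "\<dots> \<subseteq> carrier G \<times> rcarrier W" using p g by auto
    finally have "pushforward ?m p \<in> ?V" by simp
    moreover have "?f (pushforward ?m p) = act g (?f p)"
    proof (rule lin_eq_on_keys[OF lin_compose[OF lin_lin_extend lin_pushforward] lin_compose[OF lin_pushforward lin_lin_extend]])
      fix i assume "i \<in> keys p"
      then obtain x w where i: "i = (x, w)" "x \<in> carrier G" using p by auto
      then show "?f (pushforward ?m (basis i)) = act g (?f (basis i))"
        using g by (simp add: pushforward_single lin_extend_single induced_eval_def act_comp)
    qed
    ultimately show "pushforward ?m p \<in> ?V \<and> ?f (pushforward ?m p) = act g (?f p)" by simp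
  qed
qed

end

section \<open>Arrow spaces as reduced homology\<close>

lemma lin_pscale_chi: "lin (\<lambda>p. pscale (chi X p) q)"
  by (rule linI) (simp_all add: chi_add chi_pscale free.scale_left_distrib)

text \<open>Modulo boundaries this is a derivation with respect to two characters, so it kills the square
  of the radical. It inverts the map from homology to arrows.\<close>

definition band_derivation :: "'b::left_regular_band \<Rightarrow> 'b set \<Rightarrow> ('b \<Rightarrow>\<^sub>0 'k::field) \<Rightarrow> ('b \<Rightarrow>\<^sub>0 'k)" where
  "band_derivation b W = lin_extend (\<lambda>c. if W \<subseteq> supp c \<and> \<not> supp b \<subseteq> supp c
     then basis (b * c) else 0)"

lemma lin_band_derivation: "lin (band_derivation b W)"
  by (simp add: band_derivation_def lin_lin_extend)

lemma band_derivation_single: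
  "band_derivation b W (basis c) =
    (if W \<subseteq> supp c \<and> \<not> supp b \<subseteq> supp c then basis (b * c) else 0)"
  by (simp add: band_derivation_def lin_extend_single)

lemma subspace_boundaries0: "free.subspace (boundaries0 P)"
  by (simp add: boundaries0_def)

lemma mult_mem_below_above:
  assumes "W \<subseteq> supp b" "W \<subseteq> supp c" "\<not> supp b \<subseteq> supp c"
  shows "b * c \<in> below_above b W"
  using assms by (auto simp: below_above_def supp_mult intro!: band_less_multI)

lemma band_derivation_mult_single:
  fixes b c d :: "'b::left_regular_band"
  assumes W: "W \<subset> supp b"
  shows "band_derivation b W (basis (c * d))
    - pscale (chi (supp b) (basis c)) (band_derivation b W (basis d))
    - pscale (chi W (basis d)) (band_derivation b W (basis c))
    \<in> boundaries0 (below_above b W)" (is "?x \<in> ?B")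
proof -
  have zero: "?x = 0 \<Longrightarrow> ?x \<in> ?B" using free.subspace_0[OF subspace_boundaries0] by metis
  show ?thesis
  proof (cases "W \<subseteq> supp c \<and> W \<subseteq> supp d")
    case False
    then have "?x = 0"
      using W by (auto simp: band_derivation_single chi_single supp_mult)
    then show ?thesis by (rule zero)
  next
    case True
    show ?thesis
    proof (cases "supp b \<subseteq> supp c")
      case c: True
      then have "b * (c * d) = b * d" by (simp add: supp_subset_iff flip: mult.assoc)
      then have "?x = 0"
        using True c by (simp add: band_derivation_single chi_single supp_mult)
      then show ?thesis by (rule zero)
    next
      case c: False
      let ?y = "b * c" and ?z = "b * (c * d)"
      have x: "?x = basis ?z - basis ?y"
        using True c by (simp add: band_derivation_single chi_single supp_mult)
      have y: "?y \<in> below_above b W" and z: "?z \<in> below_above b W"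
        using W True c by (auto intro!: mult_mem_below_above simp: supp_mult)
      have "?y * ?z = ?z" by (metis band mult.assoc)
      then have "?z = ?y \<or> band_less ?z ?y" by (auto simp: band_less_def band_le_def)
      then show ?thesis
      proof
        assume "?z = ?y"
        then show ?thesis using x by (intro zero) simp
      next
        assume "band_less ?z ?y"
        then have "basis ?y - basis ?z \<in> ?B"
          unfolding boundaries0_def using y z by (intro free.span_base) blast
        from free.subspace_neg[OF subspace_boundaries0 this] show ?thesis unfolding x by simp
      qed
    qed
  qed
qed

lemma band_derivation_mult:
  fixes b :: "'b::left_regular_band"
  assumes W: "W \<subset> supp b"
  shows "band_derivation b W (p \<star> q) - pscale (chi (supp b) p) (band_derivation b W q)
    - pscale (chi W q) (band_derivation b W p) \<in> boundaries0 (below_above b W)"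
proof (rule lin_in_subspace[where p = p, OF _ subspace_boundaries0])
  show "lin (\<lambda>p. band_derivation b W (p \<star> q) - pscale (chi (supp b) p) (band_derivation b W q)
    - pscale (chi W q) (band_derivation b W p))"
    by (intro lin_intros lin_pscale_chi lin_band_derivation lin_compose[OF lin_band_derivation lin_alg_mult_left])
  fix c
  show "band_derivation b W (basis c \<star> q)
      - pscale (chi (supp b) (basis c)) (band_derivation b W q)
    - pscale (chi W q) (band_derivation b W (basis c)) \<in> boundaries0 (below_above b W)"
  proof (rule lin_in_subspace[where p = q, OF _ subspace_boundaries0])
    show "lin (\<lambda>q. band_derivation b W (basis c \<star> q)
      - pscale (chi (supp b) (basis c)) (band_derivation b W q)
    - pscale (chi W q) (band_derivation b W (basis c)))"
      by (intro lin_intros lin_pscale_chi lin_band_derivation lin_compose[OF lin_band_derivation lin_alg_mult_right])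
  qed (use band_derivation_mult_single[OF W] in \<open>simp add: single_alg_mult_single\<close>)
qed

lemma band_derivation_rad_sq:
  fixes b :: "'b::left_regular_band" and x :: "'b \<Rightarrow>\<^sub>0 'k::field"
  assumes W: "W \<subset> supp b" "W \<in> supports" and x: "x \<in> rad_sq"
  shows "band_derivation b W x \<in> boundaries0 (below_above b W)"
proof (rule lin_span_subset[OF lin_band_derivation subspace_boundaries0 _ x[unfolded rad_sq_def]])
  fix y :: "'b \<Rightarrow>\<^sub>0 'k" assume "y \<in> {p \<star> q |p q. p \<in> rad \<and> q \<in> rad}"
  then obtain p q where "y = p \<star> q" "p \<in> rad" "q \<in> rad" by auto
  then show "band_derivation b W y \<in> boundaries0 (below_above b W)"
    using band_derivation_mult[OF W(1), of p q] W(2) by (simp add: radD)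
qed

lemma reduced_cycles0_below_above:
  "reduced_cycles0 (below_above b W) = {p :: 'b::left_regular_band \<Rightarrow>\<^sub>0 'k::field. keys p \<subseteq> below_above b W \<and> chi W p = 0}"
proof -
  have "(\<Sum>x\<in>keys p. lookup p x) = chi W p"
    if "keys p \<subseteq> below_above b W" for p :: "'b \<Rightarrow>\<^sub>0 'k"
    unfolding chi_keys by (rule sum.cong) (use that in \<open>auto simp: below_above_def\<close>)
  then show ?thesis by (auto simp: reduced_cycles0_def)
qed

lemma subspace_reduced_cycles0:
  "free.subspace (reduced_cycles0 (below_above b W) :: ('b::left_regular_band \<Rightarrow>\<^sub>0 'k::field) set)"
proof -
  have "free.subspace ({p :: 'b \<Rightarrow>\<^sub>0 'k. keys p \<subseteq> below_above b W} \<inter> {p. chi W p = 0})"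
    by (intro free.subspace_inter subspace_keys free.subspaceI) (auto simp: chi_add chi_pscale)
  moreover have "reduced_cycles0 (below_above b W)
      = {p :: 'b \<Rightarrow>\<^sub>0 'k. keys p \<subseteq> below_above b W} \<inter> {p. chi W p = 0}"
    by (auto simp: reduced_cycles0_below_above)
  ultimately show ?thesis by simp
qed

lemma boundaries0_subset:
  "boundaries0 (below_above b W) \<subseteq> (reduced_cycles0 (below_above b W) :: ('b::left_regular_band \<Rightarrow>\<^sub>0 'k::field) set)"
  unfolding boundaries0_def
proof (rule free.span_minimal[OF _ subspace_reduced_cycles0], clarify)
  fix x y assume xy: "x \<in> below_above b W" "y \<in> below_above b W"
  have "basis y - basis x \<in> {p :: 'b \<Rightarrow>\<^sub>0 'k. keys p \<subseteq> below_above b W}"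
    by (intro free.subspace_diff[OF subspace_keys]) (use xy in auto)
  then show "basis y - Poly_Mapping.single x (1 :: 'k) \<in> reduced_cycles0 (below_above b W)"
    using xy unfolding reduced_cycles0_below_above
    by (simp add: chi_diff chi_single) (simp add: below_above_def)
qed

lemma band_derivation_id:
  assumes "keys z \<subseteq> below_above b W"
  shows "band_derivation b W z = z"
proof (rule lin_eq_on_keys[OF lin_band_derivation lin_id])
  fix a assume "a \<in> keys z"
  then have "band_less a b" "W \<subseteq> supp a" using assms by (auto simp: below_above_def)
  then show "band_derivation b W (basis a) = basis a"
    using band_less_supp[of a b] by (auto simp: band_derivation_single)
qed

lemma keys_band_derivation:
  assumes "W \<subseteq> supp b"
  shows "keys (band_derivation b W p) \<subseteq> below_above b W"
proof -
  have "band_derivation b W p \<in> {p. keys p \<subseteq> below_above b W}"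
    by (rule lin_in_subspace[OF lin_band_derivation subspace_keys])
      (use assms in \<open>auto simp: band_derivation_single mult_mem_below_above split: if_splits\<close>)
  then show ?thesis by simp
qed

lemma chi_band_derivation:
  fixes b :: "'b::left_regular_band" and p :: "'b \<Rightarrow>\<^sub>0 'k::field"
  assumes "W \<subset> supp b"
  shows "chi W (band_derivation b W p) = chi W p - chi (supp b) p"
proof -
  have "pscale (chi W (band_derivation b W p)) (basis b)
      = pscale (chi W p) (basis b) - pscale (chi (supp b) p) (Poly_Mapping.single b (1::'k))"
  proof (rule lin_eq_on_keys[where p = p])
    show "lin (\<lambda>p. pscale (chi W (band_derivation b W p)) (Poly_Mapping.single b (1::'k)))"
      by (rule lin_compose[OF lin_pscale_chi lin_band_derivation])
    show "lin (\<lambda>p. pscale (chi W p) (basis b)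
        - pscale (chi (supp b) p) (Poly_Mapping.single b (1::'k)))"
      by (intro lin_intros lin_pscale_chi)
    fix c
    show "pscale (chi W (band_derivation b W (basis c))) (Poly_Mapping.single b (1::'k))
      = pscale (chi W (basis c)) (basis b)
        - pscale (chi (supp b) (basis c)) (basis b)"
      using assms by (auto simp: band_derivation_single chi_single supp_mult)
  qed
  then have "lookup (pscale (chi W (band_derivation b W p)) (basis b)) b
      = lookup (pscale (chi W p) (basis b)
        - pscale (chi (supp b) p) (Poly_Mapping.single b (1::'k))) b" by (rule arg_cong)
  then show ?thesis by (simp add: lookup_pscale lookup_minus)
qed

context band_idempotents
begin

abbreviation alg_unit :: "'b \<Rightarrow>\<^sub>0 'k" where
  "alg_unit \<equiv> (\<Sum>X\<in>supports. E X)"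

lemma chi_alg_unit: "X \<in> supports \<Longrightarrow> chi X alg_unit = 1"
  by (simp add: chi_sum chi_E)

lemma edge_in_rad_sq:
  assumes W: "W \<in> supports" and xy: "x \<in> below_above b W" "y \<in> below_above b W" "band_less x y"
  shows "E (supp b) \<star> (basis y - basis x) \<star> E W \<in> rad_sq"
proof -
  let ?x = "Poly_Mapping.single x (1::'k)" and ?y = "Poly_Mapping.single y (1::'k)"
  let ?Z = "supp b"
  have yb: "supp y \<subset> ?Z" "W \<subseteq> supp x" using xy band_less_supp[of y b] by (auto simp: below_above_def)
  have "?y \<star> (alg_unit - ?x) = ?y - ?x"
    using band_less_supp(2)[OF xy(3)] by (simp add: alg_mult_linear E_unit_right single_alg_mult_single)
  then have "E ?Z \<star> (?y - ?x) \<star> E W = E ?Z \<star> (?y \<star> (alg_unit \<star> (alg_unit - ?x))) \<star> E W"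
    by (simp add: E_unit_left)
  also have "\<dots> = (\<Sum>V\<in>supports. E ?Z \<star> (?y \<star> (E V \<star> (alg_unit - ?x))) \<star> E W)"
    unfolding alg_mult_sum_left[of E] unfolding alg_mult_sum_right unfolding alg_mult_sum_left ..
  also have "\<dots> = (\<Sum>V\<in>supports. (E ?Z \<star> ?y \<star> E V) \<star> (E V \<star> (alg_unit - ?x) \<star> E W))"
    by (intro sum.cong refl) (simp only: alg_mult_assoc E_E_mult)
  also have "\<dots> \<in> rad_sq"
  proof (intro free.subspace_sum[OF subspace_rad_sq] rad_sqI)
    fix V :: "'b set" assume V: "V \<in> supports"
    show "E ?Z \<star> ?y \<star> E V \<in> rad"
    proof (cases "V = ?Z")
      case True
      then have "?y \<star> E V = 0" using V yb by (intro single_mult_E_eq_0) auto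
      then show ?thesis by (simp add: alg_mult_assoc alg_mult_linear free.subspace_0[OF subspace_rad])
    qed (use V E_mult_E_in_rad in simp)
    show "E V \<star> (alg_unit - ?x) \<star> E W \<in> rad"
    proof (cases "V = W")
      case True
      have "chi W (alg_unit - ?x) = 0" using yb W by (simp add: chi_diff chi_alg_unit chi_single)
      then show ?thesis unfolding True by (intro rad_mult_right E_mult_in_rad W)
    qed (use V W E_mult_E_in_rad in simp)
  qed
  finally show ?thesis .
qed

lemma E_unit_minus_in_rad:
  "E (supp b) \<star> (alg_unit - basis b) \<in> rad"
  by (rule E_mult_in_rad) (simp_all add: chi_diff chi_alg_unit chi_single)

lemma single_mult_rad_sq:
  assumes "q \<in> rad"
  shows "E (supp b) \<star> q - E (supp b) \<star> (basis b \<star> q) \<in> rad_sq"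
proof -
  have "E (supp b) \<star> (alg_unit - basis b) \<star> q \<in> rad_sq"
    by (intro rad_sqI E_unit_minus_in_rad assms)
  then show ?thesis by (simp add: alg_mult_assoc alg_mult_linear E_unit_left)
qed

lemma single_mult_band_derivation:
  assumes W: "W \<in> supports" "W \<subset> supp b"
  shows "(basis b \<star> p) \<star> E W
    = band_derivation b W p \<star> E W + pscale (chi (supp b) p) (basis b \<star> E W)"
proof (rule lin_eq_on_keys[where p = p])
  show "lin (\<lambda>p. (basis b \<star> p) \<star> E W)"
    by (rule lin_compose[OF lin_alg_mult_left lin_alg_mult_right])
  show "lin (\<lambda>p. band_derivation b W p \<star> E W + pscale (chi (supp b) p) (basis b \<star> E W))"
    by (intro lin_intros lin_pscale_chi lin_compose[OF lin_alg_mult_left lin_band_derivation])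
  fix c
  show "(basis b \<star> basis c) \<star> E W
    = band_derivation b W (basis c) \<star> E W
      + pscale (chi (supp b) (basis c)) (basis b \<star> E W)"
  proof (cases "W \<subseteq> supp c")
    case False
    then have "basis (b * c) \<star> E W = 0"
      by (intro single_mult_E_eq_0 W) (auto simp: supp_mult)
    moreover have "\<not> supp b \<subseteq> supp c" using False W by auto
    ultimately show ?thesis using False
      by (simp add: single_alg_mult_single band_derivation_single chi_single alg_mult_linear)
  next
    case True
    then show ?thesis
      by (auto simp: single_alg_mult_single band_derivation_single chi_single alg_mult_linear
          supp_subset_iff[of b c])
  qed
qed

end

context equivariant_idempotents
begin

definition homology_eval :: "'b set \<Rightarrow> 'b set \<Rightarrow> ('b \<Rightarrow>\<^sub>0 'k) \<Rightarrow> ('b \<Rightarrow>\<^sub>0 'k)" where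
  "homology_eval Z W z = E Z \<star> z \<star> E W - P (E Z \<star> z \<star> E W)"

lemma lin_homology_eval: "lin (homology_eval Z W)"
  unfolding homology_eval_def[abs_def]
  by (intro lin_minus lin_compose[OF lin_P] lin_compose[OF lin_alg_mult_left lin_alg_mult_right])

lemma P_diff_eq:
  assumes "x - y \<in> rad_sq"
  shows "x - P x = y - P y"
proof -
  have "P x - P y = x - y" using P_id[OF assms] by (simp add: lin_diff[OF lin_P])
  then show ?thesis by (simp add: algebra_simps)
qed

theorem models_reduced_H0:
  assumes W: "W \<in> supports" and b: "supp b = Z" and WZ: "W \<subset> Z"
    and S: "S \<subseteq> carrier G" "\<And>g. g \<in> S \<Longrightarrow> supp_act \<alpha> g W = W" "\<And>g. g \<in> S \<Longrightarrow> supp_act \<alpha> g Z = Z"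
  shows "models S (reduced_H0 \<alpha> b W) (arrows Z W) act (coset_map (homology_eval Z W))"
proof -
  let ?f = "homology_eval Z W" and ?A = "below_above b W" and ?b = "Poly_Mapping.single b (1::'k)"
  let ?V = "reduced_cycles0 ?A :: ('b \<Rightarrow>\<^sub>0 'k) set" and ?B = "boundaries0 ?A :: ('b \<Rightarrow>\<^sub>0 'k) set"
  have Z: "Z \<in> supports" using b by auto
  have Wb: "W \<subset> supp b" using WZ b by simp
  have kerW: "z \<star> E W \<in> rad" if "chi W z = 0" for z
    by (rule mult_E_in_rad[OF W that])
  have EzE: "E Z \<star> z \<star> E W \<in> rad" if "chi W z = 0" for z
    using rad_mult_left[OF kerW[OF that]] by (simp add: alg_mult_assoc)
  have V: "keys z \<subseteq> ?A" "chi W z = 0" if "z \<in> ?V" for z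
    using that by (auto simp: reduced_cycles0_below_above)
  have fB: "?f z = 0" if "z \<in> ?B" for z
  proof -
    have "?f z \<in> {0}"
    proof (rule lin_span_subset[OF lin_homology_eval free.subspace_single_0 _ that[unfolded boundaries0_def]])
      fix e assume "e \<in> {basis y - Poly_Mapping.single x (1::'k) |x y.
          x \<in> ?A \<and> y \<in> ?A \<and> band_less x y}"
      then obtain x y where e: "e = basis y - Poly_Mapping.single x (1::'k)"
        "x \<in> ?A" "y \<in> ?A" "band_less x y" by auto
      have "E Z \<star> e \<star> E W \<in> rad_sq"
        using edge_in_rad_sq[OF W e(2-4)] unfolding e(1) b .
      then show "?f e \<in> {0}" by (simp add: homology_eval_def P_id)
    qed
    then show ?thesis by simp
  qed
  have D: "band_derivation b W (E Z \<star> z \<star> E W) - z \<in> ?B" if z: "z \<in> ?V" for z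
  proof -
    have "chi Z z = 0"
      unfolding chi_keys using V(1)[OF z] band_less_supp(1) b
      by (intro sum.neutral) (auto simp: below_above_def)
    then have 1: "band_derivation b W (z \<star> E W) - z \<in> ?B"
      using band_derivation_mult[OF Wb, of z "E W"] W b
      by (simp add: chi_E band_derivation_id[OF V(1)[OF z]])
    have "band_derivation b W (E Z \<star> (z \<star> E W)) - band_derivation b W (z \<star> E W) \<in> ?B"
      using band_derivation_mult[OF Wb, of "E Z" "z \<star> E W"] W Z b V(2)[OF z]
      by (simp add: chi_E chi_mult)
    from free.subspace_add[OF subspace_boundaries0 this 1] show ?thesis by (simp add: alg_mult_assoc)
  qed
  have ker: "z \<in> ?B" if z: "z \<in> ?V" and f0: "?f z = 0" for z
  proof -
    have "E Z \<star> z \<star> E W = P (E Z \<star> z \<star> E W)" using f0 by (simp add: homology_eval_def)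
    then have "E Z \<star> z \<star> E W \<in> rad_sq" using P_in[of "E Z \<star> z \<star> E W"] by simp
    from free.subspace_diff[OF subspace_boundaries0 band_derivation_rad_sq[OF Wb W this] D[OF z]]
    show ?thesis by simp
  qed
  have image: "?f ` ?V = arrows Z W"
  proof (intro equalityI subsetI)
    fix y assume "y \<in> ?f ` ?V"
    then obtain z where z: "z \<in> ?V" "y = ?f z" by blast
    have "E Z \<star> (E Z \<star> z \<star> E W) = E Z \<star> z \<star> E W" "E Z \<star> z \<star> E W \<star> E W = E Z \<star> z \<star> E W"
      using Z W by (simp_all add: mult_E_E E_E_mult alg_mult_assoc[of "E Z"])
    then show "y \<in> arrows Z W"
      unfolding z(2) homology_eval_def by (intro arrow_part EzE V(2) z(1) W Z)
  next
    fix v assume v: "v \<in> arrows Z W"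
    note v' = arrowsD[OF v]
    let ?z = "band_derivation b W v"
    have chi0: "chi Z v = 0" "chi W v = 0" using v'(1) W Z by (auto dest: radD)
    have zV: "?z \<in> ?V"
      using keys_band_derivation[of W b v] chi_band_derivation[OF Wb, of v] WZ b chi0
      by (auto simp: reduced_cycles0_below_above)
    have "(?b \<star> v) \<star> E W = ?z \<star> E W"
      using single_mult_band_derivation[OF W Wb, of v] chi0 b by simp
    then have "?b \<star> v = ?z \<star> E W" using v'(4) by (simp add: alg_mult_assoc)
    then have "v - E Z \<star> ?z \<star> E W \<in> rad_sq"
      using single_mult_rad_sq[OF v'(1), of b] v'(3) b by (simp add: alg_mult_assoc)
    from P_diff_eq[OF this] have "v = ?f ?z"
      using v'(2) by (simp add: homology_eval_def)
    then show "v \<in> ?f ` ?V" using zV by blast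
  qed
  have act: "pushforward (\<lambda>a. b * \<alpha> g a) z \<in> ?V \<and> ?f (pushforward (\<lambda>a. b * \<alpha> g a) z) = act g (?f z)"
    if g: "g \<in> S" and z: "z \<in> ?V" for g z
  proof
    have gG: "g \<in> carrier G" using g S by blast
    have push: "pushforward (\<lambda>a. b * \<alpha> g a) z = ?b \<star> act g z"
      by (rule lin_eq_on_keys[OF lin_pushforward lin_compose[OF lin_alg_mult_right lin_pushforward]])
        (simp add: pushforward_single single_alg_mult_single)
    have chig: "chi W (act g z) = 0"
      using chi_act[OF gG, of W z] S(2)[OF g] V(2)[OF z] by simp
    have "b * \<alpha> g a \<in> ?A" if "a \<in> ?A" for a
    proof -
      have "supp a \<subset> Z" "W \<subseteq> supp a" using that band_less_supp(1)[of a b] b by (auto simp: below_above_def)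
      then have "supp_act \<alpha> g (supp a) \<subset> supp_act \<alpha> g Z" "supp_act \<alpha> g W \<subseteq> supp_act \<alpha> g (supp a)"
        using gG by (simp_all add: supp_act_psubset_iff supp_act_subset_iff)
      then show ?thesis
        using S(2,3)[OF g] gG Wb b by (intro mult_mem_below_above) (auto simp: supp_act_supp)
    qed
    then have "keys (pushforward (\<lambda>a. b * \<alpha> g a) z) \<subseteq> ?A"
      using V(1)[OF z] keys_pushforward[of "\<lambda>a. b * \<alpha> g a" z] by blast
    moreover have "chi W (pushforward (\<lambda>a. b * \<alpha> g a) z) = 0" by (simp add: push chi_mult chig)
    ultimately show "pushforward (\<lambda>a. b * \<alpha> g a) z \<in> ?V" by (simp add: reduced_cycles0_below_above)
    have "E Z \<star> (act g z \<star> E W) - E Z \<star> (?b \<star> (act g z \<star> E W)) \<in> rad_sq"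
      using single_mult_rad_sq[OF kerW[OF chig], of b] b by simp
    then have "E Z \<star> act g z \<star> E W - E Z \<star> (?b \<star> act g z) \<star> E W \<in> rad_sq"
      by (simp add: alg_mult_assoc)
    from P_diff_eq[OF this] have "?f (?b \<star> act g z) = ?f (act g z)"
      by (simp add: homology_eval_def)
    also have "E Z \<star> act g z \<star> E W = act g (E Z \<star> z \<star> E W)"
      using S(2,3)[OF g] gG Z W by (simp add: act_mult E_invariant)
    then have "?f (act g z) = act g (?f z)"
      by (simp add: homology_eval_def P_equivariant[OF gG] lin_diff[OF lin_pushforward])
    finally show "?f (pushforward (\<lambda>a. b * \<alpha> g a) z) = act g (?f z)" by (simp add: push)
  qed
  show ?thesis
    unfolding reduced_H0_def image[symmetric]
    by (rule models_quotient_rep[OF subspace_reduced_cycles0 subspace_boundaries0 boundaries0_subset lin_homology_eval])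
      (use ker fB act in blast)+
qed

end

section \<open>An equivariant projection onto the square of the radical\<close>

context band_idempotents
begin

definition peirce_average :: "(('b \<Rightarrow>\<^sub>0 'k) \<Rightarrow> ('b \<Rightarrow>\<^sub>0 'k)) \<Rightarrow> ('b \<Rightarrow>\<^sub>0 'k) \<Rightarrow> ('b \<Rightarrow>\<^sub>0 'k)" where
  "peirce_average r x = (\<Sum>Y\<in>supports. \<Sum>X\<in>supports. E Y \<star> r (E Y \<star> x \<star> E X) \<star> E X)"

lemma
  assumes r: "lin r" "\<And>x. r x \<in> rad_sq" "\<And>x. x \<in> rad_sq \<Longrightarrow> r x = x"
  shows lin_peirce_average: "lin (peirce_average r)"
    and peirce_average_in: "peirce_average r x \<in> rad_sq"
    and peirce_average_id: "x \<in> rad_sq \<Longrightarrow> peirce_average r x = x"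
    and peirce_average_left: "Y \<in> supports \<Longrightarrow> peirce_average r (E Y \<star> x) = E Y \<star> peirce_average r x"
    and peirce_average_right: "X \<in> supports \<Longrightarrow> peirce_average r (x \<star> E X) = peirce_average r x \<star> E X"
proof -
  show "lin (peirce_average r)"
    unfolding peirce_average_def[abs_def]
    by (intro lin_setsum lin_compose[OF lin_alg_mult_left] lin_compose[OF lin_alg_mult_right]
        lin_compose[OF r(1)] lin_alg_mult_right)
  show "peirce_average r x \<in> rad_sq"
    unfolding peirce_average_def
    by (intro free.subspace_sum[OF subspace_rad_sq] rad_sq_mult_left rad_sq_mult_right r(2))
  show "peirce_average r x = x" if x: "x \<in> rad_sq"
  proof -
    have "r (E Y \<star> x \<star> E X) = E Y \<star> x \<star> E X" for X Y
      by (intro r(3) rad_sq_mult_left rad_sq_mult_right x)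
    then have "peirce_average r x = (\<Sum>Y\<in>supports. \<Sum>X\<in>supports. E Y \<star> x \<star> E X)"
      unfolding peirce_average_def
      by (intro sum.cong refl) (simp add: mult_E_E E_E_mult alg_mult_assoc E_idem)
    then show ?thesis using unit_decomp[of x] by simp
  qed
  have delta: "E Z \<star> E Y = (if Z = Y then E Y else 0)" if "Z \<in> supports" "Y \<in> supports" for Y Z
    using that E_orth E_idem by auto
  show "peirce_average r (E Y \<star> x) = E Y \<star> peirce_average r x" if Y: "Y \<in> supports"
  proof -
    have "peirce_average r (E Y \<star> x) = (\<Sum>Z\<in>supports. if Z = Y then
        \<Sum>X\<in>supports. E Y \<star> r (E Y \<star> x \<star> E X) \<star> E X else 0)"
      unfolding peirce_average_def
      by (intro sum.cong refl) (simp add: delta Y lin_zero[OF r(1)] alg_mult_linear flip: alg_mult_assoc)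
    also have "\<dots> = (\<Sum>Z\<in>supports. E Y \<star> (\<Sum>X\<in>supports. E Z \<star> r (E Z \<star> x \<star> E X) \<star> E X))"
      unfolding alg_mult_sum_right
      by (intro sum.cong refl) (auto simp add: delta Y alg_mult_linear simp flip: alg_mult_assoc)
    finally show ?thesis by (simp add: peirce_average_def alg_mult_sum_right)
  qed
  show "peirce_average r (x \<star> E X) = peirce_average r x \<star> E X" if X: "X \<in> supports"
  proof -
    have "peirce_average r (x \<star> E X) = (\<Sum>Y\<in>supports. \<Sum>Z\<in>supports. if Z = X then
        E Y \<star> r (E Y \<star> x \<star> E X) \<star> E X else 0)"
      unfolding peirce_average_def
      by (intro sum.cong refl) (auto simp add: delta X lin_zero[OF r(1)] alg_mult_linear alg_mult_assoc)
    also have "\<dots> = (\<Sum>Y\<in>supports. \<Sum>Z\<in>supports. E Y \<star> r (E Y \<star> x \<star> E Z) \<star> E Z \<star> E X)"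
      by (intro sum.cong refl) (auto simp add: delta X alg_mult_linear alg_mult_assoc)
    finally show ?thesis by (simp add: peirce_average_def alg_mult_sum_left)
  qed
qed

end

lemma equivariant_projection_exists:
  fixes E :: "'b::left_regular_band set \<Rightarrow> ('b \<Rightarrow>\<^sub>0 'k::field)" and \<alpha> :: "'g \<Rightarrow> 'b \<Rightarrow> 'b"
  assumes "band_idempotents E" "band_action G \<alpha>"
    and fin: "finite (carrier G)" and char: "of_nat (order G) \<noteq> (0 :: 'k)"
    and inv: "\<And>g X. g \<in> carrier G \<Longrightarrow> X \<in> supports \<Longrightarrow> pushforward (\<alpha> g) (E X) = E (supp_act \<alpha> g X)"
  shows "\<exists>P. lin P \<and> (\<forall>x. P x \<in> rad_sq) \<and> (\<forall>x\<in>rad_sq. P x = x)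
    \<and> (\<forall>Y\<in>supports. \<forall>x. P (E Y \<star> x) = E Y \<star> P x) \<and> (\<forall>X\<in>supports. \<forall>x. P (x \<star> E X) = P x \<star> E X)
    \<and> (\<forall>g\<in>carrier G. \<forall>x. P (pushforward (\<alpha> g) x) = pushforward (\<alpha> g) (P x))"
proof -
  interpret band_idempotents E by fact
  interpret band_action G \<alpha> by fact
  obtain r :: "('b \<Rightarrow>\<^sub>0 'k) \<Rightarrow> ('b \<Rightarrow>\<^sub>0 'k)" where "lin r" "range r \<subseteq> rad_sq" "\<forall>x\<in>rad_sq. r x = x"
    using lin_projection_exists[OF subspace_rad_sq] by blast
  then have r: "lin r" "\<And>x. r x \<in> rad_sq" "\<And>x. x \<in> rad_sq \<Longrightarrow> r x = x" by auto
  let ?Q = "peirce_average r"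
  define c :: 'k where "c = inverse (of_nat (order G))"
  define P where "P x = pscale c (\<Sum>g\<in>carrier G. act (inv\<^bsub>G\<^esub> g) (?Q (act g x)))" for x
  have actinv: "act (inv\<^bsub>G\<^esub> g) (act g x) = x" if "g \<in> carrier G" for g and x :: "'b \<Rightarrow>\<^sub>0 'k"
    using that by (simp add: act_comp act_one)
  have "lin P"
    unfolding P_def[abs_def]
    by (intro lin_pscale lin_setsum lin_compose[OF lin_pushforward] lin_compose[OF lin_peirce_average[OF r]]
        lin_pushforward)
  moreover have "P x \<in> rad_sq" for x
    unfolding P_def
    by (intro free.subspace_scale[OF subspace_rad_sq] free.subspace_sum[OF subspace_rad_sq]
        act_rad_sq peirce_average_in[OF r] inv_closed)
  moreover have "P x = x" if x: "x \<in> rad_sq" for x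
  proof -
    have "(\<Sum>g\<in>carrier G. act (inv\<^bsub>G\<^esub> g) (?Q (act g x))) = (\<Sum>g\<in>carrier G. x)"
      using x by (intro sum.cong refl) (simp add: peirce_average_id[OF r] act_rad_sq actinv)
    also have "\<dots> = pscale (of_nat (order G)) x"
      by (simp add: order_def free.sum_constant_scale)
    finally show ?thesis using char by (simp add: P_def c_def)
  qed
  moreover have "P (E Y \<star> x) = E Y \<star> P x" if Y: "Y \<in> supports" for Y x
  proof -
    have "act (inv\<^bsub>G\<^esub> g) (?Q (act g (E Y \<star> x))) = E Y \<star> act (inv\<^bsub>G\<^esub> g) (?Q (act g x))"
      if g: "g \<in> carrier G" for g
      using g Y by (simp add: act_mult inv peirce_average_left[OF r] supp_act_comp supp_act_one)
    then show ?thesis by (simp add: P_def alg_mult_linear alg_mult_sum_right)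
  qed
  moreover have "P (x \<star> E X) = P x \<star> E X" if X: "X \<in> supports" for X x
  proof -
    have "act (inv\<^bsub>G\<^esub> g) (?Q (act g (x \<star> E X))) = act (inv\<^bsub>G\<^esub> g) (?Q (act g x)) \<star> E X"
      if g: "g \<in> carrier G" for g
      using g X by (simp add: act_mult inv peirce_average_right[OF r] supp_act_comp supp_act_one)
    then show ?thesis by (simp add: P_def alg_mult_linear alg_mult_sum_left)
  qed
  moreover have "P (act h x) = act h (P x)" if h: "h \<in> carrier G" for h x
  proof -
    have "(\<Sum>g\<in>carrier G. act (inv\<^bsub>G\<^esub> g) (?Q (act g (act h x))))
        = (\<Sum>g\<in>carrier G. act h (act (inv\<^bsub>G\<^esub> g) (?Q (act g x))))"
    proof (rule sum.reindex_bij_witness[where i = "\<lambda>g. g \<otimes>\<^bsub>G\<^esub> inv\<^bsub>G\<^esub> h" and j = "\<lambda>g. g \<otimes>\<^bsub>G\<^esub> h"])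
      fix g assume g: "g \<in> carrier G"
      have "h \<otimes>\<^bsub>G\<^esub> inv\<^bsub>G\<^esub> (g \<otimes>\<^bsub>G\<^esub> h) = inv\<^bsub>G\<^esub> g"
        using g h by (simp add: inv_mult_group flip: m_assoc)
      then show "act h (act (inv\<^bsub>G\<^esub> (g \<otimes>\<^bsub>G\<^esub> h)) (?Q (act (g \<otimes>\<^bsub>G\<^esub> h) x)))
          = act (inv\<^bsub>G\<^esub> g) (?Q (act g (act h x)))"
        using g h by (simp add: act_comp)
    qed (use h in \<open>simp_all add: m_assoc\<close>)
    then show ?thesis
      by (simp add: P_def lin_scale[OF lin_pushforward] lin_sum[OF lin_pushforward])
  qed
  ultimately show ?thesis by blast
qed

section \<open>The decomposition\<close>

lemma rep_iso_direct_sum_rep: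
  fixes V :: "'r \<Rightarrow> ('k::field, 's, 'v) rep" and U :: "'r \<Rightarrow> ('i \<Rightarrow>\<^sub>0 'k) set"
  assumes \<tau>: "\<And>r. r \<in> R \<Longrightarrow> models S (V r) (U r) \<beta> (\<tau> r)"
    and M: "M = {\<Sum>r\<in>R. x r | x. \<forall>r\<in>R. x r \<in> U r}"
    and indep: "\<And>x r. (\<And>r. r \<in> R \<Longrightarrow> x r \<in> U r) \<Longrightarrow> (\<Sum>r\<in>R. x r) = 0 \<Longrightarrow> r \<in> R \<Longrightarrow> x r = 0"
    and \<beta>: "\<And>s. s \<in> S \<Longrightarrow> lin (\<beta> s)"
  shows "rep_iso S (sub_rep M \<beta>) (direct_sum_rep R V)"
proof -
  let ?D = "direct_sum_rep R V"
  define g where "g \<phi> = (\<Sum>r\<in>R. \<tau> r (\<phi> r))" for \<phi>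
  have D: "rcarrier ?D = (\<Pi>\<^sub>E r\<in>R. rcarrier (V r))"
    "radd ?D = (\<lambda>f f'. \<lambda>r\<in>R. radd (V r) (f r) (f' r))"
    "rscale ?D = (\<lambda>c f. \<lambda>r\<in>R. rscale (V r) c (f r))"
    "ract ?D = (\<lambda>s f. \<lambda>r\<in>R. ract (V r) s (f r))"
    by (simp_all add: direct_sum_rep_def)
  have V: "\<phi> r \<in> rcarrier (V r)" if "\<phi> \<in> rcarrier ?D" "r \<in> R" for \<phi> r
    using that by (auto simp: D)
  have bij: "bij_betw g (rcarrier ?D) M"
    unfolding bij_betw_def
  proof
    show "inj_on g (rcarrier ?D)"
    proof (rule inj_onI)
      fix \<phi> \<psi> assume \<phi>: "\<phi> \<in> rcarrier ?D" and \<psi>: "\<psi> \<in> rcarrier ?D" and eq: "g \<phi> = g \<psi>"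
      have "\<phi> r = \<psi> r" if r: "r \<in> R" for r
      proof -
        have "\<tau> r (\<phi> r) - \<tau> r (\<psi> r) = 0"
        proof (rule indep[where x = "\<lambda>r. \<tau> r (\<phi> r) - \<tau> r (\<psi> r)", OF _ _ r])
          show "\<tau> r (\<phi> r) - \<tau> r (\<psi> r) \<in> U r" if r: "r \<in> R" for r
            by (intro free.subspace_diff[OF models_subspace[OF \<tau>[OF r]]] models_in[OF \<tau>[OF r]] V \<phi> \<psi> r)
          show "(\<Sum>r\<in>R. \<tau> r (\<phi> r) - \<tau> r (\<psi> r)) = 0" using eq by (simp add: g_def sum_subtractf)
        qed
        then show ?thesis
          using models_inj[OF \<tau>[OF r] V[OF \<phi> r] V[OF \<psi> r]] by simp
      qed
      then show "\<phi> = \<psi>" using \<phi> \<psi> unfolding D by (rule_tac PiE_ext) auto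
    qed
    show "g ` rcarrier ?D = M"
    proof (intro equalityI subsetI)
      fix y assume "y \<in> g ` rcarrier ?D"
      then obtain \<phi> where \<phi>: "\<phi> \<in> rcarrier ?D" "y = g \<phi>" by blast
      then have "\<forall>r\<in>R. \<tau> r (\<phi> r) \<in> U r" using models_in[OF \<tau>] V by blast
      then show "y \<in> M" unfolding M \<phi>(2) g_def by blast
    next
      fix y assume "y \<in> M"
      then obtain x where x: "y = (\<Sum>r\<in>R. x r)" "\<forall>r\<in>R. x r \<in> U r" unfolding M by blast
      have "\<forall>r\<in>R. \<exists>w\<in>rcarrier (V r). \<tau> r w = x r" using models_surj[OF \<tau>] x by blast
      then obtain w where w: "\<forall>r\<in>R. w r \<in> rcarrier (V r) \<and> \<tau> r (w r) = x r" by metis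
      then have "restrict w R \<in> rcarrier ?D" "g (restrict w R) = y"
        by (auto simp: D g_def x intro!: sum.cong)
      then show "y \<in> g ` rcarrier ?D" by blast
    qed
  qed
  define f where "f = inv_into (rcarrier ?D) g"
  have fbij: "bij_betw f M (rcarrier ?D)" unfolding f_def by (rule bij_betw_inv_into[OF bij])
  have fM: "f x \<in> rcarrier ?D" "g (f x) = x" if "x \<in> M" for x
    using that fbij bij by (auto simp: f_def bij_betw_def f_inv_into_f inv_into_into)
  have feq: "f x = \<phi>" if "\<phi> \<in> rcarrier ?D" "g \<phi> = x" for x \<phi>
    using that bij by (auto simp: f_def bij_betw_def)
  have "f \<in> rep_hom S (sub_rep M \<beta>) ?D"
    unfolding rep_hom_def mem_Collect_eq rcarrier_sub_rep radd_sub_rep rscale_sub_rep ract_sub_rep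
  proof (intro conjI ballI allI)
    fix x assume x: "x \<in> M"
    show "f x \<in> rcarrier ?D" by (rule fM(1)[OF x])
    show "f (x + y) = radd ?D (f x) (f y)" if y: "y \<in> M" for y
    proof (rule feq)
      show "radd ?D (f x) (f y) \<in> rcarrier ?D"
        using V[OF fM(1)[OF x]] V[OF fM(1)[OF y]] models_add_closed[OF \<tau>] by (simp add: D)
      have "g (radd ?D (f x) (f y)) = g (f x) + g (f y)"
        using V[OF fM(1)[OF x]] V[OF fM(1)[OF y]]
        by (simp add: D g_def models_add[OF \<tau>] flip: sum.distrib)
      then show "g (radd ?D (f x) (f y)) = x + y" using fM(2) x y by simp
    qed
    show "f (pscale c x) = rscale ?D c (f x)" for c
    proof (rule feq)
      show "rscale ?D c (f x) \<in> rcarrier ?D"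
        using V[OF fM(1)[OF x]] models_scale_closed[OF \<tau>] by (simp add: D)
      have "g (rscale ?D c (f x)) = pscale c (g (f x))"
        using V[OF fM(1)[OF x]] by (simp add: D g_def models_scale[OF \<tau>] free.scale_sum_right)
      then show "g (rscale ?D c (f x)) = pscale c x" using fM(2) x by simp
    qed
    show "f (\<beta> s x) = ract ?D s (f x)" if s: "s \<in> S" for s
    proof (rule feq)
      show "ract ?D s (f x) \<in> rcarrier ?D"
        using V[OF fM(1)[OF x]] models_act_closed[OF \<tau> s] by (simp add: D)
      have "g (ract ?D s (f x)) = \<beta> s (g (f x))"
        using V[OF fM(1)[OF x]] by (simp add: D g_def models_act[OF \<tau> s] lin_sum[OF \<beta>[OF s]])
      then show "g (ract ?D s (f x)) = \<beta> s x" using fM(2) x by simp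
    qed
  qed
  then show ?thesis using fbij unfolding rep_iso_def by auto
qed

lemma upt_map_Suc: "[1..<Suc (Suc n)] = 1 # map Suc [1..<Suc n]"
  by (simp add: map_Suc_upt upt_conv_Cons del: upt_Suc)

context equivariant_idempotents
begin

lemma chain_models_reduced_H0:
  assumes "C \<noteq> []" "set C \<subseteq> supports" "sorted_wrt (\<subset>) C" "\<And>Z. Z \<in> set (tl C) \<Longrightarrow> supp (b Z) = Z"
    and S: "S \<subseteq> carrier G" "\<And>g X. g \<in> S \<Longrightarrow> X \<in> set C \<Longrightarrow> supp_act \<alpha> g X = X"
  shows "chain_models S act C
    (map (\<lambda>i. reduced_H0 \<alpha> (b (C ! i)) (C ! (i - 1))) [1..<length C])
    (map (\<lambda>i. coset_map (homology_eval (C ! i) (C ! (i - 1)))) [1..<length C])"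
  using assms
proof (induction C rule: induct_list012)
  case (3 X Z C)
  have shift: "map (\<lambda>i. h ((X # Z # C) ! i) ((X # Z # C) ! (i - 1))) [1..<length (X # Z # C)]
      = h Z X # map (\<lambda>i. h ((Z # C) ! i) ((Z # C) ! (i - 1))) [1..<length (Z # C)]"
    for h :: "'b set \<Rightarrow> 'b set \<Rightarrow> 'z"
  proof -
    have "map (\<lambda>i. h ((X # Z # C) ! i) ((X # Z # C) ! (i - 1))) (map Suc [1..<Suc (length C)])
        = map (\<lambda>i. h ((Z # C) ! i) ((Z # C) ! (i - 1))) [1..<Suc (length C)]"
      by (auto simp: nth_Cons')
    then show ?thesis unfolding length_Cons upt_map_Suc by simp
  qed
  have "models S (reduced_H0 \<alpha> (b Z) X) (arrows Z X) act (coset_map (homology_eval Z X))"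
    by (rule models_reduced_H0) (use "3.prems" in auto)
  moreover have "chain_models S act (Z # C)
      (map (\<lambda>i. reduced_H0 \<alpha> (b ((Z # C) ! i)) ((Z # C) ! (i - 1))) [1..<length (Z # C)])
      (map (\<lambda>i. coset_map (homology_eval ((Z # C) ! i) ((Z # C) ! (i - 1)))) [1..<length (Z # C)])"
    by (rule "3.IH"(2)) (use "3.prems" in auto)
  ultimately show ?case
    unfolding shift[of "\<lambda>Z X. reduced_H0 \<alpha> (b Z) X"] shift[of "\<lambda>Z X. coset_map (homology_eval Z X)"]
    by simp
qed simp_all

lemma models_induced_tensor_reduced_H0:
  assumes C: "C \<in> strict_chains" and b: "\<And>Z. Z \<in> set (tl C) \<Longrightarrow> supp (b Z) = Z"
  shows "\<exists>t. models (carrier G)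
    (induced_rep G (chain_stabilizer G \<alpha> C)
      (tensor_rep (map (\<lambda>i. reduced_H0 \<alpha> (b (C ! i)) (C ! (i - 1))) [1..<length C])))
    (orbit_space C) act t"
proof -
  let ?H = "chain_stabilizer G \<alpha> C"
  note C' = strict_chainsD[OF C]
  have H: "?H \<subseteq> carrier G" "supp_act \<alpha> g X = X" if "g \<in> ?H" "X \<in> set C" for g X
    using that C'(1) by (auto simp: chain_stabilizer_def stabilizer_def)
  have HG: "?H \<subseteq> carrier G" using C'(1) by (auto simp: chain_stabilizer_eq)
  have cm: "chain_models ?H act C
    (map (\<lambda>i. reduced_H0 \<alpha> (b (C ! i)) (C ! (i - 1))) [1..<length C])
    (map (\<lambda>i. coset_map (homology_eval (C ! i) (C ! (i - 1)))) [1..<length C])"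
    by (rule chain_models_reduced_H0[OF C'(1-3) b HG H(2)])
  have e: "act s (E (last C)) = E (last C)" if "s \<in> ?H" for s
    using that HG C' H(2)[OF that, of "last C"] by (auto simp: E_invariant)
  show ?thesis
    using models_induced_rep[OF C models_tensor_rep[OF cm C'(2) e] chain_stabilizer_eq[OF C'(1)]]
      act_mult HG lin_pushforward by blast
qed

lemma mem_supp_orbit: "Z \<in> supp_orbit G \<alpha> X \<longleftrightarrow> (\<exists>g\<in>carrier G. Z = supp_act \<alpha> g X)"
  by (auto simp: supp_orbit_def orbit_def)

lemma self_in_supp_orbit: "X \<in> supp_orbit G \<alpha> X"
  unfolding mem_supp_orbit by (rule bexI[of _ "\<one>\<^bsub>G\<^esub>"]) (simp_all add: supp_act_one)

lemma supp_orbit_closed: "g \<in> carrier G \<Longrightarrow> Z \<in> supp_orbit G \<alpha> X \<Longrightarrow> supp_act \<alpha> g Z \<in> supp_orbit G \<alpha> X"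
  unfolding mem_supp_orbit using supp_act_comp m_closed by metis

lemma supp_orbit_eq:
  assumes "Z \<in> supp_orbit G \<alpha> X"
  shows "supp_orbit G \<alpha> Z = supp_orbit G \<alpha> X"
proof -
  obtain g where g: "g \<in> carrier G" "Z = supp_act \<alpha> g X" using assms by (auto simp: mem_supp_orbit)
  have "X = supp_act \<alpha> (inv\<^bsub>G\<^esub> g) Z" using g by (simp add: supp_act_comp supp_act_one)
  then have X: "X \<in> supp_orbit G \<alpha> Z" using g by (auto simp: mem_supp_orbit)
  have "supp_orbit G \<alpha> A \<subseteq> supp_orbit G \<alpha> B" if A: "A \<in> supp_orbit G \<alpha> B" for A B
  proof
    fix V assume "V \<in> supp_orbit G \<alpha> A"
    then obtain h where "h \<in> carrier G" "V = supp_act \<alpha> h A" by (auto simp: mem_supp_orbit)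
    then show "V \<in> supp_orbit G \<alpha> B" using supp_orbit_closed[OF _ A] by simp
  qed
  then show ?thesis using X assms by blast
qed

lemma supp_orbit_subset: "X \<in> supports \<Longrightarrow> supp_orbit G \<alpha> X \<subseteq> supports"
  by (auto simp: mem_supp_orbit)

lemma card_supp_orbit: "Z \<in> supp_orbit G \<alpha> X \<Longrightarrow> card Z = card X"
  by (auto simp: mem_supp_orbit supp_act_def intro!: card_image inj_on_subset[OF inj_alpha])

lemma chains_between_orbits:
  assumes "supp_orbit G \<alpha> X \<noteq> supp_orbit G \<alpha> Y"
  shows "chains_between (supp_orbit G \<alpha> X) (supp_orbit G \<alpha> Y)
    = {C \<in> strict_chains. hd C \<in> supp_orbit G \<alpha> X \<and> last C \<in> supp_orbit G \<alpha> Y}"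
proof -
  have "2 \<le> length C" if "C \<noteq> []" "hd C \<in> supp_orbit G \<alpha> X" "last C \<in> supp_orbit G \<alpha> Y" for C
  proof (rule ccontr)
    assume "\<not> 2 \<le> length C"
    then have "last C = hd C" using that(1) by (cases C rule: remdups_adj.cases) auto
    then show False using that supp_orbit_eq[of "hd C"] assms by metis
  qed
  then show ?thesis by (auto simp: chains_between_def strict_chains_def)
qed

lemma mult_orbit_idempotent:
  assumes "X \<in> supports" "C \<in> strict_chains" "u \<in> chain_space C"
  shows "u \<star> (\<Sum>X'\<in>supp_orbit G \<alpha> X. E X') = (if hd C \<in> supp_orbit G \<alpha> X then u else 0)"
proof -
  have "u \<star> (\<Sum>X'\<in>supp_orbit G \<alpha> X. E X') = (\<Sum>X'\<in>supp_orbit G \<alpha> X. if hd C = X' then u else 0)"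
    unfolding alg_mult_sum_right
    using supp_orbit_subset[OF assms(1)] by (intro sum.cong refl chain_space_mult_E assms) auto
  then show ?thesis using finite_subset[OF supp_orbit_subset[OF assms(1)]] by simp
qed

lemma orbit_idempotent_mult:
  assumes "Y \<in> supports" "C \<in> strict_chains" "u \<in> chain_space C"
  shows "(\<Sum>Y'\<in>supp_orbit G \<alpha> Y. E Y') \<star> u = (if last C \<in> supp_orbit G \<alpha> Y then u else 0)"
proof -
  have "(\<Sum>Y'\<in>supp_orbit G \<alpha> Y. E Y') \<star> u = (\<Sum>Y'\<in>supp_orbit G \<alpha> Y. if last C = Y' then u else 0)"
    unfolding alg_mult_sum_left
    using supp_orbit_subset[OF assms(1)] by (intro sum.cong refl E_mult_chain_space assms) auto
  then show ?thesis using finite_subset[OF supp_orbit_subset[OF assms(1)]] by simp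
qed

lemma
  assumes S: "S \<subseteq> strict_chains" "\<And>g C. g \<in> carrier G \<Longrightarrow> C \<in> S \<Longrightarrow> chain_act \<alpha> g C \<in> S"
    and R: "orbit_representatives G (chain_act \<alpha>) S R"
  shows orbit_representatives_cover: "S = (\<Union>r\<in>R. chain_orbit r)"
    and orbit_representatives_disjoint:
      "r \<in> R \<Longrightarrow> r' \<in> R \<Longrightarrow> C \<in> chain_orbit r \<Longrightarrow> C \<in> chain_orbit r' \<Longrightarrow> r = r'"
proof -
  have RS: "R \<subseteq> S" and unique: "\<And>C. C \<in> S \<Longrightarrow> \<exists>!r. r \<in> R \<and> r \<in> chain_orbit C"
    using R by (auto simp: orbit_representatives_def orbits_def chain_orbit_def)
  have sym: "r \<in> chain_orbit C" if C: "C \<in> chain_orbit r" for r C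
  proof -
    obtain g where g: "g \<in> carrier G" "C = chain_act \<alpha> g r" using C by (auto simp: mem_chain_orbit)
    then have "r = chain_act \<alpha> (inv\<^bsub>G\<^esub> g) C" by (simp add: chain_act_comp chain_act_one)
    then show ?thesis using g by (auto simp: mem_chain_orbit)
  qed
  have orbS: "chain_orbit r \<subseteq> S" if "r \<in> R" for r
    using that RS by (auto simp: mem_chain_orbit intro!: S(2))
  show "S = (\<Union>r\<in>R. chain_orbit r)"
  proof
    show "(\<Union>r\<in>R. chain_orbit r) \<subseteq> S" using orbS by blast
    show "S \<subseteq> (\<Union>r\<in>R. chain_orbit r)"
    proof
      fix C assume "C \<in> S"
      then obtain r where "r \<in> R" "r \<in> chain_orbit C" using unique[of C] by auto
      then show "C \<in> (\<Union>r\<in>R. chain_orbit r)" using sym by auto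
    qed
  qed
  show "r = r'" if r: "r \<in> R" "r' \<in> R" "C \<in> chain_orbit r" "C \<in> chain_orbit r'"
  proof -
    have "C \<in> S" using orbS[OF r(1)] r(3) by auto
    from unique[OF this] show ?thesis using r(1,2) sym[OF r(3)] sym[OF r(4)] by auto
  qed
qed

lemma orbit_spaces_sum:
  assumes XY: "X \<in> supports" "Y \<in> supports" "supp_orbit G \<alpha> X \<noteq> supp_orbit G \<alpha> Y"
    and R: "orbit_representatives G (chain_act \<alpha>)
      (chains_between (supp_orbit G \<alpha> X) (supp_orbit G \<alpha> Y)) R"
  shows "{(\<Sum>Y'\<in>supp_orbit G \<alpha> Y. E Y') \<star> a \<star> (\<Sum>X'\<in>supp_orbit G \<alpha> X. E X') | a. True}
      = {\<Sum>r\<in>R. x r | x. \<forall>r\<in>R. x r \<in> orbit_space r}" (is "?M = ?N")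
    and "\<And>x r. (\<And>r. r \<in> R \<Longrightarrow> x r \<in> orbit_space r) \<Longrightarrow> (\<Sum>r\<in>R. x r) = 0 \<Longrightarrow> r \<in> R \<Longrightarrow> x r = 0"
proof -
  let ?OX = "supp_orbit G \<alpha> X" and ?OY = "supp_orbit G \<alpha> Y"
  let ?eX = "\<Sum>X'\<in>?OX. E X'" and ?eY = "\<Sum>Y'\<in>?OY. E Y'"
  define S where "S = chains_between ?OX ?OY"
  have S_eq: "S = {C \<in> strict_chains. hd C \<in> ?OX \<and> last C \<in> ?OY}"
    unfolding S_def by (rule chains_between_orbits[OF XY(3)])
  then have S: "S \<subseteq> strict_chains" by auto
  have S_act: "chain_act \<alpha> g C \<in> S" if g: "g \<in> carrier G" and C: "C \<in> S" for g C
  proof -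
    have "hd (chain_act \<alpha> g C) = supp_act \<alpha> g (hd C)" "last (chain_act \<alpha> g C) = supp_act \<alpha> g (last C)"
      using strict_chainsD(1)[OF subsetD[OF S C]] by (simp_all add: chain_act_def hd_map last_map)
    then show ?thesis using g C by (simp add: S_eq supp_orbit_closed)
  qed
  have cover: "S = (\<Union>r\<in>R. chain_orbit r)"
    by (rule orbit_representatives_cover[OF S _ R[folded S_def]]) (rule S_act)
  have disjoint: "r = r'" if "r \<in> R" "r' \<in> R" "C \<in> chain_orbit r" "C \<in> chain_orbit r'" for r r' C
    by (rule orbit_representatives_disjoint[OF S _ R[folded S_def] that]) (rule S_act)
  have finS: "finite S" using S finite_strict_chains by (rule finite_subset)
  have orbS: "chain_orbit r \<subseteq> S" if "r \<in> R" for r using cover that by blast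
  have finO: "finite (chain_orbit r)" if "r \<in> R" for r using orbS[OF that] finS by (rule finite_subset)
  have finR: "finite R"
  proof (rule finite_subset[OF _ finS])
    show "R \<subseteq> S" using R[folded S_def] by (simp add: orbit_representatives_def)
  qed
  have cut: "?eY \<star> u \<star> ?eX = (if C \<in> S then u else 0)"
    if "C \<in> strict_chains" "u \<in> chain_space C" for C u
    using that by (simp add: orbit_idempotent_mult[OF XY(2)] mult_orbit_idempotent[OF XY(1)] S_eq alg_mult_linear)
  show "?M = ?N"
  proof (intro equalityI subsetI)
    fix y assume "y \<in> ?M"
    then obtain a where y: "y = ?eY \<star> a \<star> ?eX" by blast
    obtain u where u: "\<And>C. C \<in> strict_chains \<Longrightarrow> u C \<in> chain_space C" and a: "a = (\<Sum>C\<in>strict_chains. u C)"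
      using chain_spaces_span[of a] by blast
    have "y = (\<Sum>C\<in>strict_chains. ?eY \<star> u C \<star> ?eX)"
      unfolding y a alg_mult_sum_right[of ?eY] unfolding alg_mult_sum_left[of "\<lambda>C. ?eY \<star> u C"] ..
    also have "\<dots> = (\<Sum>C\<in>strict_chains. if C \<in> S then u C else 0)"
      by (intro sum.cong refl cut u)
    also have "\<dots> = (\<Sum>C\<in>S. u C)"
      using S by (simp add: sum.inter_restrict[symmetric] Int_absorb1)
    also have "\<dots> = (\<Sum>r\<in>R. \<Sum>C\<in>chain_orbit r. u C)"
    proof (subst cover, rule sum.UNION_disjoint[OF finR])
      show "\<forall>r\<in>R. finite (chain_orbit r)" using finO by blast
      show "\<forall>r\<in>R. \<forall>r'\<in>R. r \<noteq> r' \<longrightarrow> chain_orbit r \<inter> chain_orbit r' = {}" using disjoint by blast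
    qed
    finally have "y = (\<Sum>r\<in>R. \<Sum>C\<in>chain_orbit r. u C)" .
    moreover have "\<forall>r\<in>R. (\<Sum>C\<in>chain_orbit r. u C) \<in> orbit_space r"
      using u orbS S unfolding orbit_space_def by blast
    ultimately show "y \<in> ?N" by blast
  next
    fix y assume "y \<in> ?N"
    then obtain x where x: "y = (\<Sum>r\<in>R. x r)" "\<forall>r\<in>R. x r \<in> orbit_space r" by blast
    have "?eY \<star> x r \<star> ?eX = x r" if r: "r \<in> R" for r
    proof -
      obtain u where u: "x r = (\<Sum>C\<in>chain_orbit r. u C)" "\<forall>C\<in>chain_orbit r. u C \<in> chain_space C"
        using x(2) r unfolding orbit_space_def by blast
      have "?eY \<star> x r \<star> ?eX = (\<Sum>C\<in>chain_orbit r. ?eY \<star> u C \<star> ?eX)"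
        unfolding u(1) alg_mult_sum_right[of ?eY] unfolding alg_mult_sum_left[of "\<lambda>C. ?eY \<star> u C"] ..
      also have "\<dots> = x r"
        unfolding u(1)
      proof (rule sum.cong[OF refl])
        fix C assume C: "C \<in> chain_orbit r"
        then have "C \<in> S" using orbS[OF r] by blast
        then show "?eY \<star> u C \<star> ?eX = u C" using cut[of C "u C"] S u(2) C by auto
      qed
      finally show ?thesis .
    qed
    then have "y = (\<Sum>r\<in>R. ?eY \<star> x r \<star> ?eX)" by (simp add: x(1))
    also have "\<dots> = ?eY \<star> y \<star> ?eX"
      unfolding x(1) alg_mult_sum_right[of ?eY] unfolding alg_mult_sum_left[of "\<lambda>r. ?eY \<star> x r"] ..
    finally show "y \<in> ?M" by blast
  qed
  fix x r
  assume x: "\<And>r. r \<in> R \<Longrightarrow> x r \<in> orbit_space r" and x0: "(\<Sum>r\<in>R. x r) = 0" and r: "r \<in> R"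
  have "\<forall>r\<in>R. \<exists>u. x r = (\<Sum>C\<in>chain_orbit r. u C) \<and> (\<forall>C\<in>chain_orbit r. u C \<in> chain_space C)"
    using x unfolding orbit_space_def by blast
  then obtain u where u: "\<And>r. r \<in> R \<Longrightarrow> x r = (\<Sum>C\<in>chain_orbit r. u r C)"
    "\<And>r C. r \<in> R \<Longrightarrow> C \<in> chain_orbit r \<Longrightarrow> u r C \<in> chain_space C"
    by (metis (no_types, lifting))
  define w where "w C = (\<Sum>r\<in>R. if C \<in> chain_orbit r then u r C else 0)" for C
  have w: "w C \<in> chain_space C" for C
    unfolding w_def using u(2) free.subspace_0[OF subspace_chain_space]
    by (intro free.subspace_sum[OF subspace_chain_space]) auto
  have "(\<Sum>C\<in>strict_chains. w C) = (\<Sum>r\<in>R. \<Sum>C\<in>strict_chains. if C \<in> chain_orbit r then u r C else 0)"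
    unfolding w_def by (rule sum.swap)
  also have "\<dots> = (\<Sum>r\<in>R. x r)"
  proof (rule sum.cong[OF refl])
    fix r assume r: "r \<in> R"
    have "chain_orbit r \<subseteq> strict_chains" using orbS[OF r] S by blast
    then show "(\<Sum>C\<in>strict_chains. if C \<in> chain_orbit r then u r C else 0) = x r"
      by (simp add: u(1)[OF r] sum.inter_restrict[symmetric] Int_absorb1)
  qed
  finally have w_sum: "(\<Sum>C\<in>strict_chains. w C) = 0" using x0 by simp
  have "u r C = 0" if C: "C \<in> chain_orbit r" for C
  proof -
    have "w C = (\<Sum>r'\<in>R. if r' = r then u r C else 0)"
      unfolding w_def
    proof (rule sum.cong[OF refl])
      fix r' assume r': "r' \<in> R"
      show "(if C \<in> chain_orbit r' then u r' C else 0) = (if r' = r then u r C else 0)"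
      proof (cases "r' = r")
        case False
        then have "C \<notin> chain_orbit r'" using disjoint[OF r' r _ C] by blast
        then show ?thesis using False by simp
      qed (simp add: C)
    qed
    then have "w C = u r C" using finR r by simp
    moreover have "w C = 0"
      by (rule chain_spaces_independent[of w, OF w w_sum subsetD[OF S subsetD[OF orbS[OF r] C]]])
    ultimately show ?thesis by simp
  qed
  then show "x r = 0" by (simp add: u(1)[OF r])
qed

end

theorem theorem7p7:
  fixes G :: "('g, 'm) monoid_scheme"
    and \<alpha> :: "'g \<Rightarrow> 'b::left_regular_band \<Rightarrow> 'b"
    and E :: "'b set \<Rightarrow> ('b \<Rightarrow>\<^sub>0 'k::field)"
    and b :: "'b set \<Rightarrow> 'b"
    and X Y :: "'b set"
    and R :: "'b set list set"
  assumes "k_hereditary TYPE('k) TYPE('b)"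
    and "finite (carrier G)"
    and "acts_by_automorphisms G \<alpha>"
    and "\<not> CHAR('k) dvd order G"
    and "cfpoi E" and "standardly_indexed E" and "invariant_family G \<alpha> E"
    and "X \<in> supports" and "Y \<in> supports"
    and "orbit_less (supp_orbit G \<alpha> X) (supp_orbit G \<alpha> Y)"
    and "\<And>Z. Z \<in> supports \<Longrightarrow> orbit_less (supp_orbit G \<alpha> X) (supp_orbit G \<alpha> Z) \<Longrightarrow>
           orbit_le (supp_orbit G \<alpha> Z) (supp_orbit G \<alpha> Y) \<Longrightarrow> supp (b Z) = Z"
    and "orbit_representatives G (chain_act \<alpha>)
           (chains_between (supp_orbit G \<alpha> X) (supp_orbit G \<alpha> Y)) R"
  shows "rep_iso (carrier G)
    (sub_rep
      {(\<Sum>Y'\<in>supp_orbit G \<alpha> Y. E Y') \<star> a \<star> (\<Sum>X'\<in>supp_orbit G \<alpha> X. E X') | a. True}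
      (\<lambda>g. pushforward (\<alpha> g)))
    (direct_sum_rep R (\<lambda>C.
      induced_rep G (chain_stabilizer G \<alpha> C)
        (tensor_rep
          (map (\<lambda>i. reduced_H0 \<alpha> (b (C ! i)) (C ! (i - 1))) [1..<length C]))))"
proof -
  have idem: "band_idempotents E" by (rule band_idempotents_cfpoi[OF assms(5,6)])
  have "group G"
    using assms(3) by (simp add: acts_by_automorphisms_def group_action_def group_hom_def)
  then have action: "band_action G \<alpha>"
    using assms(3) by (simp add: band_action_def band_action_axioms_def)
  have inv: "pushforward (\<alpha> g) (E X) = E (supp_act \<alpha> g X)" if "g \<in> carrier G" "X \<in> supports" for g X
    using assms(7) that by (simp add: invariant_family_def)
  have "of_nat (order G) \<noteq> (0 :: 'k)" using assms(4) by (simp add: of_nat_eq_0_iff_char_dvd)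
  from equivariant_projection_exists[OF idem action assms(2) this inv] obtain P
    where P: "lin P" "\<forall>x. P x \<in> rad_sq" "\<forall>x\<in>rad_sq. P x = x"
      "\<forall>Y\<in>supports. \<forall>x. P (E Y \<star> x) = E Y \<star> P x" "\<forall>X\<in>supports. \<forall>x. P (x \<star> E X) = P x \<star> E X"
      "\<forall>g\<in>carrier G. \<forall>x. P (pushforward (\<alpha> g) x) = pushforward (\<alpha> g) (P x)"
    by blast
  have hered: "projective (sub_rep (L :: ('b \<Rightarrow>\<^sub>0 'k) set) left_mult)" if "left_ideal L" for L
    using assms(1) that by (simp add: k_hereditary_def)
  have "hereditary_idempotents_axioms E P"
    by (rule hereditary_idempotents_axioms.intro)
      (fact hered P(1) P(2-5)[rule_format])+
  moreover have "equivariant_idempotents_axioms E P G \<alpha>"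
    by (rule equivariant_idempotents_axioms.intro) (fact inv P(6)[rule_format])+
  ultimately interpret equivariant_idempotents E P G \<alpha>
    using idem action by (simp add: equivariant_idempotents_def hereditary_idempotents_def)
  let ?OX = "supp_orbit G \<alpha> X" and ?OY = "supp_orbit G \<alpha> Y"
  have neq: "?OX \<noteq> ?OY" using assms(10) by (simp add: orbit_less_def)
  have ex: "\<exists>t. models (carrier G)
      (induced_rep G (chain_stabilizer G \<alpha> C)
        (tensor_rep (map (\<lambda>i. reduced_H0 \<alpha> (b (C ! i)) (C ! (i - 1))) [1..<length C])))
      (orbit_space C) act t" (is "\<exists>t. ?models C t") if C: "C \<in> R" for C
  proof (rule models_induced_tensor_reduced_H0)
    have C': "C \<in> strict_chains" "hd C \<in> ?OX" "last C \<in> ?OY"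
      using C assms(12) unfolding orbit_representatives_def chains_between_orbits[OF neq] by auto
    show "C \<in> strict_chains" by (rule C'(1))
    note sc = strict_chainsD[OF C'(1)]
    fix Z assume Z: "Z \<in> set (tl C)"
    obtain D where D: "C = hd C # D" using sc(1) by (cases C) auto
    have hdZ: "hd C \<subset> Z" using sc(3) Z D by (metis list.sel(3) sorted_wrt.simps(2))
    have "Z \<subseteq> last C"
    proof -
      have "Z \<in> set C" by (rule list.set_sel(2)[OF sc(1) Z])
      then obtain xs ys where xs: "C = xs @ Z # ys" by (auto simp: in_set_conv_decomp)
      show ?thesis
      proof (cases "ys = []")
        case False
        then have "last ys \<in> set ys" "last C = last ys" by (simp_all add: xs)
        moreover have "\<forall>V\<in>set ys. Z \<subset> V" using sc(3) by (simp add: xs sorted_wrt_append)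
        ultimately show ?thesis by auto
      qed (simp add: xs)
    qed
    have "?OX \<noteq> supp_orbit G \<alpha> Z"
    proof
      assume "?OX = supp_orbit G \<alpha> Z"
      then have "Z \<in> ?OX" by (simp add: self_in_supp_orbit)
      then show False
        using card_supp_orbit[of Z X] card_supp_orbit[OF C'(2)] psubset_card_mono[OF finite hdZ] by simp
    qed
    then have "orbit_less ?OX (supp_orbit G \<alpha> Z)"
      unfolding orbit_less_def orbit_le_def using C'(2) hdZ self_in_supp_orbit[of Z] by blast
    moreover have "orbit_le (supp_orbit G \<alpha> Z) ?OY"
      unfolding orbit_le_def using C'(3) \<open>Z \<subseteq> last C\<close> self_in_supp_orbit[of Z] by blast
    moreover have "Z \<in> supports" using list.set_sel(2)[OF sc(1) Z] sc(2) by blast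
    ultimately show "supp (b Z) = Z" by (rule assms(11)[rotated 1])
  qed
  define \<tau> where "\<tau> C = (SOME t. ?models C t)" for C
  have \<tau>: "?models C (\<tau> C)" if "C \<in> R" for C
    unfolding \<tau>_def by (rule someI_ex[OF ex[OF that]])
  note sums = orbit_spaces_sum[OF assms(8,9) neq assms(12)]
  show ?thesis
    by (rule rep_iso_direct_sum_rep[where U = orbit_space and \<tau> = \<tau>, OF _ sums(1)])
      (fact \<tau>, rule sums(2), auto intro: lin_pushforward)
qed

end
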